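(* Let $q\in(0,1)$, let $n$ be a positive integer, and let $\{A_i,\ i=1,\dots,n\}$ be a family of operators on a Hilbert space $\mathcal{H}$ defining a well-behaved representation of $\mathcal{O}_n^q$. Let $A_i=S_i|A_i|$ be the polar decomposition of $A_i$ and put $D_i=S_i|A_i|S_i^*$, $i=1,\dots,n$. Then: (a) $f(D_i^2)S_i=S_if(1+qD_i^2)$ for every $i$ and every real bounded measurable function $f$ on $\mathbb{R}$; (b) for any $i,j$ the operators $|A_i|$ and $|A_j|$ commute in the sense of resolutions of identity (i.e. their spectral projections commute); (c) $S_i^*S_j=\delta_{ij}I$ for all $i,j$.
   Context: $\mathcal{O}_n^q$ is the $*$-algebra generated by $a_i,a_i^*$, $i=1,\dots,n$, with relations $a_i^*a_i=1+q\,a_ia_i^*$ and $a_i^*a_j=0$ for $i\ne j$, where $0<q<1$. Definition (well-behaved representation). A family $\{A_i,\ i=1,\dots,n\}$ of closed operators on a Hilbert space $\mathcal{H}$ defines a well-behaved representation of $\mathcal{O}_n^q$ if (1) there exists a dense linear subset $\mathcal{D}\subset\mathcal{H}$ which is invariant with respect to $A_1,\dots,A_n,A_1^*,\dots,A_n^*$ (in particular $\mathcal{D}$ is contained in the domains of all these operators); (2) $A_i^*A_ix=(1+qA_iA_i^* )x$ and $A_i^*A_jx=0$ for $i\neq j$, $i,j=1,\dots,n$, $x\in\mathcal{D}$; (3) the positive linear operator $\Delta=\sum_{i=1}^nA_i^*A_i$ is essentially selfadjoint on $\mathcal{D}$. In the polar decomposition $A_i=S_i|A_i|$, $|A_i|=(A_i^*A_i)^{1/2}$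 and $S_i$ is the partial isometry with $\ker S_i=\ker|A_i|$. Functions of selfadjoint operators are defined by the Borel functional calculus. *)

theory Defs
  imports "HOL-Analysis.Analysis"
begin

text \<open>Complex Hilbert spaces. The inner product is conjugate-linear in the first argument;
  its real part is the library's real inner product, so that norm, topology and completeness
  are the library's.\<close>

class complex_hilbert = real_inner + complete_space +
  fixes scaleC :: "complex \<Rightarrow> 'a \<Rightarrow> 'a"
    and cinner :: "'a \<Rightarrow> 'a \<Rightarrow> complex"
  assumes scaleC_add_right: "scaleC c (x + y) = scaleC c x + scaleC c y"
    and scaleC_add_left: "scaleC (c + d) x = scaleC c x + scaleC d x"
    and scaleC_scaleC: "scaleC c (scaleC d x) = scaleC (c * d) x"
    and scaleC_of_real: "scaleC (of_real r) x = r *\<^sub>R x"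
    and cinner_commute: "cinner x y = cnj (cinner y x)"
    and cinner_add_right: "cinner x (y + z) = cinner x y + cinner x z"
    and cinner_scaleC_right: "cinner x (scaleC c y) = c * cinner x y"
    and Re_cinner: "Re (cinner x y) = inner x y"

instantiation complex :: complex_hilbert
begin

definition "scaleC_complex (c :: complex) (x :: complex) = c * x"
definition "cinner_complex (x :: complex) (y :: complex) = cnj x * y"

instance
  by standard
    (auto simp: scaleC_complex_def cinner_complex_def inner_complex_def scaleR_conv_of_real
      algebra_simps)

end

definition csubspace :: "'a::complex_hilbert set \<Rightarrow> bool" where
  "csubspace D \<longleftrightarrow> 0 \<in> D \<and> (\<forall>x\<in>D. \<forall>y\<in>D. x + y \<in> D) \<and> (\<forall>c. \<forall>x\<in>D. scaleC c x \<in> D)"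


text \<open>An unbounded operator is its graph; its domain is \<open>Domain T\<close>, and equality of
  operators includes equality of domains. A closed operator is one satisfying \<open>closed T\<close>,
  and the closure of \<open>T\<close> is \<open>closure T\<close>, both in the product topology.\<close>

type_synonym 'a oper = "('a \<times> 'a) set"

definition linear_op :: "'a::complex_hilbert oper \<Rightarrow> bool" where
  "linear_op T \<longleftrightarrow> single_valued T \<and> (0, 0) \<in> T \<and>
     (\<forall>x y u v. (x, y) \<in> T \<longrightarrow> (u, v) \<in> T \<longrightarrow> (x + u, y + v) \<in> T) \<and>
     (\<forall>c x y. (x, y) \<in> T \<longrightarrow> (scaleC c x, scaleC c y) \<in> T)"

definition op_comp :: "'a oper \<Rightarrow> 'a oper \<Rightarrow> 'a oper" (infixr "\<odot>" 75) where
  "S \<odot> T = T O S"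

definition op_add :: "'a::complex_hilbert oper \<Rightarrow> 'a oper \<Rightarrow> 'a oper" (infixl "\<oplus>" 65) where
  "S \<oplus> T = {(x, y + z) | x y z. (x, y) \<in> S \<and> (x, z) \<in> T}"

definition op_scale :: "complex \<Rightarrow> 'a::complex_hilbert oper \<Rightarrow> 'a oper" (infixr "\<cdot>" 70) where
  "c \<cdot> T = {(x, scaleC c y) | x y. (x, y) \<in> T}"

definition op_sum :: "('i \<Rightarrow> 'a::complex_hilbert oper) \<Rightarrow> 'i set \<Rightarrow> 'a oper" where
  "op_sum T I = {(x, \<Sum>i\<in>I. y i) | x y. \<forall>i\<in>I. (x, y i) \<in> T i}"

definition op_restrict :: "'a oper \<Rightarrow> 'a set \<Rightarrow> 'a oper" where
  "op_restrict T D = {(x, y) \<in> T. x \<in> D}"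

definition op_kernel :: "'a::complex_hilbert oper \<Rightarrow> 'a set" where
  "op_kernel T = {x. (x, 0) \<in> T}"

text \<open>This is an operator (single-valued) exactly when the domain of \<open>T\<close> is dense.\<close>

definition adj :: "'a::complex_hilbert oper \<Rightarrow> 'a oper" where
  "adj T = {(y, z). \<forall>(x, w)\<in>T. cinner y w = cinner z x}"

definition selfadjoint :: "'a::complex_hilbert oper \<Rightarrow> bool" where
  "selfadjoint T \<longleftrightarrow> linear_op T \<and> adj T = T"

definition ess_selfadjoint_on :: "'a::complex_hilbert oper \<Rightarrow> 'a set \<Rightarrow> bool" where
  "ess_selfadjoint_on T D \<longleftrightarrow> selfadjoint (closure (op_restrict T D))"

definition bounded_op :: "'a::complex_hilbert oper \<Rightarrow> bool" where
  "bounded_op T \<longleftrightarrow> linear_op T \<and> Domain T = UNIV \<and> (\<exists>K. \<forall>(x, y)\<in>T. norm y \<le> K * norm x)"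

definition partial_isometry :: "'a::complex_hilbert oper \<Rightarrow> bool" where
  "partial_isometry S \<longleftrightarrow> bounded_op S \<and>
     (\<forall>(x, y)\<in>S. (\<forall>u\<in>op_kernel S. cinner u x = 0) \<longrightarrow> norm y = norm x)"


text \<open>Projection-valued measures on the Borel sets of the line, and the integrals
  \<open>\<integral> f dE\<close>. The value 0 off the Borel sets is a convention that makes
  the resolution of the identity of a selfadjoint operator unique.\<close>

definition orth_projection :: "('a::complex_hilbert \<Rightarrow> 'a) \<Rightarrow> bool" where
  "orth_projection P \<longleftrightarrow>
     (\<forall>x y. P (x + y) = P x + P y) \<and> (\<forall>c x. P (scaleC c x) = scaleC c (P x)) \<and>
     (\<forall>x. P (P x) = P x) \<and> (\<forall>x y. cinner (P x) y = cinner x (P y))"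

definition proj_valued_measure :: "(real set \<Rightarrow> 'a::complex_hilbert \<Rightarrow> 'a) \<Rightarrow> bool" where
  "proj_valued_measure E \<longleftrightarrow>
     (\<forall>B\<in>sets borel. orth_projection (E B)) \<and>
     (\<forall>x. E UNIV x = x) \<and>
     (\<forall>B :: nat \<Rightarrow> real set. range B \<subseteq> sets borel \<longrightarrow> disjoint_family B \<longrightarrow>
        (\<forall>x. (\<lambda>k. E (B k) x) sums E (\<Union>k. B k) x)) \<and>
     (\<forall>B. B \<notin> sets borel \<longrightarrow> (\<forall>x. E B x = 0))"

text \<open>The measure \<open>B \<mapsto> \<langle>x, E(B) x\<rangle>\<close>.\<close>

definition scalar_measure :: "(real set \<Rightarrow> 'a::complex_hilbert \<Rightarrow> 'a) \<Rightarrow> 'a \<Rightarrow> real measure" where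
  "scalar_measure E x =
     measure_of UNIV (sets borel) (\<lambda>B. ennreal (Re (cinner x (E B x))))"

text \<open>\<open>R = \<integral> f dE\<close>: its domain is \<open>{x. \<integral> f\<^sup>2 d\<langle>x, E x\<rangle> < \<infinity>}\<close>, and there
  \<open>\<langle>x, R x\<rangle> = \<integral> f d\<langle>x, E x\<rangle>\<close>, which determines \<open>R\<close> by polarization.\<close>

definition is_spectral_integral ::
    "(real set \<Rightarrow> 'a::complex_hilbert \<Rightarrow> 'a) \<Rightarrow> (real \<Rightarrow> real) \<Rightarrow> 'a oper \<Rightarrow> bool" where
  "is_spectral_integral E f R \<longleftrightarrow> linear_op R \<and>
     Domain R = {x. integrable (scalar_measure E x) (\<lambda>t. (f t)\<^sup>2)} \<and>
     (\<forall>(x, y)\<in>R. cinner x y = complex_of_real (integral\<^sup>L (scalar_measure E x) f))"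

definition spectral_integral ::
    "(real set \<Rightarrow> 'a::complex_hilbert \<Rightarrow> 'a) \<Rightarrow> (real \<Rightarrow> real) \<Rightarrow> 'a oper" where
  "spectral_integral E f = (THE R. is_spectral_integral E f R)"

text \<open>The resolution of the identity of a selfadjoint \<open>T\<close>: the unique \<open>E\<close> with
  \<open>T = \<integral> t dE(t)\<close>.\<close>

definition resolution_of_identity ::
    "'a::complex_hilbert oper \<Rightarrow> real set \<Rightarrow> 'a \<Rightarrow> 'a" where
  "resolution_of_identity T =
     (THE E. proj_valued_measure E \<and> is_spectral_integral E (\<lambda>t. t) T)"

definition borel_calculus :: "(real \<Rightarrow> real) \<Rightarrow> 'a::complex_hilbert oper \<Rightarrow> 'a oper" where
  "borel_calculus f T = spectral_integral (resolution_of_identity T) f"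

definition spectral_projections_commute ::
    "'a::complex_hilbert oper \<Rightarrow> 'a oper \<Rightarrow> bool" where
  "spectral_projections_commute T U \<longleftrightarrow>
     (\<forall>B\<in>sets borel. \<forall>C\<in>sets borel.
        resolution_of_identity T B \<circ> resolution_of_identity U C =
        resolution_of_identity U C \<circ> resolution_of_identity T B)"

text \<open>The library's \<open>sqrt\<close> is odd, but its values on the negative half-line do not matter:
  \<open>A\<^sup>* A\<close> is positive.\<close>

definition op_abs :: "'a::complex_hilbert oper \<Rightarrow> 'a oper" where
  "op_abs A = borel_calculus sqrt (adj A \<odot> A)"

text \<open>\<open>A = S |A|\<close> is the polar decomposition of \<open>A\<close>.\<close>

definition polar_decomposition :: "'a::complex_hilbert oper \<Rightarrow> 'a oper \<Rightarrow> bool" where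
  "polar_decomposition A S \<longleftrightarrow>
     partial_isometry S \<and> op_kernel S = op_kernel (op_abs A) \<and> A = S \<odot> op_abs A"


definition invariant_under :: "'a set \<Rightarrow> 'a oper \<Rightarrow> bool" where
  "invariant_under D T \<longleftrightarrow> D \<subseteq> Domain T \<and> T `` D \<subseteq> D"

definition well_behaved_rep ::
    "real \<Rightarrow> nat \<Rightarrow> (nat \<Rightarrow> 'a::complex_hilbert oper) \<Rightarrow> bool" where
  "well_behaved_rep q n A \<longleftrightarrow>
     (\<forall>i\<in>{1..n}. linear_op (A i) \<and> closed (A i)) \<and>
     (\<exists>D. csubspace D \<and> closure D = UNIV \<and>
        (\<forall>i\<in>{1..n}. invariant_under D (A i) \<and> invariant_under D (adj (A i))) \<and>
        (\<forall>i\<in>{1..n}. op_restrict (adj (A i) \<odot> A i) D =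
           op_restrict (Id \<oplus> complex_of_real q \<cdot> (A i \<odot> adj (A i))) D) \<and>
        (\<forall>i\<in>{1..n}. \<forall>j\<in>{1..n}. i \<noteq> j \<longrightarrow>
           op_restrict (adj (A i) \<odot> A j) D = op_restrict (0 \<cdot> Id) D) \<and>
        ess_selfadjoint_on (op_sum (\<lambda>i. adj (A i) \<odot> A i) {1..n}) D)"

end

theory Submission
  imports Defs "HOL-Probability.Helly_Selection" "HOL-Probability.Probability_Mass_Function"
    "HOL-Computational_Algebra.Polynomial"
begin

text \<open>
  Write \<open>N\<^sub>j = A\<^sub>j A\<^sub>j\<^sup>*\<close>. On the invariant domain \<open>K\<close> the relations say
  \<open>A\<^sub>j\<^sup>* A\<^sub>j = 1 + q N\<^sub>j\<close> and \<open>N\<^sub>i N\<^sub>j = 0\<close> for \<open>i \<noteq> j\<close>. The heart of the proof is that these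
  identities on \<open>K\<close> are identities of selfadjoint operators. Suppose that \<open>y\<close> is orthogonal to
  \<open>(1 + A\<^sub>i\<^sup>* A\<^sub>i) K\<close>. Testing this against the vectors \<open>N\<^sub>j x\<close> gives \<open>\<langle>N\<^sub>j x, y\<rangle> = 0\<close> for
  \<open>j \<noteq> i\<close>, hence \<open>\<langle>\<Delta> x, y\<rangle> = (n - 2) \<langle>x, y\<rangle>\<close> on \<open>K\<close>. As \<open>\<Delta>\<close> is essentially selfadjoint on \<open>K\<close>,
  \<open>y\<close> is an eigenvector of its closure for \<open>n - 2\<close>; but \<open>\<Delta> \<ge> n\<close>, so \<open>y = 0\<close> (\<open>no_defect\<close>).
  It follows that each \<open>A\<^sub>i\<^sup>* A\<^sub>i\<close> is selfadjoint with core \<open>K\<close>, that it equals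
  \<open>1 + q A\<^sub>i A\<^sub>i\<^sup>*\<close> including domains (\<open>commutation_relation\<close>), and that the ranges of \<open>A\<^sub>i\<close> and
  \<open>A\<^sub>j\<close> are orthogonal (\<open>range_orthogonal\<close>).

  The three assertions are then short. Since \<open>A\<^sub>i\<^sup>* A\<^sub>i \<ge> 1\<close>, the kernel of \<open>|A\<^sub>i|\<close> is zero,
  so \<open>S\<^sub>i\<close> is an isometry onto the closed range of \<open>A\<^sub>i\<close>; this is (c). The operator
  \<open>(1 + A\<^sub>i\<^sup>* A\<^sub>i)\<^sup>-\<^sup>1 - 1/2\<close> maps into the range of \<open>A\<^sub>i\<close>, so two of these operators with
  different indices have product zero, the resolvents commute, and with them all functions; this is
  (b). Finally \<open>D\<^sub>i\<^sup>2 = S\<^sub>i (A\<^sub>i\<^sup>* A\<^sub>i) S\<^sub>i\<^sup>* = A\<^sub>i A\<^sub>i\<^sup>*\<close>, so \<open>1 + q D\<^sub>i\<^sup>2 = A\<^sub>i\<^sup>* A\<^sub>i\<close>, and \<open>S\<^sub>i\<close>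
  intertwines the resolvents of \<open>A\<^sub>i\<^sup>* A\<^sub>i\<close> and \<open>D\<^sub>i\<^sup>2\<close>, hence their functions; this is (a).

  Functions and spectral projections are defined by descriptions, so all of this needs the spectral
  theorem for a positive selfadjoint \<open>T\<close>, with existence and uniqueness. It is obtained from the
  bounded operator \<open>C = (1 + T)\<^sup>-\<^sup>1\<close>, for which \<open>0 \<le> C \<le> 1\<close>. The numbers
  \<open>\<langle>x, C\<^sup>k x\<rangle>\<close> are moments of a measure \<open>\<mu>\<^sub>x\<close> on \<open>[0, 1]\<close> by Hausdorff's criterion
  (\<open>moment_measure\<close>). Polynomials are dense in \<open>L\<^sup>2(\<mu>\<^sub>x)\<close>, and \<open>p \<mapsto> p(C) x\<close> is isometric from
  \<open>L\<^sup>2(\<mu>\<^sub>x)\<close>; its continuous extension defines \<open>f(C) x\<close> for every \<open>f \<in> L\<^sup>2(\<mu>\<^sub>x)\<close>, bounded or not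
  (\<open>fcalc\<close>). As \<open>T = 1/C - 1\<close> in this calculus (\<open>T_eq_fgraph\<close>), the indicator
  functions give a resolution of the identity of \<open>T\<close>. Any other one commutes with \<open>T\<close>, hence with
  the first, and a vector in the range of one over a set and of the other over a separated set would
  have two incompatible values of \<open>\<langle>x, T x\<rangle>\<close>; so the two agree (\<open>resolution_unique\<close>).\<close>

section \<open>The moment problem on the unit interval\<close>

text \<open>The \<open>j\<close>-th factorial moment of a binomial distribution, as a polynomial identity: it holds in
  every commutative ring, and is used in the ring of polynomials. The reason is
  \<open>(n choose k) (k choose j) = (n choose j) (n - j choose k - j)\<close>.\<close>
lemma binomial_sum_choose:
  fixes a b :: "'a::comm_ring_1"
  assumes "j \<le> n"
  shows "(\<Sum>k\<le>n. of_nat (n choose k) * of_nat (k choose j) * a ^ k * b ^ (n - k)) =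
    of_nat (n choose j) * a ^ j * (a + b) ^ (n - j)"
proof -
  have "(\<Sum>k\<le>n. of_nat (n choose k) * of_nat (k choose j) * a ^ k * b ^ (n - k)) =
    (\<Sum>k\<in>{j..n}. of_nat (n choose k) * of_nat (k choose j) * a ^ k * b ^ (n - k))"
    by (rule sum.mono_neutral_right) (auto simp: binomial_eq_0)
  also have "\<dots> = (\<Sum>k\<in>{0 + j..(n - j) + j}. of_nat (n choose k) * of_nat (k choose j) * a ^ k * b ^ (n - k))"
    using assms by simp
  also have "\<dots> = (\<Sum>k = 0..n - j. of_nat (n choose (k + j)) * of_nat ((k + j) choose j) * a ^ (k + j) * b ^ (n - (k + j)))"
    by (rule sum.shift_bounds_cl_nat_ivl)
  also have "\<dots> = (\<Sum>k\<le>n - j. of_nat (n choose j) * a ^ j * (of_nat ((n - j) choose k) * a ^ k * b ^ (n - j - k)))"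
    unfolding atLeast0AtMost
  proof (rule sum.cong[OF refl])
    fix k assume "k \<in> {..n - j}"
    then have "(n choose (k + j)) * ((k + j) choose j) = (n choose j) * ((n - j) choose k)"
      using assms choose_mult[of j "k + j" n] by simp
    then have "of_nat (n choose (k + j)) * of_nat ((k + j) choose j) =
        (of_nat (n choose j) * of_nat ((n - j) choose k) :: 'a)"
      by (metis of_nat_mult)
    then show "of_nat (n choose (k + j)) * of_nat ((k + j) choose j) * a ^ (k + j) * b ^ (n - (k + j)) =
       of_nat (n choose j) * a ^ j * (of_nat ((n - j) choose k) * a ^ k * b ^ (n - j - k))"
      by (simp add: power_add algebra_simps)
  qed
  also have "\<dots> = of_nat (n choose j) * a ^ j * (a + b) ^ (n - j)"
    by (simp add: binomial_ring sum_distrib_left)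
  finally show ?thesis .
qed

text \<open>The normalized falling factorial \<open>t (t - 1/n) \<dots> (t - (j-1)/n)\<close> approaches \<open>t\<^sup>j\<close> uniformly
  on the unit interval; this passes from the exactly computable factorial moments to
  the ordinary ones.\<close>
lemma shifted_power_close:
  "\<exists>c\<ge>0. \<forall>n\<ge>1. \<forall>t::real. 0 \<le> t \<longrightarrow> t \<le> 1 \<longrightarrow> \<bar>(\<Prod>i<j. t - real i / real n) - t ^ j\<bar> \<le> c / real n"
proof (induction j)
  case 0
  show ?case by (auto intro!: exI[of _ 0])
next
  case (Suc j)
  then obtain c where c: "c \<ge> 0" and
    bd: "\<And>n t. n \<ge> 1 \<Longrightarrow> 0 \<le> t \<Longrightarrow> t \<le> 1 \<Longrightarrow> \<bar>(\<Prod>i<j. t - real i / real n) - t ^ j\<bar> \<le> c / real n"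
    by blast
  have "\<bar>(\<Prod>i<Suc j. t - real i / real n) - t ^ Suc j\<bar> \<le> ((1 + j) * c + j) / n"
    if n: "n \<ge> 1" and t: "0 \<le> t" "t \<le> 1" for n :: nat and t :: real
  proof -
    have jn: "real j / real n \<le> real j"
      using n divide_left_mono[of 1 "real n" "real j"] by simp
    have "0 \<le> real j / real n" by simp
    then have 1: "\<bar>t - real j / real n\<bar> \<le> 1 + real j" using t jn by linarith
    have tj: "t ^ j \<le> 1" "0 \<le> t ^ j" using t by (auto simp: power_le_one)
    have "(\<Prod>i<Suc j. t - real i / real n) - t ^ Suc j =
        (t - real j / n) * ((\<Prod>i<j. t - real i / real n) - t ^ j) - real j / n * t ^ j"
      by (simp add: algebra_simps)
    also have "\<bar>\<dots>\<bar> \<le> \<bar>(t - real j / n) * ((\<Prod>i<j. t - real i / real n) - t ^ j)\<bar> + \<bar>real j / n * t ^ j\<bar>"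
      by (rule abs_triangle_ineq4)
    also have "\<dots> \<le> (1 + real j) * (c / n) + real j / n * 1"
      unfolding abs_mult using bd[OF n t] 1 tj
      by (intro add_mono mult_mono) (auto simp: c)
    also have "\<dots> = ((1 + j) * c + j) / n"
      by (simp add: add_divide_distrib)
    finally show ?thesis .
  qed
  then show ?case using c by (intro exI[of _ "(1 + j) * c + j"]) auto
qed

definition clamp01 :: "real \<Rightarrow> real" where
  "clamp01 t = max 0 (min 1 t)"

lemma clamp01_id: "0 \<le> t \<Longrightarrow> t \<le> 1 \<Longrightarrow> clamp01 t = t"
  by (simp add: clamp01_def)

lemma clamp01_bounds: "0 \<le> clamp01 t" "clamp01 t \<le> 1"
  by (auto simp: clamp01_def)

lemma isCont_clamp01: "isCont clamp01 t"
  unfolding clamp01_def by (intro continuous_intros)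

lemma measurable_clamp01 [measurable]: "clamp01 \<in> borel_measurable borel"
  unfolding clamp01_def by measurable

lemma borel_measurable_poly [measurable]: "poly p \<in> borel_measurable (borel :: real measure)"
  by (intro borel_measurable_continuous_onI continuous_intros)

lemma poly_bounded_unit_interval:
  obtains B where "B \<ge> 0" "\<And>t::real. 0 \<le> t \<Longrightarrow> t \<le> 1 \<Longrightarrow> \<bar>poly p t\<bar> \<le> B"
proof -
  have "compact (poly p ` {0..1})"
    by (intro compact_continuous_image continuous_intros) auto
  then have "bounded (poly p ` {0..1})" by (rule compact_imp_bounded)
  then obtain B where "B > 0" "\<And>t. t \<in> {0..1} \<Longrightarrow> norm (poly p t) \<le> B"
    unfolding bounded_pos by auto
  then show ?thesis by (intro that[of B]) auto
qed

text \<open>Measures live on the whole line and are only concentrated on \<open>[0, 1]\<close>, so that Borel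
  functions of a real variable need no restriction.\<close>
definition unit_measure :: "real measure \<Rightarrow> bool" where
  "unit_measure M \<longleftrightarrow> finite_measure M \<and> sets M = sets borel \<and> (AE t in M. 0 \<le> t \<and> t \<le> 1)"

lemma unit_measure_integrable_poly:
  assumes "unit_measure M"
  shows "integrable M (poly p)"
proof -
  interpret finite_measure M using assms by (simp add: unit_measure_def)
  obtain B where B: "B \<ge> 0" "\<And>t::real. 0 \<le> t \<Longrightarrow> t \<le> 1 \<Longrightarrow> \<bar>poly p t\<bar> \<le> B"
    using poly_bounded_unit_interval[of p] by metis
  have "poly p \<in> borel_measurable M"
    using assms by (simp add: unit_measure_def cong: measurable_cong_sets)
  moreover have "AE t in M. norm (poly p t) \<le> B"
    using assms B unfolding unit_measure_def by (elim conjE) (erule eventually_mono, auto)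
  ultimately show ?thesis by (intro integrable_const_bound)
qed

text \<open>A functional \<open>L\<close> on polynomials that is nonnegative on the products \<open>t\<^sup>k (1 - t)\<^sup>l\<close>; by Hausdorff's
  theorem these are the functionals \<open>p \<mapsto> \<integral> p d\<mu>\<close> of measures \<open>\<mu>\<close> on \<open>[0, 1]\<close>.\<close>
locale hausdorff_functional =
  fixes L :: "real poly \<Rightarrow> real"
  assumes L_add: "L (p + r) = L p + L r"
    and L_smult: "L (smult c p) = c * L p"
    and L_pos: "0 \<le> L ([:0, 1:] ^ k * [:1, -1:] ^ l)"
begin

lemma L_zero: "L 0 = 0" using L_smult[of 0 0] by simp

lemma L_sum: "finite I \<Longrightarrow> L (\<Sum>i\<in>I. f i) = (\<Sum>i\<in>I. L (f i))"
  by (induction I rule: finite_induct) (simp_all add: L_add L_zero)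

lemma L_of_nat_mult: "L (of_nat m * p) = real m * L p"
  by (simp add: of_nat_poly L_smult)

text \<open>The value of \<open>L\<close> at the \<open>k\<close>-th Bernstein polynomial of degree \<open>n\<close>. The measure with mass
  \<open>weight n k\<close> at \<open>k/n\<close> is the \<open>n\<close>-th approximation of the measure sought.\<close>
definition weight :: "nat \<Rightarrow> nat \<Rightarrow> real" where
  "weight n k = real (n choose k) * L ([:0, 1:] ^ k * [:1, -1:] ^ (n - k))"

lemma weight_nonneg: "0 \<le> weight n k"
  using L_pos by (simp add: weight_def)

text \<open>The factorial moments of the approximating measures are exact.\<close>
lemma weight_choose:
  assumes "j \<le> n"
  shows "(\<Sum>k\<le>n. weight n k * real (k choose j)) = real (n choose j) * L ([:0, 1:] ^ j)"
proof -
  have "(\<Sum>k\<le>n. weight n k * real (k choose j)) =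
      L (\<Sum>k\<le>n. of_nat (n choose k) * of_nat (k choose j) * [:0, 1:] ^ k * [:1, -1:] ^ (n - k))"
    by (simp add: L_sum weight_def mult.assoc L_of_nat_mult) (simp add: ac_simps)
  also have "\<dots> = L (of_nat (n choose j) * [:0, 1:] ^ j * ([:0, 1:] + [:1, -1:]) ^ (n - j))"
    using assms by (simp only: binomial_sum_choose)
  also have "L (of_nat (n choose j) * [:0, 1:] ^ j * ([:0, 1:] + [:1, -1:]) ^ (n - j)) =
      real (n choose j) * L ([:0, 1:] ^ j)"
  proof -
    have "[:0, 1:] + [:1, -1:] = (1 :: real poly)"
    by (simp add: one_pCons)
    then show ?thesis
      by (simp only: power_one mult_1_right L_of_nat_mult)
  qed
  finally show ?thesis .
qed

lemma weight_sum: "(\<Sum>k\<le>n. weight n k) = L 1"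
  using weight_choose[of 0 n] by simp

lemma weight_moment_limit:
  "(\<lambda>n. \<Sum>k\<le>n. weight n k * (real k / real n) ^ j) \<longlonglongrightarrow> L ([:0, 1:] ^ j)"
proof -
  obtain c where c: "c \<ge> 0" and
    bd: "\<And>n t. n \<ge> 1 \<Longrightarrow> 0 \<le> t \<Longrightarrow> t \<le> 1 \<Longrightarrow> \<bar>(\<Prod>i<j. t - real i / real n) - t ^ j\<bar> \<le> c / real n"
    using shifted_power_close[of j] by metis
  let ?s = "\<lambda>n. \<Sum>k\<le>n. weight n k * (\<Prod>i<j. real k / real n - real i / real n)"
  have falling: "(\<Prod>i<j. real k / real n - real i / real n) = fact j * real (k choose j) / real n ^ j" for k n
  proof -
    have "(\<Prod>i<j. real k / real n - real i / real n) = (\<Prod>i<j. (real k - real i) / real n)"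
      by (simp add: diff_divide_distrib)
    also have "\<dots> = (\<Prod>i<j. real k - real i) / real n ^ j"
      by (simp add: prod_dividef)
    finally show ?thesis
      by (simp add: binomial_gbinomial gbinomial_prod_rev atLeast0LessThan)
  qed
  have s: "?s n = (\<Prod>i<j. 1 - real i / real n) * L ([:0, 1:] ^ j)" if "n \<ge> j" "n \<ge> 1" for n
  proof -
    have "?s n = fact j / real n ^ j * (\<Sum>k\<le>n. weight n k * real (k choose j))"
      by (simp add: falling sum_distrib_left mult_ac)
    also have "\<dots> = fact j * real (n choose j) / real n ^ j * L ([:0, 1:] ^ j)"
      using that by (simp add: weight_choose)
    also have "\<dots> = (\<Prod>i<j. real n / real n - real i / real n) * L ([:0, 1:] ^ j)"
      by (simp only: falling)
    finally show ?thesis using that by simp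
  qed
  have "(\<lambda>n. (\<Prod>i<j. 1 - real i / real n) * L ([:0, 1:] ^ j)) \<longlonglongrightarrow> (\<Prod>i<j. 1 - 0) * L ([:0, 1:] ^ j)"
    by (intro tendsto_intros lim_const_over_n)
  then have lim: "?s \<longlonglongrightarrow> L ([:0, 1:] ^ j)"
    by (rule Lim_transform_eventually[THEN back_subst[of "\<lambda>z. ?s \<longlonglongrightarrow> z"]])
       (auto intro!: eventually_sequentiallyI[of "max 1 j"] simp: s)
  have err: "\<bar>(\<Sum>k\<le>n. weight n k * (real k / real n) ^ j) - ?s n\<bar> \<le> c * L 1 / n" if "n \<ge> 1" for n
  proof -
    have "\<bar>(\<Sum>k\<le>n. weight n k * (real k / real n) ^ j) - ?s n\<bar> =
      \<bar>\<Sum>k\<le>n. weight n k * ((real k / real n) ^ j - (\<Prod>i<j. real k / real n - real i / real n))\<bar>"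
      by (simp add: sum_subtractf algebra_simps)
    also have "\<dots> \<le> (\<Sum>k\<le>n. weight n k * (c / n))"
    proof (intro order_trans[OF sum_abs] sum_mono)
      fix k assume k: "k \<in> {..n}"
      then have "\<bar>(\<Prod>i<j. real k / real n - real i / real n) - (real k / real n) ^ j\<bar> \<le> c / n"
        using that by (intro bd) auto
      then have "weight n k * \<bar>(real k / real n) ^ j - (\<Prod>i<j. real k / real n - real i / real n)\<bar> \<le> weight n k * (c / n)"
        by (intro mult_left_mono weight_nonneg) (simp add: abs_minus_commute)
      then show "\<bar>weight n k * ((real k / real n) ^ j - (\<Prod>i<j. real k / real n - real i / real n))\<bar> \<le> weight n k * (c / n)"
        by (simp add: abs_mult weight_nonneg)
    qed
    also have "\<dots> = c * L 1 / n"
      unfolding sum_distrib_right[symmetric] weight_sum by simp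
    finally show ?thesis .
  qed
  have ev: "\<forall>\<^sub>F n in sequentially. norm ((\<Sum>k\<le>n. weight n k * (real k / real n) ^ j) - ?s n) \<le> c * L 1 / real n"
    using eventually_ge_at_top[of 1] by (rule eventually_mono) (simp only: real_norm_def err)
  have "(\<lambda>n. (\<Sum>k\<le>n. weight n k * (real k / real n) ^ j) - ?s n) \<longlonglongrightarrow> 0"
    by (rule Lim_null_comparison[OF ev lim_const_over_n])
  from tendsto_add[OF this lim] show ?thesis by simp
qed

lemma weight_poly_limit:
  "(\<lambda>n. \<Sum>k\<le>n. weight n k * poly p (real k / real n)) \<longlonglongrightarrow> L p"
proof -
  have "(\<lambda>n. \<Sum>j\<le>degree p. coeff p j * (\<Sum>k\<le>n. weight n k * (real k / real n) ^ j))
      \<longlonglongrightarrow> (\<Sum>j\<le>degree p. coeff p j * L ([:0, 1:] ^ j))"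
    by (intro tendsto_intros weight_moment_limit)
  also have "(\<Sum>j\<le>degree p. coeff p j * L ([:0, 1:] ^ j)) = L (\<Sum>j\<le>degree p. monom (coeff p j) j)"
    by (simp add: L_sum L_smult[symmetric] monom_altdef)
  also have "\<dots> = L p" by (simp add: poly_as_sum_of_monoms)
  also have "(\<lambda>n. \<Sum>j\<le>degree p. coeff p j * (\<Sum>k\<le>n. weight n k * (real k / real n) ^ j)) =
     (\<lambda>n. \<Sum>k\<le>n. weight n k * poly p (real k / real n))"
    unfolding sum_distrib_left by (subst sum.swap) (simp add: poly_altdef sum_distrib_left mult_ac)
  finally show ?thesis .
qed

text \<open>Hausdorff's theorem. After normalization the approximating measures are probability measures on a
  common compact interval, hence tight; by Helly's selection theorem a subsequence converges weakly,
  and the limit has the prescribed moments because those of the approximations converge to them.\<close>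
theorem moment_measure: "\<exists>M. unit_measure M \<and> (\<forall>p. integral\<^sup>L M (poly p) = L p)"
proof (cases "L 1 = 0")
  case True
  have w0: "weight n k = 0" if "k \<le> n" for n k
    using weight_sum[of n] weight_nonneg that True
    by (metis atMost_iff finite_atMost sum_nonneg_eq_0_iff)
  have "L p = 0" for p
    using weight_poly_limit[of p] by (simp add: w0 LIMSEQ_const_iff)
  moreover have "unit_measure (null_measure borel)"
    unfolding unit_measure_def by (auto intro!: finite_measureI simp: AE_iff_null null_sets_def)
  ultimately show ?thesis by (intro exI[of _ "null_measure borel"]) simp
next
  case False
  have L1: "0 < L 1" using False L_pos[of 0 0] by (simp add: one_pCons)
  define pm where "pm n = embed_pmf (\<lambda>k. if k \<le> n then weight n k / L 1 else 0)" for n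
  have pmf_pm: "pmf (pm n) k = (if k \<le> n then weight n k / L 1 else 0)" for n k
    unfolding pm_def
  proof (rule pmf_embed_pmf)
    show "0 \<le> (if k \<le> n then weight n k / L 1 else 0)" for k
      using L1 by (simp add: weight_nonneg)
    have "(\<integral>\<^sup>+ k. ennreal (if k \<le> n then weight n k / L 1 else 0) \<partial>count_space UNIV) =
        (\<Sum>k\<le>n. ennreal (if k \<le> n then weight n k / L 1 else 0))"
      by (subst nn_integral_count_space'[of "{..n}"]) auto
    also have "\<dots> = ennreal (\<Sum>k\<le>n. weight n k / L 1)"
      using L1 by (subst sum_ennreal[symmetric]) (auto simp: weight_nonneg)
    also have "\<dots> = 1"
      using L1 by (simp add: sum_divide_distrib[symmetric] weight_sum)
    finally show "(\<integral>\<^sup>+ k. ennreal (if k \<le> n then weight n k / L 1 else 0) \<partial>count_space UNIV) = 1" .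
  qed
  define N where "N n = distr (measure_pmf (pm n)) borel (\<lambda>k. real k / real n)" for n
  have rd: "real_distribution (N n)" for n
    unfolding N_def by (intro prob_space.real_distribution_distr measure_pmf.prob_space_axioms) simp
  have int: "integral\<^sup>L (N n) g = (\<Sum>k\<le>n. weight n k * g (real k / real n)) / L 1"
    if [measurable]: "g \<in> borel_measurable borel" for n and g :: "real \<Rightarrow> real"
  proof -
    have "integral\<^sup>L (N n) g = (\<integral>k. g (real k / real n) \<partial>measure_pmf (pm n))"
      unfolding N_def by (subst integral_distr) auto
    also have "\<dots> = (\<Sum>k\<le>n. g (real k / real n) * pmf (pm n) k)"
      by (rule integral_measure_pmf_real) (auto simp: set_pmf_iff pmf_pm split: if_splits)
    also have "\<dots> = (\<Sum>k\<le>n. weight n k * g (real k / real n)) / L 1"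
      by (simp add: pmf_pm sum_divide_distrib mult_ac)
    finally show ?thesis .
  qed
  have supp: "measure (N n) {-1<..1} = 1" for n
  proof -
    interpret real_distribution "N n" by (rule rd)
    have "integral\<^sup>L (N n) (indicator {-1<..1}) = (\<Sum>k\<le>n. weight n k * indicator {-1<..1} (real k / real n)) / L 1"
      by (rule int) simp
    also have "(\<Sum>k\<le>n. weight n k * indicator {-1<..1} (real k / real n)) = (\<Sum>k\<le>n. weight n k)"
    proof (rule sum.cong[OF refl])
      fix k assume "k \<in> {..n}"
      then have "real k / real n \<le> 1" by (cases "n = 0") auto
      moreover have "-1 < real k / real n" by (rule less_le_trans[of _ 0]) auto
      ultimately show "weight n k * indicator {-1<..1} (real k / real n) = weight n k" by simp
    qed
    finally show ?thesis using L1 by (simp add: weight_sum)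
  qed
  have "tight N"
    unfolding tight_def
  proof (intro conjI allI impI rd)
    fix e :: real assume "e > 0"
    then show "\<exists>a b. a < b \<and> (\<forall>n. 1 - e < measure (N n) {a<..b})"
      by (intro exI[of _ "-1"] exI[of _ 1]) (simp add: supp)
  qed
  from tight_imp_convergent_subsubsequence[OF this, of id]
  obtain r M0 where r: "strict_mono (r :: nat \<Rightarrow> nat)" and M0: "real_distribution M0"
    and wc: "weak_conv_m (N \<circ> id \<circ> r) M0" by (auto simp: strict_mono_id)
  interpret M0: real_distribution M0 by fact
  \<comment> \<open>Clamping moves the limit measure into \<open>[0, 1]\<close> without changing the integrals below, as
    the test functions are themselves composed with the clamping.\<close>
  define M where "M = density (distr M0 borel clamp01) (\<lambda>_. ennreal (L 1))"
  have "integral\<^sup>L M (poly p) = L p" for p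
  proof -
    obtain B where B: "B \<ge> 0" "\<And>t::real. 0 \<le> t \<Longrightarrow> t \<le> 1 \<Longrightarrow> \<bar>poly p t\<bar> \<le> B"
      using poly_bounded_unit_interval[of p] by metis
    have "\<And>n. real_distribution ((N \<circ> id \<circ> r) n)" using rd by simp
    moreover have "isCont (\<lambda>t. poly p (clamp01 t)) t" for t
      by (rule isCont_o2[OF isCont_clamp01 poly_isCont])
    moreover have "norm (poly p (clamp01 t)) \<le> B" for t
      using B clamp01_bounds by simp
    ultimately have "(\<lambda>n. integral\<^sup>L ((N \<circ> id \<circ> r) n) (\<lambda>t. poly p (clamp01 t))) \<longlonglongrightarrow> integral\<^sup>L M0 (\<lambda>t. poly p (clamp01 t))"
      by (intro weak_conv_imp_integral_bdd_continuous_conv[OF _ M0 wc])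
    moreover have "(\<lambda>n. integral\<^sup>L ((N \<circ> id \<circ> r) n) (\<lambda>t. poly p (clamp01 t))) \<longlonglongrightarrow> L p / L 1"
    proof -
      have kn: "real k / real n \<le> 1" if "k \<le> n" for k n
        using that by (cases "n = 0") auto
      have "integral\<^sup>L (N n) (\<lambda>t. poly p (clamp01 t)) = (\<Sum>k\<le>n. weight n k * poly p (real k / real n)) / L 1" for n
        by (subst int, measurable) (auto intro!: sum.cong simp: clamp01_id kn)
      then have "(\<lambda>n. integral\<^sup>L (N n) (\<lambda>t. poly p (clamp01 t))) \<longlonglongrightarrow> L p / L 1"
        by (simp, intro tendsto_intros weight_poly_limit False)
      from LIMSEQ_subseq_LIMSEQ[OF this r] show ?thesis by (simp add: o_def)
    qed
    ultimately have "integral\<^sup>L M0 (\<lambda>t. poly p (clamp01 t)) = L p / L 1"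
      by (rule LIMSEQ_unique)
    then have "integral\<^sup>L (distr M0 borel clamp01) (poly p) = L p / L 1"
      by (subst integral_distr) auto
    then show ?thesis
      using L1 unfolding M_def by (subst integral_density) auto
  qed
  moreover have "unit_measure M"
  proof -
    have "AE t in distr M0 borel clamp01. 0 \<le> t \<and> t \<le> 1"
      by (subst AE_distr_iff) (auto simp: clamp01_bounds)
    then have "AE t in M. 0 \<le> t \<and> t \<le> 1"
      unfolding M_def by (subst AE_density) auto
    moreover have "emeasure M (space M) \<noteq> \<infinity>"
      unfolding M_def by (simp add: emeasure_density emeasure_distr nn_integral_cmult_indicator
        M0.emeasure_eq_measure ennreal_mult_eq_top_iff)
    ultimately show ?thesis
      unfolding unit_measure_def by (auto intro!: finite_measureI simp: M_def)
  qed
  ultimately show ?thesis by blast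
qed

end

section \<open>Density of the polynomials in square-integrable functions\<close>

text \<open>Approximation is required in finitely many measures at once, because linearity of \<open>f(C)\<close> in the
  vector needs one sequence of polynomials for \<open>x\<close>, \<open>y\<close> and \<open>x + y\<close>, whose measures differ.
  Integrals in \<open>[0, \<infinity>]\<close> spare all integrability conditions at this stage.\<close>
definition approximable :: "'i set \<Rightarrow> ('i \<Rightarrow> real measure) \<Rightarrow> (real \<Rightarrow> real) \<Rightarrow> bool" where
  "approximable I M f \<longleftrightarrow>
     (\<forall>e>0. \<exists>p. \<forall>i\<in>I. (\<integral>\<^sup>+t. ennreal ((f t - poly p t)\<^sup>2) \<partial>M i) < ennreal e)"

lemma square_triangle: "(a - c)\<^sup>2 \<le> 2 * (a - b)\<^sup>2 + 2 * (b - c)\<^sup>2" for a b c :: real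
proof -
  have "0 \<le> ((a - b) - (b - c))\<^sup>2" by simp
  then show ?thesis by (simp add: power2_eq_square algebra_simps)
qed

lemma nn_square_triangle:
  assumes [measurable]: "f \<in> borel_measurable M" "g \<in> borel_measurable M" "h \<in> borel_measurable M"
  shows "(\<integral>\<^sup>+t. ennreal ((f t - h t)\<^sup>2) \<partial>M) \<le>
    2 * (\<integral>\<^sup>+t. ennreal ((f t - g t)\<^sup>2) \<partial>M) + 2 * (\<integral>\<^sup>+t. ennreal ((g t - h t)\<^sup>2) \<partial>M)"
proof -
  have "(\<integral>\<^sup>+t. ennreal ((f t - h t)\<^sup>2) \<partial>M) \<le>
      (\<integral>\<^sup>+t. 2 * ennreal ((f t - g t)\<^sup>2) + 2 * ennreal ((g t - h t)\<^sup>2) \<partial>M)"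
  proof (rule nn_integral_mono)
    fix t
    have "ennreal ((f t - h t)\<^sup>2) \<le> ennreal (2 * (f t - g t)\<^sup>2 + 2 * (g t - h t)\<^sup>2)"
      by (intro ennreal_leI square_triangle)
    then show "ennreal ((f t - h t)\<^sup>2) \<le> 2 * ennreal ((f t - g t)\<^sup>2) + 2 * ennreal ((g t - h t)\<^sup>2)"
      by (simp add: ennreal_plus ennreal_mult)
  qed
  also have "\<dots> = 2 * (\<integral>\<^sup>+t. ennreal ((f t - g t)\<^sup>2) \<partial>M) + 2 * (\<integral>\<^sup>+t. ennreal ((g t - h t)\<^sup>2) \<partial>M)"
    by (simp add: nn_integral_add nn_integral_cmult)
  finally show ?thesis .
qed

lemma square_diff_le_1: "0 \<le> a \<Longrightarrow> a \<le> 1 \<Longrightarrow> 0 \<le> b \<Longrightarrow> b \<le> 1 \<Longrightarrow> (a - b)\<^sup>2 \<le> (1::real)"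
  using abs_le_square_iff[of "a - b" 1] by (simp add: abs_le_iff)

lemma ennreal_double_sum_less:
  assumes "a < ennreal (e / 4)" "b < ennreal (e / 4)" "e > 0"
  shows "2 * a + 2 * b < ennreal e"
proof -
  obtain r where r: "a = ennreal r" "0 \<le> r" using assms(1) by (cases a) auto
  obtain s where s: "b = ennreal s" "0 \<le> s" using assms(2) by (cases b) auto
  have "2 * a + 2 * b = ennreal (2 * r + 2 * s)"
    using r s by (simp add: ennreal_plus ennreal_mult)
  also have "\<dots> < ennreal e"
    using assms r s by (intro ennreal_lessI) (auto simp: ennreal_less_iff)
  finally show ?thesis .
qed

locale unit_measure_family =
  fixes I :: "'i set" and M :: "'i \<Rightarrow> real measure"
  assumes fin: "finite I" and unit: "i \<in> I \<Longrightarrow> unit_measure (M i)"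
begin

lemma sets_M: "i \<in> I \<Longrightarrow> sets (M i) = sets borel"
  using unit by (simp add: unit_measure_def)

lemma borel_M: "i \<in> I \<Longrightarrow> f \<in> borel_measurable borel \<Longrightarrow> f \<in> borel_measurable (M i)"
  using measurable_cong_sets[OF sets_M refl] by blast

lemma finite_M: "i \<in> I \<Longrightarrow> finite_measure (M i)"
  using unit by (simp add: unit_measure_def)

lemma approximable_close:
  assumes f [measurable]: "f \<in> borel_measurable borel"
    and ap: "\<And>e. e > 0 \<Longrightarrow> \<exists>g\<in>borel_measurable borel. approximable I M g \<and>
       (\<forall>i\<in>I. (\<integral>\<^sup>+t. ennreal ((f t - g t)\<^sup>2) \<partial>M i) < ennreal e)"
  shows "approximable I M f"
  unfolding approximable_def
proof (intro allI impI)
  fix e :: real assume e: "e > 0"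
  then obtain g where g: "g \<in> borel_measurable borel" "approximable I M g"
     "\<forall>i\<in>I. (\<integral>\<^sup>+t. ennreal ((f t - g t)\<^sup>2) \<partial>M i) < ennreal (e / 4)"
    using ap[of "e / 4"] by auto
  then obtain p where p: "\<forall>i\<in>I. (\<integral>\<^sup>+t. ennreal ((g t - poly p t)\<^sup>2) \<partial>M i) < ennreal (e / 4)"
    using e unfolding approximable_def by (metis zero_less_divide_iff zero_less_numeral)
  have "(\<integral>\<^sup>+t. ennreal ((f t - poly p t)\<^sup>2) \<partial>M i) < ennreal e" if "i \<in> I" for i
    using nn_square_triangle[OF borel_M[OF that f] borel_M[OF that g(1)] borel_M[OF that borel_measurable_poly], of p]
      ennreal_double_sum_less[OF g(3)[rule_format, OF that] p[rule_format, OF that] e]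
    by (rule le_less_trans)
  then show "\<exists>p. \<forall>i\<in>I. (\<integral>\<^sup>+t. ennreal ((f t - poly p t)\<^sup>2) \<partial>M i) < ennreal e" by blast
qed

text \<open>Dominated convergence; finiteness of the family makes the convergence uniform in \<open>i\<close>.\<close>
lemma approximable_limit:
  assumes f: "f \<in> borel_measurable borel"
    and U: "\<And>n. U n \<in> borel_measurable borel" "\<And>n. approximable I M (U n)"
    and lim: "\<And>t. (\<lambda>n. U n t) \<longlonglongrightarrow> f t"
    and w: "w \<in> borel_measurable borel" "\<And>n t. (f t - U n t)\<^sup>2 \<le> w t"
      "\<And>i. i \<in> I \<Longrightarrow> (\<integral>\<^sup>+t. ennreal (w t) \<partial>M i) < \<infinity>"
  shows "approximable I M f"
proof (rule approximable_close[OF f])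
  fix e :: real assume e: "e > 0"
  have "\<forall>\<^sub>F n in sequentially. (\<integral>\<^sup>+t. ennreal ((f t - U n t)\<^sup>2) \<partial>M i) < ennreal e" if i: "i \<in> I" for i
  proof -
    note [measurable] = borel_M[OF i f] borel_M[OF i U(1)] borel_M[OF i w(1)]
    have "(\<lambda>n. \<integral>\<^sup>+t. ennreal ((f t - U n t)\<^sup>2) \<partial>M i) \<longlonglongrightarrow> (\<integral>\<^sup>+t. 0 \<partial>M i)"
    proof (rule nn_integral_dominated_convergence[where w = "\<lambda>t. ennreal (w t)"])
      show "AE t in M i. (\<lambda>n. ennreal ((f t - U n t)\<^sup>2)) \<longlonglongrightarrow> 0"
      proof (rule AE_I2)
        fix t
        have "(\<lambda>n. (f t - U n t)\<^sup>2) \<longlonglongrightarrow> (f t - f t)\<^sup>2"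
          by (intro tendsto_intros lim)
        then show "(\<lambda>n. ennreal ((f t - U n t)\<^sup>2)) \<longlonglongrightarrow> 0"
          using tendsto_ennrealI by fastforce
      qed
    qed (use w i in \<open>auto intro!: ennreal_leI\<close>)
    then show ?thesis
      using e by (auto dest!: order_tendstoD(2)[of _ _ _ "ennreal e"])
  qed
  then have "\<forall>\<^sub>F n in sequentially. \<forall>i\<in>I. (\<integral>\<^sup>+t. ennreal ((f t - U n t)\<^sup>2) \<partial>M i) < ennreal e"
    using fin by (simp add: eventually_ball_finite)
  then obtain n where "\<forall>i\<in>I. (\<integral>\<^sup>+t. ennreal ((f t - U n t)\<^sup>2) \<partial>M i) < ennreal e"
    by (auto simp: eventually_sequentially)
  then show "\<exists>g\<in>borel_measurable borel. approximable I M g \<and>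
      (\<forall>i\<in>I. (\<integral>\<^sup>+t. ennreal ((f t - g t)\<^sup>2) \<partial>M i) < ennreal e)"
    using U by blast
qed

lemma approximable_add:
  assumes f: "f \<in> borel_measurable borel" "approximable I M f"
    and g: "g \<in> borel_measurable borel" "approximable I M g"
  shows "approximable I M (\<lambda>t. f t + g t)"
  unfolding approximable_def
proof (intro allI impI)
  fix e :: real assume e: "e > 0"
  obtain p where p: "\<forall>i\<in>I. (\<integral>\<^sup>+t. ennreal ((f t - poly p t)\<^sup>2) \<partial>M i) < ennreal (e / 4)"
    using e f(2) unfolding approximable_def by (metis zero_less_divide_iff zero_less_numeral)
  obtain r where r: "\<forall>i\<in>I. (\<integral>\<^sup>+t. ennreal ((g t - poly r t)\<^sup>2) \<partial>M i) < ennreal (e / 4)"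
    using e g(2) unfolding approximable_def by (metis zero_less_divide_iff zero_less_numeral)
  have "(\<integral>\<^sup>+t. ennreal ((f t + g t - poly (p + r) t)\<^sup>2) \<partial>M i) < ennreal e" if i: "i \<in> I" for i
  proof -
    note [measurable] = borel_M[OF i f(1)] borel_M[OF i g(1)] borel_M[OF i borel_measurable_poly]
    have "(\<integral>\<^sup>+t. ennreal ((f t + g t - poly (p + r) t)\<^sup>2) \<partial>M i) \<le>
       2 * (\<integral>\<^sup>+t. ennreal ((f t + g t - (poly p t + g t))\<^sup>2) \<partial>M i) +
       2 * (\<integral>\<^sup>+t. ennreal ((poly p t + g t - poly (p + r) t)\<^sup>2) \<partial>M i)"
      by (rule nn_square_triangle) measurable
    also have "\<dots> = 2 * (\<integral>\<^sup>+t. ennreal ((f t - poly p t)\<^sup>2) \<partial>M i) + 2 * (\<integral>\<^sup>+t. ennreal ((g t - poly r t)\<^sup>2) \<partial>M i)"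
      by simp
    also have "\<dots> < ennreal e"
      using p r i e by (intro ennreal_double_sum_less) auto
    finally show ?thesis .
  qed
  then show "\<exists>p. \<forall>i\<in>I. (\<integral>\<^sup>+t. ennreal ((f t + g t - poly p t)\<^sup>2) \<partial>M i) < ennreal e" by blast
qed

lemma approximable_scale:
  assumes f: "f \<in> borel_measurable borel" "approximable I M f"
  shows "approximable I M (\<lambda>t. c * f t)"
  unfolding approximable_def
proof (intro allI impI)
  fix e :: real assume e: "e > 0"
  define e' where "e' = e / (1 + c\<^sup>2)"
  have e': "e' > 0" using e by (auto simp: e'_def intro!: divide_pos_pos add_pos_nonneg)
  then obtain p where p: "\<forall>i\<in>I. (\<integral>\<^sup>+t. ennreal ((f t - poly p t)\<^sup>2) \<partial>M i) < ennreal e'"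
    using f(2) unfolding approximable_def by metis
  have "(\<integral>\<^sup>+t. ennreal ((c * f t - poly (smult c p) t)\<^sup>2) \<partial>M i) < ennreal e" if i: "i \<in> I" for i
  proof -
    note [measurable] = borel_M[OF i f(1)] borel_M[OF i borel_measurable_poly]
    have "(\<integral>\<^sup>+t. ennreal ((c * f t - poly (smult c p) t)\<^sup>2) \<partial>M i) =
        (\<integral>\<^sup>+t. ennreal (c\<^sup>2) * ennreal ((f t - poly p t)\<^sup>2) \<partial>M i)"
      by (simp add: ennreal_mult[symmetric] power_mult_distrib[symmetric] right_diff_distrib)
    also have "\<dots> = ennreal (c\<^sup>2) * (\<integral>\<^sup>+t. ennreal ((f t - poly p t)\<^sup>2) \<partial>M i)"
      by (rule nn_integral_cmult) measurable
    also have "\<dots> \<le> ennreal (c\<^sup>2) * ennreal e'"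
      using p i by (intro mult_left_mono) auto
    also have "\<dots> = ennreal (c\<^sup>2 * e')" using e' by (simp add: ennreal_mult)
    also have "\<dots> < ennreal e"
      using e by (intro ennreal_lessI) (auto simp: e'_def field_simps add_pos_nonneg)
    finally show ?thesis .
  qed
  then show "\<exists>p. \<forall>i\<in>I. (\<integral>\<^sup>+t. ennreal ((c * f t - poly p t)\<^sup>2) \<partial>M i) < ennreal e" by blast
qed

lemma nn_integral_const_finite: "i \<in> I \<Longrightarrow> (\<integral>\<^sup>+t. ennreal c \<partial>M i) < \<infinity>"
  using finite_measure.emeasure_finite[OF finite_M, of i "space (M i)"]
  by (simp add: ennreal_mult_less_top top.not_eq_extremum)

text \<open>Bernstein's theorem gives uniform approximation on \<open>[0, 1]\<close>, where all the measures are
  concentrated.\<close>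
lemma approximable_continuous:
  assumes f: "continuous_on UNIV f"
  shows "approximable I M f"
  unfolding approximable_def
proof (intro allI impI)
  fix e :: real assume e: "e > 0"
  define m where "m = (\<Sum>i\<in>I. measure (M i) UNIV)"
  have m: "measure (M i) UNIV \<le> m" if "i \<in> I" for i
    unfolding m_def using fin that by (intro member_le_sum) auto
  have m0: "m \<ge> 0" unfolding m_def by (intro sum_nonneg) auto
  define d where "d = sqrt (e / (1 + m))"
  have d: "d > 0" "d\<^sup>2 = e / (1 + m)" using e m0 by (auto simp: d_def)
  obtain N where N: "\<forall>n x. N \<le> n \<and> x \<in> {0..1} \<longrightarrow> \<bar>f x - (\<Sum>k\<le>n. f(k/n) * Bernstein n k x)\<bar> < d"
    using Bernstein_Weierstrass[OF continuous_on_subset[OF f] d(1)] by auto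
  define p where "p = (\<Sum>k\<le>N. smult (f (real k / real N) * real (N choose k)) ([:0, 1:] ^ k * [:1, -1:] ^ (N - k)))"
  have p: "poly p x = (\<Sum>k\<le>N. f(k/N) * Bernstein N k x)" for x
    by (simp add: p_def poly_sum Bernstein_def mult_ac)
  have "(\<integral>\<^sup>+t. ennreal ((f t - poly p t)\<^sup>2) \<partial>M i) < ennreal e" if i: "i \<in> I" for i
  proof -
    interpret finite_measure "M i" by (rule finite_M[OF i])
    have sp: "space (M i) = UNIV" using sets_eq_imp_space_eq[OF sets_M[OF i]] by simp
    have "AE t in M i. 0 \<le> t \<and> t \<le> 1" using unit[OF i] by (simp add: unit_measure_def)
    then have "AE t in M i. ennreal ((f t - poly p t)\<^sup>2) \<le> ennreal (d\<^sup>2)"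
    proof (rule eventually_mono)
      fix t :: real assume "0 \<le> t \<and> t \<le> 1"
      then have "\<bar>f t - poly p t\<bar> < d" using N[rule_format, of N t] by (simp add: p)
      then have "\<bar>f t - poly p t\<bar>\<^sup>2 \<le> d\<^sup>2" by (intro power_mono) auto
      then show "ennreal ((f t - poly p t)\<^sup>2) \<le> ennreal (d\<^sup>2)" by (simp add: ennreal_leI)
    qed
    then have "(\<integral>\<^sup>+t. ennreal ((f t - poly p t)\<^sup>2) \<partial>M i) \<le> (\<integral>\<^sup>+t. ennreal (d\<^sup>2) \<partial>M i)"
      by (rule nn_integral_mono_AE)
    also have "\<dots> = ennreal (d\<^sup>2 * measure (M i) UNIV)"
      by (simp add: sp emeasure_eq_measure ennreal_mult)
    also have "\<dots> < ennreal e"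
    proof (rule ennreal_lessI[OF e])
      have "d\<^sup>2 * measure (M i) UNIV \<le> d\<^sup>2 * m" using m[OF i] by (intro mult_left_mono) auto
      also have "\<dots> < e" using e m0 by (simp add: d field_simps add_pos_nonneg)
      finally show "d\<^sup>2 * measure (M i) UNIV < e" .
    qed
    finally show ?thesis .
  qed
  then show "\<exists>p. \<forall>i\<in>I. (\<integral>\<^sup>+t. ennreal ((f t - poly p t)\<^sup>2) \<partial>M i) < ennreal e" by blast
qed

lemma approximable_indicator_atMost: "approximable I M (indicator {..a :: real})"
proof (rule approximable_limit[where w = "\<lambda>_. 1" and U = "\<lambda>n t. max 0 (min 1 (1 - real n * (t - a)))"])
  show "approximable I M (\<lambda>t. max 0 (min 1 (1 - real n * (t - a))))" for n
    by (intro approximable_continuous continuous_intros)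
  show "(\<lambda>n. max 0 (min 1 (1 - real n * (t - a)))) \<longlonglongrightarrow> indicator {..a} t" for t
  proof (cases "t \<le> a")
    case True
    then have "real n * (t - a) \<le> 0" for n by (simp add: mult_le_0_iff)
    then have "max 0 (min 1 (1 - real n * (t - a))) = 1" for n by (simp add: min_def max_def)
    then show ?thesis using True by simp
  next
    case False
    obtain N where N: "real N > 1 / (t - a)" using reals_Archimedean2 by blast
    have "max 0 (min 1 (1 - real n * (t - a))) = 0" if "n \<ge> N" for n
    proof -
      have "real n > 1 / (t - a)" using N that by linarith
      then have "1 < real n * (t - a)" using False by (simp add: field_simps)
      then show ?thesis by simp
    qed
    then show ?thesis using False by (auto intro!: tendsto_eventually eventually_sequentiallyI[of N])
  qed
  show "(indicator {..a} t - max 0 (min 1 (1 - real n * (t - a))))\<^sup>2 \<le> 1" for n t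
    by (rule square_diff_le_1) (auto simp: indicator_def)
qed (use nn_integral_const_finite[of _ 1] in auto)

text \<open>The sets with approximable indicator form a Dynkin system, and the half-lines are an
  intersection-stable generator.\<close>
lemma approximable_indicator:
  assumes "B \<in> sets (borel :: real measure)"
  shows "approximable I M (indicator B)"
proof -
  have "Int_stable (range (atMost :: real \<Rightarrow> real set))"
    by (auto simp: Int_stable_def)
  moreover have "range (atMost :: real \<Rightarrow> real set) \<subseteq> Pow UNIV" by auto
  moreover have "B \<in> sigma_sets UNIV (range (atMost :: real \<Rightarrow> real set))"
    using assms by (simp add: borel_eq_atMost)
  ultimately show ?thesis
  proof (induction rule: sigma_sets_induct_disjoint)
    case (basic A)
    then show ?case by (auto intro: approximable_indicator_atMost)
  next
    case empty
    show ?case using approximable_continuous[of "\<lambda>_. 0"] by simp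
  next
    case (compl A)
    have [measurable]: "A \<in> sets borel" using compl by (simp add: borel_eq_atMost)
    have "approximable I M (\<lambda>t. 1 + (-1) * indicator A t)"
      using compl.IH by (intro approximable_add approximable_scale) (auto intro: approximable_continuous)
    moreover have "(\<lambda>t. 1 + (-1) * indicator A t) = (indicator (UNIV - A) :: real \<Rightarrow> real)"
      by (auto simp: indicator_def)
    ultimately show ?case by simp
  next
    case (union A)
    have A [measurable]: "A i \<in> sets borel" for i using union by (auto simp: borel_eq_atMost)
    have part: "indicator (\<Union>i<n. A i) t = (\<Sum>i<n. indicator (A i) t :: real)" for n t
      using union(1) by (intro indicator_UN_disjoint) (auto simp: disjoint_family_on_def)
    have ap: "approximable I M (\<lambda>t. \<Sum>i<n. indicator (A i) t)" for n
    proof (induction n)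
      case 0
      show ?case using approximable_continuous[of "\<lambda>_. 0"] by simp
    next
      case (Suc n)
      then show ?case using union.IH by (simp, intro approximable_add) auto
    qed
    show ?case
    proof (rule approximable_limit[where w = "\<lambda>_. 1" and U = "\<lambda>n. indicator (\<Union>i<n. A i)"])
      show "approximable I M (indicator (\<Union>i<n. A i))" for n
      proof -
        have "(\<lambda>t. \<Sum>i<n. indicator (A i) t) = (indicator (\<Union>i<n. A i) :: real \<Rightarrow> real)"
          by (rule ext) (simp only: part)
        then show ?thesis using ap[of n] by simp
      qed
      show "(\<lambda>n. indicator (\<Union>i<n. A i) t :: real) \<longlonglongrightarrow> indicator (\<Union> (range A)) t" for t
        by (rule LIMSEQ_indicator_UN)
      show "(indicator (\<Union> (range A)) t - indicator (\<Union>i<n. A i) t)\<^sup>2 \<le> (1::real)" for n t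
        by (rule square_diff_le_1) (auto simp: indicator_def)
    qed (use nn_integral_const_finite[of _ 1] in auto)
  qed
qed

lemma approximable_nonneg:
  assumes u: "u \<in> borel_measurable borel" "\<And>t. 0 \<le> u t"
    and "\<And>i. i \<in> I \<Longrightarrow> (\<integral>\<^sup>+t. ennreal ((u t)\<^sup>2) \<partial>M i) < \<infinity>"
  shows "approximable I M u"
proof -
  have "(\<forall>i\<in>I. (\<integral>\<^sup>+t. ennreal ((u t)\<^sup>2) \<partial>M i) < \<infinity>) \<longrightarrow> approximable I M u"
    using u
  proof (induction rule: borel_measurable_induct_real)
    case (set A)
    then show ?case by (simp add: approximable_indicator)
  next
    case (mult u c)
    show ?case
    proof (cases "c = 0")
      case True
      then show ?thesis using approximable_continuous[of "\<lambda>_. 0"] by simp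
    next
      case False
      show ?thesis
      proof
        assume fin: "\<forall>i\<in>I. (\<integral>\<^sup>+t. ennreal ((c * u t)\<^sup>2) \<partial>M i) < \<infinity>"
        have "(\<integral>\<^sup>+t. ennreal ((u t)\<^sup>2) \<partial>M i) < \<infinity>" if i: "i \<in> I" for i
        proof -
          note [measurable] = borel_M[OF i mult(2)]
          have "(\<integral>\<^sup>+t. ennreal ((c * u t)\<^sup>2) \<partial>M i) = ennreal (c\<^sup>2) * (\<integral>\<^sup>+t. ennreal ((u t)\<^sup>2) \<partial>M i)"
            by (simp add: power_mult_distrib ennreal_mult nn_integral_cmult)
          moreover have "(\<integral>\<^sup>+t. ennreal ((c * u t)\<^sup>2) \<partial>M i) < top" using fin i by simp
          ultimately have "ennreal (c\<^sup>2) * (\<integral>\<^sup>+t. ennreal ((u t)\<^sup>2) \<partial>M i) < top" by simp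
          then show ?thesis using False by (auto simp: ennreal_mult_less_top)
        qed
        then show "approximable I M (\<lambda>t. c * u t)" using mult by (intro approximable_scale) auto
      qed
    qed
  next
    case (add u v)
    show ?case
    proof
      assume fin: "\<forall>i\<in>I. (\<integral>\<^sup>+t. ennreal ((v t + u t)\<^sup>2) \<partial>M i) < \<infinity>"
      have nn: "0 \<le> u t" "0 \<le> v t" for t using add by auto
      have "(u t)\<^sup>2 \<le> (v t + u t)\<^sup>2" "(v t)\<^sup>2 \<le> (v t + u t)\<^sup>2" for t
        using nn[of t] by (auto intro!: power_mono)
      then have "(\<integral>\<^sup>+t. ennreal ((u t)\<^sup>2) \<partial>M i) \<le> (\<integral>\<^sup>+t. ennreal ((v t + u t)\<^sup>2) \<partial>M i)"
        "(\<integral>\<^sup>+t. ennreal ((v t)\<^sup>2) \<partial>M i) \<le> (\<integral>\<^sup>+t. ennreal ((v t + u t)\<^sup>2) \<partial>M i)" for i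
        by (auto intro!: nn_integral_mono ennreal_leI)
      then show "approximable I M (\<lambda>t. v t + u t)"
        using add fin by (intro approximable_add) (meson le_less_trans)+
    qed
  next
    case (seq U)
    have inc: "incseq U" and lim: "\<And>t. (\<lambda>n. U n t) \<longlonglongrightarrow> u t"
      and pos: "\<And>n t. 0 \<le> U n t"
      and IH: "\<And>n. (\<forall>i\<in>I. (\<integral>\<^sup>+t. ennreal ((U n t)\<^sup>2) \<partial>M i) < \<infinity>) \<longrightarrow> approximable I M (U n)"
      using seq by simp_all
    have le: "U n t \<le> u t" for n t
      using inc lim by (intro incseq_le[of "\<lambda>n. U n t"]) (auto simp: incseq_def le_fun_def)
    show ?case
    proof
      assume fin: "\<forall>i\<in>I. (\<integral>\<^sup>+t. ennreal ((u t)\<^sup>2) \<partial>M i) < \<infinity>"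
      show "approximable I M u"
      proof (rule approximable_limit[where w = "\<lambda>t. (u t)\<^sup>2" and U = U])
        have "(U n t)\<^sup>2 \<le> (u t)\<^sup>2" for n t
          using le pos by (intro power_mono) auto
        then have "(\<integral>\<^sup>+t. ennreal ((U n t)\<^sup>2) \<partial>M i) \<le> (\<integral>\<^sup>+t. ennreal ((u t)\<^sup>2) \<partial>M i)" for i n
          by (auto intro!: nn_integral_mono ennreal_leI)
        then show "approximable I M (U n)" for n
          using IH fin by (meson le_less_trans)
        show "(u t - U n t)\<^sup>2 \<le> (u t)\<^sup>2" for n t
          using le[of n t] pos[of n t] by (intro power_mono) auto
      qed (use seq u fin in auto)
    qed
  qed
  then show ?thesis using assms by blast
qed

theorem poly_dense_nn:
  assumes f [measurable]: "f \<in> borel_measurable borel"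
    and "\<And>i. i \<in> I \<Longrightarrow> (\<integral>\<^sup>+t. ennreal ((f t)\<^sup>2) \<partial>M i) < \<infinity>"
  shows "approximable I M f"
proof -
  have le: "(\<integral>\<^sup>+t. ennreal ((max 0 (f t))\<^sup>2) \<partial>M i) \<le> (\<integral>\<^sup>+t. ennreal ((f t)\<^sup>2) \<partial>M i)"
    "(\<integral>\<^sup>+t. ennreal ((max 0 (- f t))\<^sup>2) \<partial>M i) \<le> (\<integral>\<^sup>+t. ennreal ((f t)\<^sup>2) \<partial>M i)" for i
    by (auto intro!: nn_integral_mono ennreal_leI simp: max_def)
  have "approximable I M (\<lambda>t. max 0 (f t) + (-1) * max 0 (- f t))"
    using assms(2) le
    by (intro approximable_add approximable_scale approximable_nonneg) (auto intro: le_less_trans)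
  moreover have "(\<lambda>t. max 0 (f t) + (-1) * max 0 (- f t)) = f" by (auto simp: max_def)
  ultimately show ?thesis by simp
qed

end

lemma unit_measure_borel:
  "unit_measure M \<Longrightarrow> f \<in> borel_measurable borel \<Longrightarrow> f \<in> borel_measurable M"
  using measurable_cong_sets[of M borel borel borel] by (auto simp: unit_measure_def)

lemma poly_square: "poly (p * p) = (\<lambda>t. (poly p t)\<^sup>2)" for p :: "real poly"
  by (auto simp: power2_eq_square)

lemma unit_measure_integrable_diff_poly:
  assumes M: "unit_measure M" and f: "f \<in> borel_measurable borel" "integrable M (\<lambda>t. (f t)\<^sup>2)"
  shows "integrable M (\<lambda>t. (f t - poly p t)\<^sup>2)"
proof (rule Bochner_Integration.integrable_bound)
  have "integrable M (poly (p * p))" using M by (rule unit_measure_integrable_poly)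
  then show "integrable M (\<lambda>t. 2 * (f t)\<^sup>2 + 2 * (poly p t)\<^sup>2)"
    using f(2) by (simp add: poly_square)
  show "(\<lambda>t. (f t - poly p t)\<^sup>2) \<in> borel_measurable M"
    by (intro unit_measure_borel[OF M]) (use f in measurable)
  show "AE t in M. norm ((f t - poly p t)\<^sup>2) \<le> norm (2 * (f t)\<^sup>2 + 2 * (poly p t)\<^sup>2)"
    using square_triangle[of "f _" "poly p _" 0] by (intro AE_I2) simp
qed

lemma (in unit_measure_family) poly_dense:
  assumes f: "f \<in> borel_measurable borel"
    and int: "\<And>i. i \<in> I \<Longrightarrow> integrable (M i) (\<lambda>t. (f t)\<^sup>2)"
  shows "\<exists>p. \<forall>i\<in>I. (\<lambda>n. \<integral>t. (f t - poly (p n) t)\<^sup>2 \<partial>M i) \<longlonglongrightarrow> 0"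
proof -
  have "approximable I M f"
    by (rule poly_dense_nn[OF f]) (use int in \<open>simp add: nn_integral_eq_integral\<close>)
  then have "\<forall>n. \<exists>p. \<forall>i\<in>I. (\<integral>\<^sup>+t. ennreal ((f t - poly p t)\<^sup>2) \<partial>M i) < ennreal (1 / real (Suc n))"
    unfolding approximable_def by (metis of_nat_0_less_iff zero_less_Suc zero_less_divide_1_iff)
  then obtain p where p: "\<And>n i. i \<in> I \<Longrightarrow> (\<integral>\<^sup>+t. ennreal ((f t - poly (p n) t)\<^sup>2) \<partial>M i) < ennreal (1 / real (Suc n))"
    by metis
  have "(\<lambda>n. \<integral>t. (f t - poly (p n) t)\<^sup>2 \<partial>M i) \<longlonglongrightarrow> 0" if i: "i \<in> I" for i
  proof (rule tendsto_sandwich[of "\<lambda>_. 0" _ _ "\<lambda>n. 1 / real (Suc n)"])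
    have "(\<integral>t. (f t - poly (p n) t)\<^sup>2 \<partial>M i) \<le> 1 / real (Suc n)" for n
      using p[OF i, of n] nn_integral_eq_integral[OF unit_measure_integrable_diff_poly[OF unit[OF i] f int[OF i], of "p n"]]
      by (simp add: ennreal_less_iff)
    then show "\<forall>\<^sub>F n in sequentially. (\<integral>t. (f t - poly (p n) t)\<^sup>2 \<partial>M i) \<le> 1 / real (Suc n)" by simp
    show "(\<lambda>n. 1 / real (Suc n)) \<longlonglongrightarrow> 0" by (rule LIMSEQ_Suc) (rule lim_1_over_n)
  qed auto
  then show ?thesis by blast
qed

text \<open>A form of \<open>2ab \<le> \<delta>a\<^sup>2 + b\<^sup>2/\<delta>\<close> that can be integrated termwise.\<close>
lemma square_perturb:
  fixes a b \<delta> :: real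
  assumes "\<delta> > 0"
  shows "\<bar>b\<^sup>2 - a\<^sup>2\<bar> \<le> \<delta> * a\<^sup>2 + (1 + 1 / \<delta>) * (a - b)\<^sup>2"
proof -
  have s: "0 \<le> (\<delta> * a - (a - b))\<^sup>2 / \<delta>" "0 \<le> (\<delta> * a + (a - b))\<^sup>2 / \<delta>"
    using assms by auto
  have e: "(\<delta> * a - (a - b))\<^sup>2 / \<delta> = \<delta> * a\<^sup>2 - 2 * a * (a - b) + (a - b)\<^sup>2 / \<delta>"
     "(\<delta> * a + (a - b))\<^sup>2 / \<delta> = \<delta> * a\<^sup>2 + 2 * a * (a - b) + (a - b)\<^sup>2 / \<delta>"
    using assms by (auto simp: power2_eq_square field_simps)
  have "b\<^sup>2 - a\<^sup>2 = (a - b)\<^sup>2 - 2 * a * (a - b)" by (simp add: power2_eq_square algebra_simps)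
  moreover have "(1 + 1 / \<delta>) * (a - b)\<^sup>2 = (a - b)\<^sup>2 + (a - b)\<^sup>2 / \<delta>" by (simp add: algebra_simps)
  moreover have "0 \<le> (a - b)\<^sup>2" by simp
  ultimately show ?thesis using s unfolding e by linarith
qed

text \<open>Convergence in \<open>L\<^sup>2\<close> entails convergence of the norms.\<close>
lemma norm_limit:
  assumes M: "unit_measure M" and f: "f \<in> borel_measurable borel" "integrable M (\<lambda>t. (f t)\<^sup>2)"
    and lim: "(\<lambda>n. \<integral>t. (f t - poly (p n) t)\<^sup>2 \<partial>M) \<longlonglongrightarrow> 0"
  shows "(\<lambda>n. \<integral>t. (poly (p n) t)\<^sup>2 \<partial>M) \<longlonglongrightarrow> (\<integral>t. (f t)\<^sup>2 \<partial>M)"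
proof (rule LIMSEQ_I)
  fix e :: real assume e: "e > 0"
  define a where "a = (\<integral>t. (f t)\<^sup>2 \<partial>M)"
  have a: "a \<ge> 0" by (simp add: a_def)
  \<comment> \<open>This choice makes \<open>\<delta> \<integral> f\<^sup>2 < e / 2\<close>, the first half of the error.\<close>
  define \<delta> where "\<delta> = e / (2 * (1 + a))"
  have \<delta>: "\<delta> > 0" "\<delta> * a < e / 2" using e a by (auto simp: \<delta>_def field_simps add_pos_nonneg)
  have "(\<lambda>n. (1 + 1 / \<delta>) * (\<integral>t. (f t - poly (p n) t)\<^sup>2 \<partial>M)) \<longlonglongrightarrow> (1 + 1 / \<delta>) * 0"
    by (intro tendsto_intros lim)
  then have "\<forall>\<^sub>F n in sequentially. (1 + 1 / \<delta>) * (\<integral>t. (f t - poly (p n) t)\<^sup>2 \<partial>M) < e / 2"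
    using e by (intro order_tendstoD(2)[of _ 0]) auto
  then obtain N where N: "\<And>n. n \<ge> N \<Longrightarrow> (1 + 1 / \<delta>) * (\<integral>t. (f t - poly (p n) t)\<^sup>2 \<partial>M) < e / 2"
    by (auto simp: eventually_sequentially)
  have "\<bar>(\<integral>t. (poly (p n) t)\<^sup>2 \<partial>M) - a\<bar> < e" if "n \<ge> N" for n
  proof -
    have ip: "integrable M (\<lambda>t. (poly (p n) t)\<^sup>2)"
      using unit_measure_integrable_poly[OF M, of "p n * p n"] by (simp add: poly_square)
    note id = unit_measure_integrable_diff_poly[OF M f, of "p n"]
    have "\<bar>(\<integral>t. (poly (p n) t)\<^sup>2 \<partial>M) - a\<bar> = \<bar>\<integral>t. (poly (p n) t)\<^sup>2 - (f t)\<^sup>2 \<partial>M\<bar>"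
      using ip f(2) by (simp add: a_def)
    also have "\<dots> \<le> (\<integral>t. \<delta> * (f t)\<^sup>2 + (1 + 1 / \<delta>) * (f t - poly (p n) t)\<^sup>2 \<partial>M)"
      using ip f(2) id square_perturb[OF \<delta>(1)]
      by (intro order_trans[OF integral_abs_bound] integral_mono) auto
    also have "\<dots> = \<delta> * a + (1 + 1 / \<delta>) * (\<integral>t. (f t - poly (p n) t)\<^sup>2 \<partial>M)"
      using f(2) id by (simp add: a_def)
    also have "\<dots> < e" using \<delta>(2) N[OF that] by linarith
    finally show ?thesis .
  qed
  then show "\<exists>no. \<forall>n\<ge>no. norm ((\<integral>t. (poly (p n) t)\<^sup>2 \<partial>M) - (\<integral>t. (f t)\<^sup>2 \<partial>M)) < e"
    by (auto simp: a_def)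
qed

text \<open>Uniqueness in the moment problem: polynomials converging to an indicator in both measures
  have squares with equal integrals.\<close>
lemma unit_measure_eqI:
  assumes M: "unit_measure M" and N: "unit_measure N"
    and eq: "\<And>p. integral\<^sup>L M (poly p) = integral\<^sup>L N (poly p)"
  shows "M = N"
proof (rule measure_eqI)
  have sM: "sets M = sets borel" and sN: "sets N = sets borel"
    using M N by (auto simp: unit_measure_def)
  then show "sets M = sets N" by simp
  fix B assume B: "B \<in> sets M"
  interpret M: finite_measure M using M by (simp add: unit_measure_def)
  interpret N: finite_measure N using N by (simp add: unit_measure_def)
  interpret unit_measure_family UNIV "\<lambda>b. if b then M else N"
    by unfold_locales (use M N in auto)
  have B': "(indicator B :: real \<Rightarrow> real) \<in> borel_measurable borel" using B sM by auto
  have sq: "(indicator B t)\<^sup>2 = (indicator B t :: real)" for t by (auto simp: indicator_def)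
  have i: "integrable M (\<lambda>t. (indicator B t :: real)\<^sup>2)" "integrable N (\<lambda>t. (indicator B t :: real)\<^sup>2)"
    using B sM sN by (auto simp: sq integrable_indicator_iff M.emeasure_eq_measure N.emeasure_eq_measure)
  obtain p where p: "(\<lambda>n. \<integral>t. (indicator B t - poly (p n) t)\<^sup>2 \<partial>M) \<longlonglongrightarrow> 0"
     "(\<lambda>n. \<integral>t. (indicator B t - poly (p n) t)\<^sup>2 \<partial>N) \<longlonglongrightarrow> 0"
  proof -
    have "integrable (if b then M else N) (\<lambda>t. (indicator B t :: real)\<^sup>2)" for b
      using i by simp
    then obtain p where "\<And>b. (\<lambda>n. \<integral>t. (indicator B t - poly (p n) t)\<^sup>2 \<partial>(if b then M else N)) \<longlonglongrightarrow> 0"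
      using poly_dense[OF B'] by blast
    from this[of True] this[of False] show ?thesis by (auto intro: that)
  qed
  have "(\<integral>t. (poly (p n) t)\<^sup>2 \<partial>M) = (\<integral>t. (poly (p n) t)\<^sup>2 \<partial>N)" for n
    using eq[of "p n * p n"] by (simp add: poly_square)
  then have "(\<integral>t. (indicator B t :: real)\<^sup>2 \<partial>M) = (\<integral>t. (indicator B t :: real)\<^sup>2 \<partial>N)"
    using norm_limit[OF M B' i(1) p(1)] norm_limit[OF N B' i(2) p(2)] LIMSEQ_unique by force
  then show "emeasure M B = emeasure N B"
    using B sM sN by (simp add: sq M.emeasure_eq_measure N.emeasure_eq_measure)
qed

section \<open>Complex Hilbert spaces\<close>

lemma cinner_add_left: "cinner (x + y) z = cinner x z + cinner y (z :: 'a::complex_hilbert)"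
  by (metis cinner_add_right cinner_commute complex_cnj_add)

lemma cinner_scaleC_left: "cinner (scaleC c x) y = cnj c * cinner x (y :: 'a::complex_hilbert)"
  by (metis cinner_scaleC_right cinner_commute complex_cnj_mult)

lemma cinner_scaleR_right: "cinner x (r *\<^sub>R y) = of_real r * cinner x (y :: 'a::complex_hilbert)"
  by (metis scaleC_of_real cinner_scaleC_right)

lemma cinner_scaleR_left: "cinner (r *\<^sub>R x) y = of_real r * cinner x (y :: 'a::complex_hilbert)"
  by (metis scaleC_of_real cinner_scaleC_left complex_cnj_complex_of_real)

lemma cinner_zero_right [simp]: "cinner x (0 :: 'a::complex_hilbert) = 0"
  using cinner_scaleR_right[of x 0 0] by simp

lemma cinner_zero_left [simp]: "cinner (0 :: 'a::complex_hilbert) x = 0"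
  using cinner_scaleR_left[of 0 0 x] by simp

lemma cinner_minus_right: "cinner x (- y) = - cinner x (y :: 'a::complex_hilbert)"
  using cinner_scaleR_right[of x "-1" y] by simp

lemma cinner_minus_left: "cinner (- x) y = - cinner x (y :: 'a::complex_hilbert)"
  using cinner_scaleR_left[of "-1" x y] by simp

lemma cinner_diff_right: "cinner x (y - z) = cinner x y - cinner x (z :: 'a::complex_hilbert)"
  using cinner_add_right[of x y "- z"] by (simp add: cinner_minus_right)

lemma cinner_diff_left: "cinner (x - y) z = cinner x z - cinner y (z :: 'a::complex_hilbert)"
  using cinner_add_left[of x "- y" z] by (simp add: cinner_minus_left)

lemma scaleC_one [simp]: "scaleC 1 x = (x :: 'a::complex_hilbert)"
  using scaleC_of_real[of 1 x] by simp

lemma scaleC_zero_left [simp]: "scaleC 0 x = (0 :: 'a::complex_hilbert)"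
  using scaleC_of_real[of 0 x] by simp

lemma scaleC_zero_right [simp]: "scaleC c 0 = (0 :: 'a::complex_hilbert)"
  using scaleC_add_right[of c 0 0] by simp

lemma scaleC_minus_right: "scaleC c (- x) = - scaleC c (x :: 'a::complex_hilbert)"
  using scaleC_add_right[of c x "- x"] by (simp add: eq_neg_iff_add_eq_0 add.commute)

lemma scaleC_diff_right: "scaleC c (x - y) = scaleC c x - scaleC c (y :: 'a::complex_hilbert)"
  using scaleC_add_right[of c x "- y"] by (simp add: scaleC_minus_right)

lemma scaleC_scaleR: "scaleC c (r *\<^sub>R x) = r *\<^sub>R scaleC c (x :: 'a::complex_hilbert)"
  by (metis scaleC_of_real scaleC_scaleC mult.commute)

lemma cinner_self: "cinner x x = of_real ((norm (x :: 'a::complex_hilbert))\<^sup>2)"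
proof -
  have "Im (cinner x x) = 0" using cinner_commute[of x x] by (metis Reals_cnj_iff complex_is_Real_iff)
  then show ?thesis by (simp add: complex_eq_iff Re_cinner power2_norm_eq_inner)
qed

lemma norm_scaleC: "norm (scaleC c x) = cmod c * norm (x :: 'a::complex_hilbert)"
proof -
  have "complex_of_real ((norm (scaleC c x))\<^sup>2) = cinner (scaleC c x) (scaleC c x)"
    by (rule cinner_self[symmetric])
  also have "\<dots> = (c * cnj c) * cinner x x"
    by (simp add: cinner_scaleC_left cinner_scaleC_right)
  also have "\<dots> = complex_of_real ((cmod c * norm x)\<^sup>2)"
    unfolding cinner_self complex_norm_square[symmetric] by (simp add: power_mult_distrib)
  finally have "complex_of_real ((norm (scaleC c x))\<^sup>2) = complex_of_real ((cmod c * norm x)\<^sup>2)" .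
  then have "(norm (scaleC c x))\<^sup>2 = (cmod c * norm x)\<^sup>2"
    by (simp only: of_real_eq_iff)
  then show ?thesis by (simp add: power2_eq_iff_nonneg)
qed

lemma cinner_norm_le: "cmod (cinner x y) \<le> norm x * norm (y :: 'a::complex_hilbert)"
proof (cases "cinner x y = 0")
  case False
  let ?c = "cinner x y"
  have "(cmod ?c)\<^sup>2 = Re (cinner (scaleC ?c x) y)"
    by (simp add: cinner_scaleC_left cmod_power2 flip: power2_eq_square)
  also have "\<dots> \<le> norm (scaleC ?c x) * norm y"
    unfolding Re_cinner by (rule norm_cauchy_schwarz)
  finally have "cmod ?c * cmod ?c \<le> cmod ?c * (norm x * norm y)"
    by (simp add: norm_scaleC power2_eq_square mult.assoc)
  then show ?thesis using False by simp
qed simp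

lemma bounded_bilinear_cinner: "bounded_bilinear (cinner :: 'a::complex_hilbert \<Rightarrow> _)"
proof
  show "\<exists>K. \<forall>a b :: 'a. norm (cinner a b) \<le> norm a * norm b * K"
    by (intro exI[of _ 1]) (simp add: cinner_norm_le)
qed (auto simp: cinner_add_left cinner_add_right cinner_scaleR_left cinner_scaleR_right scaleR_conv_of_real)

lemmas tendsto_cinner = bounded_bilinear.tendsto[OF bounded_bilinear_cinner]

lemma bounded_linear_scaleC: "bounded_linear (scaleC c :: 'a::complex_hilbert \<Rightarrow> 'a)"
  by (rule bounded_linear_intro[of _ "cmod c"])
     (auto simp: scaleC_add_right scaleC_scaleR norm_scaleC mult.commute)

lemmas tendsto_scaleC = bounded_linear.tendsto[OF bounded_linear_scaleC]

text \<open>Polarization: over the complex numbers a sesquilinear form is determined by its diagonal.\<close>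
lemma sesquilinear_zero:
  fixes B :: "'a::complex_hilbert \<Rightarrow> 'a \<Rightarrow> complex"
  assumes V: "csubspace V"
    and add: "\<And>x y z. x \<in> V \<Longrightarrow> y \<in> V \<Longrightarrow> z \<in> V \<Longrightarrow> B (x + y) z = B x z + B y z"
      "\<And>x y z. x \<in> V \<Longrightarrow> y \<in> V \<Longrightarrow> z \<in> V \<Longrightarrow> B x (y + z) = B x y + B x z"
    and scale: "\<And>c x y. x \<in> V \<Longrightarrow> y \<in> V \<Longrightarrow> B (scaleC c x) y = cnj c * B x y"
      "\<And>c x y. x \<in> V \<Longrightarrow> y \<in> V \<Longrightarrow> B x (scaleC c y) = c * B x y"
    and diag: "\<And>x. x \<in> V \<Longrightarrow> B x x = 0"
    and x: "x \<in> V" and y: "y \<in> V"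
  shows "B x y = 0"
proof -
  have sum: "B u v + B v u = 0" if "u \<in> V" "v \<in> V" for u v
  proof -
    have uv: "u + v \<in> V" using V that unfolding csubspace_def by blast
    have "B (u + v) (u + v) = B u u + B u v + (B v u + B v v)"
      using that uv by (simp add: add)
    then show ?thesis using diag that uv by (simp add: add.commute)
  qed
  have "scaleC \<i> y \<in> V" using V y unfolding csubspace_def by blast
  from sum[OF x this] scale x y have "\<i> * B x y - \<i> * B y x = 0" by simp
  then have "B x y = B y x" by simp
  with sum[OF x y] show ?thesis by simp
qed

text \<open>The projection theorem: a minimizing sequence for the distance is Cauchy by the parallelogram law.\<close>
theorem orthogonal_decomposition:
  fixes M :: "'a::complex_hilbert set"
  assumes M: "csubspace M" and cl: "closed M"
  shows "\<exists>m\<in>M. \<forall>u\<in>M. cinner u (y - m) = 0"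
proof -
  have M0: "0 \<in> M" and Madd: "\<And>u v. u \<in> M \<Longrightarrow> v \<in> M \<Longrightarrow> u + v \<in> M"
    and Msc: "\<And>c u. u \<in> M \<Longrightarrow> scaleC c u \<in> M"
    using M unfolding csubspace_def by auto
  have MR: "r *\<^sub>R u \<in> M" if "u \<in> M" for r u using Msc[OF that, of "of_real r"] by (simp add: scaleC_of_real)
  define d where "d = (INF m\<in>M. norm (y - m))"
  have bdd: "bdd_below ((\<lambda>m. norm (y - m)) ` M)" by (rule bdd_belowI[of _ 0]) auto
  have dle: "d \<le> norm (y - m)" if "m \<in> M" for m
    unfolding d_def by (rule cINF_lower[OF bdd that])
  have d0: "d \<ge> 0" unfolding d_def using M0 by (intro cINF_greatest) auto
  have "\<exists>m\<in>M. norm (y - m) < d + 1 / real (Suc n)" for n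
  proof -
    have "Inf ((\<lambda>m. norm (y - m)) ` M) < d + 1 / real (Suc n)" by (simp add: d_def)
    then show ?thesis using M0 bdd by (subst (asm) cInf_less_iff) auto
  qed
  then obtain s where sM: "\<And>n. s n \<in> M" and s: "\<And>n. norm (y - s n) < d + 1 / real (Suc n)"
    by metis
  \<comment> \<open>The parallelogram law for \<open>y - s n\<close> and \<open>y - s k\<close>, whose mean has norm at least \<open>d\<close>.\<close>
  have close: "(norm (s n - s k))\<^sup>2 \<le> (8 * d + 4) * (1 / real (Suc N))" if "n \<ge> N" "k \<ge> N" for n k N
  proof -
    define e where "e = 1 / real (Suc N)"
    have e: "0 < e" "e \<le> 1" by (auto simp: e_def)
    have up: "norm (y - s j) \<le> d + e" if "j \<ge> N" for j
    proof -
      have "1 / real (Suc j) \<le> e" using that unfolding e_def by (intro divide_left_mono) auto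
      then show ?thesis using s[of j] by linarith
    qed
    have "(1/2) *\<^sub>R (s n + s k) \<in> M" by (intro MR Madd sM)
    from dle[OF this] have "d\<^sup>2 \<le> (norm (y - (1/2) *\<^sub>R (s n + s k)))\<^sup>2"
      using d0 by (intro power_mono)
    moreover have "(norm (s n - s k))\<^sup>2 + 4 * (norm (y - (1/2) *\<^sub>R (s n + s k)))\<^sup>2 =
        2 * (norm (y - s n))\<^sup>2 + 2 * (norm (y - s k))\<^sup>2"
      unfolding power2_norm_eq_inner by (simp add: inner_diff inner_add inner_commute algebra_simps)
    moreover have "(norm (y - s n))\<^sup>2 \<le> (d + e)\<^sup>2" "(norm (y - s k))\<^sup>2 \<le> (d + e)\<^sup>2"
      using up that by (auto intro!: power_mono)
    ultimately have "(norm (s n - s k))\<^sup>2 \<le> 4 * (d + e)\<^sup>2 - 4 * d\<^sup>2" by linarith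
    also have "\<dots> = 8 * d * e + 4 * e * e" by (simp add: power2_eq_square algebra_simps)
    also have "\<dots> \<le> 8 * d * e + 4 * e * 1" using e by (intro add_left_mono mult_left_mono) auto
    also have "\<dots> = (8 * d + 4) * e" by (simp add: algebra_simps)
    finally show ?thesis by (simp add: e_def)
  qed
  have "Cauchy s"
  proof (rule CauchyI)
    fix \<epsilon> :: real assume \<epsilon>: "\<epsilon> > 0"
    have "(\<lambda>n. (8 * d + 4) * (1 / real (Suc n))) \<longlonglongrightarrow> (8 * d + 4) * 0"
      by (intro tendsto_intros LIMSEQ_Suc[OF lim_1_over_n])
    then have "\<forall>\<^sub>F n in sequentially. (8 * d + 4) * (1 / real (Suc n)) < \<epsilon>\<^sup>2"
      using \<epsilon> by (intro order_tendstoD(2)[of _ 0]) auto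
    then obtain N where N: "(8 * d + 4) * (1 / real (Suc N)) < \<epsilon>\<^sup>2"
      by (auto simp: eventually_sequentially)
    have "norm (s n - s k) < \<epsilon>" if "n \<ge> N" "k \<ge> N" for n k
      using close[OF that] N \<epsilon> by (intro power_less_imp_less_base[of _ 2 \<epsilon>]) auto
    then show "\<exists>N. \<forall>m\<ge>N. \<forall>n\<ge>N. norm (s m - s n) < \<epsilon>" by blast
  qed
  then obtain m where lim: "s \<longlonglongrightarrow> m" using Cauchy_convergent convergent_def by blast
  have mM: "m \<in> M" using closed_sequentially[OF cl sM lim] .
  have "(\<lambda>n. norm (y - s n)) \<longlonglongrightarrow> norm (y - m)" by (intro tendsto_intros lim)
  moreover have "(\<lambda>n. d + 1 / real (Suc n)) \<longlonglongrightarrow> d + 0"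
    by (intro tendsto_intros LIMSEQ_Suc[OF lim_1_over_n])
  ultimately have md: "norm (y - m) \<le> d"
    using s LIMSEQ_le[of "\<lambda>n. norm (y - s n)" "norm (y - m)" "\<lambda>n. d + 1 / real (Suc n)" d] less_imp_le by auto
  have orth: "inner u (y - m) = 0" if u: "u \<in> M" for u
  proof (cases "u = 0")
    case False
    \<comment> \<open>The coefficient that minimizes the norm of \<open>y - m - t u\<close>.\<close>
    define t where "t = inner u (y - m) / (norm u)\<^sup>2"
    have "m + t *\<^sub>R u \<in> M" by (intro Madd MR mM u)
    from dle[OF this] md have "norm (y - m) \<le> norm ((y - m) - t *\<^sub>R u)" by (simp add: algebra_simps)
    then have "(norm (y - m))\<^sup>2 \<le> (norm ((y - m) - t *\<^sub>R u))\<^sup>2" by (intro power_mono) auto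
    also have "\<dots> = (norm (y - m))\<^sup>2 - 2 * t * inner u (y - m) + t\<^sup>2 * (norm u)\<^sup>2"
      unfolding power2_norm_eq_inner
      by (simp add: inner_diff inner_commute power2_eq_square algebra_simps)
    also have "\<dots> = (norm (y - m))\<^sup>2 - (inner u (y - m))\<^sup>2 / (norm u)\<^sup>2"
      using False by (simp add: t_def power2_eq_square field_simps)
    finally have "(inner u (y - m))\<^sup>2 / (norm u)\<^sup>2 \<le> 0" by simp
    then show ?thesis using False by (simp add: divide_le_0_iff)
  qed simp
  have "cinner u (y - m) = 0" if u: "u \<in> M" for u
  proof -
    have "inner u (y - m) = 0" "inner (scaleC (- \<i>) u) (y - m) = 0" using orth Msc u by auto
    then show ?thesis
      by (simp add: complex_eq_iff Re_cinner[symmetric] cinner_scaleC_left)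
  qed
  then show ?thesis using mM by blast
qed

lemma csubspace_closure:
  assumes "csubspace (M :: 'a::complex_hilbert set)"
  shows "csubspace (closure M)"
  unfolding csubspace_def
proof (intro conjI ballI allI)
  show "0 \<in> closure M" using assms closure_subset unfolding csubspace_def by blast
next
  fix x y assume "x \<in> closure M" "y \<in> closure M"
  then obtain a b where "\<And>n. a n \<in> M" "a \<longlonglongrightarrow> x" "\<And>n. b n \<in> M" "b \<longlonglongrightarrow> y"
    unfolding closure_sequential by blast
  then show "x + y \<in> closure M"
    using assms unfolding closure_sequential csubspace_def
    by (intro exI[of _ "\<lambda>n. a n + b n"]) (auto intro: tendsto_add)
next
  fix c x assume "x \<in> closure M"
  then obtain a where "\<And>n. a n \<in> M" "a \<longlonglongrightarrow> x"
    unfolding closure_sequential by blast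
  then show "scaleC c x \<in> closure M"
    using assms unfolding closure_sequential csubspace_def
    by (intro exI[of _ "\<lambda>n. scaleC c (a n)"]) (auto intro: tendsto_scaleC)
qed

text \<open>The projection theorem in the form that produces dense ranges.\<close>
lemma dense_if_no_orthogonal:
  fixes M :: "'a::complex_hilbert set"
  assumes M: "csubspace M" and orth: "\<And>y. (\<forall>u\<in>M. cinner u y = 0) \<Longrightarrow> y = 0"
  shows "closure M = UNIV"
proof -
  have "y \<in> closure M" for y
  proof -
    obtain m where m: "m \<in> closure M" "\<forall>u\<in>closure M. cinner u (y - m) = 0"
      using orthogonal_decomposition[OF csubspace_closure[OF M] closed_closure, of y] by blast
    have "y - m = 0" using m(2) closure_subset by (intro orth) blast
    then show ?thesis using m(1) by simp
  qed
  then show ?thesis by blast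
qed

lemma orthogonal_dense_zero:
  fixes M :: "'a::complex_hilbert set"
  assumes M: "closure M = UNIV" and orth: "\<And>u. u \<in> M \<Longrightarrow> cinner u y = 0"
  shows "y = 0"
proof -
  have "y \<in> closure M" using M by simp
  then obtain a where a: "\<And>n. a n \<in> M" "a \<longlonglongrightarrow> y" unfolding closure_sequential by blast
  have "(\<lambda>n. cinner (a n) y) \<longlonglongrightarrow> cinner y y" by (intro tendsto_cinner a tendsto_const)
  then have "cinner y y = 0" using a(1) by (simp add: orth LIMSEQ_const_iff)
  then show ?thesis by (simp add: cinner_self)
qed

section \<open>Functional calculus of a positive contraction\<close>

text \<open>The operator \<open>p(C)\<close>, by Horner's scheme.\<close>
definition oper_poly :: "('a::real_vector \<Rightarrow> 'a) \<Rightarrow> real poly \<Rightarrow> 'a \<Rightarrow> 'a" where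
  "oper_poly C p = fold_coeffs (\<lambda>a g x. a *\<^sub>R x + C (g x)) p (\<lambda>_. 0)"

locale positive_contraction =
  fixes C :: "'a::complex_hilbert \<Rightarrow> 'a"
  assumes C_add: "C (x + y) = C x + C y"
    and C_scaleC: "C (scaleC c x) = scaleC c (C x)"
    and C_sym: "cinner (C x) y = cinner x (C y)"
    and C_pos: "0 \<le> inner x (C x)"
    and C_norm: "norm (C x) \<le> norm x"
begin

lemma C_scaleR: "C (r *\<^sub>R x) = r *\<^sub>R C x"
  using C_scaleC[of "of_real r" x] by (simp add: scaleC_of_real)

lemma C_zero [simp]: "C 0 = 0" using C_scaleR[of 0 0] by simp

lemma C_minus: "C (- x) = - C x" using C_scaleR[of "-1" x] by simp

lemma C_bounded_linear: "bounded_linear C"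
  by (rule bounded_linear_intro[of _ 1]) (auto simp: C_add C_scaleR C_norm)

abbreviation pcalc where "pcalc \<equiv> oper_poly C"

lemma pcalc_pCons: "pcalc (pCons a p) x = a *\<^sub>R x + C (pcalc p x)"
  by (cases "p = 0 \<and> a = 0") (auto simp: oper_poly_def)

lemma pcalc_0 [simp]: "pcalc 0 x = 0"
  by (simp add: oper_poly_def)

lemma pcalc_1 [simp]: "pcalc 1 x = x"
  by (simp add: one_pCons pcalc_pCons)

lemma pcalc_X: "pcalc [:0, 1:] x = C x"
  by (simp add: pcalc_pCons)

lemma pcalc_1_minus_X: "pcalc [:1, -1:] x = x - C x"
  by (simp add: pcalc_pCons C_minus)

lemma pcalc_add: "pcalc (p + r) x = pcalc p x + pcalc r x"
  by (induction p r rule: poly_induct2) (auto simp: pcalc_pCons C_add algebra_simps)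

lemma pcalc_smult: "pcalc (smult c p) x = c *\<^sub>R pcalc p x"
  by (induction p) (auto simp: pcalc_pCons C_scaleR algebra_simps)

lemma pcalc_diff: "pcalc (p - r) x = pcalc p x - pcalc r x"
  using pcalc_add[of "p - r" r x] by (simp add: algebra_simps)

lemma pcalc_add_right: "pcalc p (x + y) = pcalc p x + pcalc p y"
  by (induction p) (auto simp: pcalc_pCons C_add algebra_simps)

lemma pcalc_C: "pcalc p (C x) = C (pcalc p x)"
  by (induction p) (auto simp: pcalc_pCons C_add C_scaleR)

lemma pcalc_mult: "pcalc (p * r) x = pcalc p (pcalc r x)"
  by (induction p) (auto simp: pcalc_pCons pcalc_add pcalc_smult)

lemma pcalc_sym: "cinner (pcalc p x) y = cinner x (pcalc p y)"
  by (induction p arbitrary: x y)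
     (simp_all add: pcalc_pCons cinner_add_left cinner_add_right cinner_scaleR_left cinner_scaleR_right C_sym flip: pcalc_C)

lemma pcalc_sym_inner: "inner (pcalc p x) y = inner x (pcalc p y)"
  using pcalc_sym[of p x y] by (simp flip: Re_cinner)

lemma pcalc_norm: "(norm (pcalc p x))\<^sup>2 = inner x (pcalc (p * p) x)"
  by (simp add: power2_norm_eq_inner pcalc_mult pcalc_sym_inner)

lemma pcalc_bounded_linear: "bounded_linear (pcalc p)"
proof (induction p)
  case 0
  have "pcalc 0 = (\<lambda>_. 0)" by auto
  then show ?case by simp
next
  case (pCons a p)
  have "pcalc (pCons a p) = (\<lambda>x. a *\<^sub>R x + C (pcalc p x))" by (auto simp: pcalc_pCons)
  then show ?case
    using pCons by (simp add: bounded_linear_add bounded_linear_scaleR_right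
        bounded_linear_compose[OF C_bounded_linear])
qed

text \<open>The operator \<open>C\<^sup>k (1 - C)\<^sup>l\<close> is positive. Splitting off squares leaves exponents 0 or 1, and
  \<open>C (1 - C) = C\<^sup>2 (1 - C) + C (1 - C)\<^sup>2\<close> settles the mixed case.\<close>
lemma pcalc_pos: "0 \<le> inner x (pcalc ([:0, 1:] ^ k * [:1, -1:] ^ l) x)"
proof -
  let ?X = "[:0, 1:] :: real poly" and ?Y = "[:1, -1:] :: real poly"
  define r where "r = ?X ^ (k div 2) * ?Y ^ (l div 2)"
  define s where "s = ?X ^ (k mod 2) * ?Y ^ (l mod 2)"
  have pw: "p ^ k = p ^ (k div 2) * p ^ (k div 2) * p ^ (k mod 2)" for p :: "real poly" and k
    by (metis div_mult_mod_eq mult_2_right power_add)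
  have "?X ^ k * ?Y ^ l = r * (s * r)"
    by (subst (1) pw, subst (2) pw) (simp only: r_def s_def ac_simps)
  then have "inner x (pcalc (?X ^ k * ?Y ^ l) x) = inner (pcalc r x) (pcalc s (pcalc r x))"
    by (simp add: pcalc_mult pcalc_sym_inner)
  also have "0 \<le> inner y (pcalc s y)" for y
  proof -
    have X: "0 \<le> inner y (C y)" for y by (rule C_pos)
    have Y: "0 \<le> inner y (y - C y)" for y
    proof -
      have "inner y (C y) \<le> norm y * norm (C y)" by (rule norm_cauchy_schwarz)
      also have "\<dots> \<le> norm y * norm y" by (intro mult_left_mono C_norm) auto
      finally show ?thesis by (simp add: inner_diff_right power2_norm_eq_inner[symmetric] power2_eq_square)
    qed
    have XY: "0 \<le> inner y (C (y - C y))"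
    proof -
      have "C (y - C y) = C y - C (C y)" using pcalc_diff[of 1 "[:0,1:]"] C_bounded_linear
        by (simp add: bounded_linear.linear linear_diff)
      moreover have "inner (C y) (C y - C (C y)) + inner (y - C y) (C (y - C y)) = inner y (C (y - C y))"
        using calculation by (simp add: inner_diff_left)
      ultimately show ?thesis using Y[of "C y"] X[of "y - C y"] by linarith
    qed
    have "k mod 2 = 0 \<or> k mod 2 = 1" "l mod 2 = 0 \<or> l mod 2 = 1" by auto
    then show ?thesis
      unfolding s_def using X[of y] Y[of y] XY
      by (elim disjE) (simp_all only: power_0 power_one_right mult_1_left mult_1_right pcalc_1 pcalc_X pcalc_1_minus_X pcalc_mult inner_ge_zero)
  qed
  finally show ?thesis .
qed

text \<open>The measure with \<open>\<integral> p d\<mu>\<^sub>x = \<langle>x, p(C) x\<rangle>\<close>: the spectral measure of \<open>C\<close> at \<open>x\<close>.\<close>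
definition \<mu> :: "'a \<Rightarrow> real measure" where
  "\<mu> x = (SOME M. unit_measure M \<and> (\<forall>p. integral\<^sup>L M (poly p) = inner x (pcalc p x)))"

lemma mu: "unit_measure (\<mu> x)" "integral\<^sup>L (\<mu> x) (poly p) = inner x (pcalc p x)"
proof -
  interpret hausdorff_functional "\<lambda>p. inner x (pcalc p x)"
    by unfold_locales (simp_all add: pcalc_add pcalc_smult inner_add_right pcalc_pos)
  have "unit_measure (\<mu> x) \<and> (\<forall>p. integral\<^sup>L (\<mu> x) (poly p) = inner x (pcalc p x))"
    unfolding \<mu>_def using moment_measure by (rule someI_ex)
  then show "unit_measure (\<mu> x)" "integral\<^sup>L (\<mu> x) (poly p) = inner x (pcalc p x)" by auto
qed

lemma mu_square: "(\<integral>t. (poly p t)\<^sup>2 \<partial>\<mu> x) = (norm (pcalc p x))\<^sup>2"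
  using mu(2)[of x "p * p"] by (simp add: poly_square pcalc_norm)

lemma borel_mu: "f \<in> borel_measurable borel \<Longrightarrow> f \<in> borel_measurable (\<mu> x)"
  by (rule unit_measure_borel[OF mu(1)])

lemma finite_mu: "finite_measure (\<mu> x)" using mu(1)[of x] by (simp add: unit_measure_def)

lemma sets_mu: "sets (\<mu> x) = sets borel" using mu(1)[of x] by (simp add: unit_measure_def)

lemma space_mu: "space (\<mu> x) = UNIV" using sets_eq_imp_space_eq[OF sets_mu] by simp

text \<open>The domain of \<open>f(C)\<close>.\<close>
definition fdom :: "(real \<Rightarrow> real) \<Rightarrow> 'a set" where
  "fdom f = {x. integrable (\<mu> x) (\<lambda>t. (f t)\<^sup>2)}"

text \<open>The vector \<open>f(C) x\<close>, as the limit of \<open>p\<^sub>n(C) x\<close> for polynomials \<open>p\<^sub>n \<rightarrow> f\<close> in \<open>L\<^sup>2(\<mu>\<^sub>x)\<close>. It is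
  meaningful for Borel functions \<open>f\<close> and \<open>x \<in> fdom f\<close>.\<close>
definition fcalc :: "(real \<Rightarrow> real) \<Rightarrow> 'a \<Rightarrow> 'a" where
  "fcalc f x = (SOME y. \<exists>p. (\<lambda>n. \<integral>t. (f t - poly (p n) t)\<^sup>2 \<partial>\<mu> x) \<longlonglongrightarrow> 0 \<and> (\<lambda>n. pcalc (p n) x) \<longlonglongrightarrow> y)"

lemma fdom_bounded:
  assumes "f \<in> borel_measurable borel" "\<And>t. \<bar>f t\<bar> \<le> B"
  shows "x \<in> fdom f"
proof -
  interpret finite_measure "\<mu> x" by (rule finite_mu)
  have "(f t)\<^sup>2 \<le> B\<^sup>2" for t using assms(2)[of t] power_mono[of "\<bar>f t\<bar>" B 2] by simp
  then show ?thesis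
    unfolding fdom_def using borel_mu[OF assms(1), of x]
    by (auto intro!: integrable_const_bound[of _ "B\<^sup>2"])
qed

lemma pcalc_dist:
  assumes f: "f \<in> borel_measurable borel" "x \<in> fdom f"
  shows "(norm (pcalc p x - pcalc r x))\<^sup>2 \<le>
    2 * (\<integral>t. (f t - poly p t)\<^sup>2 \<partial>\<mu> x) + 2 * (\<integral>t. (f t - poly r t)\<^sup>2 \<partial>\<mu> x)"
proof -
  have i: "integrable (\<mu> x) (\<lambda>t. (f t - poly p t)\<^sup>2)" for p
    using unit_measure_integrable_diff_poly[OF mu(1) f(1)] f(2) by (simp add: fdom_def)
  have "(norm (pcalc p x - pcalc r x))\<^sup>2 = (\<integral>t. (poly p t - poly r t)\<^sup>2 \<partial>\<mu> x)"
    using mu_square[where p = "p - r" and x = x] by (simp add: pcalc_diff)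
  also have "\<dots> \<le> (\<integral>t. 2 * (f t - poly p t)\<^sup>2 + 2 * (f t - poly r t)\<^sup>2 \<partial>\<mu> x)"
  proof (rule integral_mono)
    show "integrable (\<mu> x) (\<lambda>t. (poly p t - poly r t)\<^sup>2)"
      using unit_measure_integrable_poly[OF mu(1), where p = "(p - r) * (p - r)"] by (simp only: poly_square poly_diff)
    show "(poly p t - poly r t)\<^sup>2 \<le> 2 * (f t - poly p t)\<^sup>2 + 2 * (f t - poly r t)\<^sup>2" for t
      using square_triangle[of "poly p t" "poly r t" "f t"] by (simp add: power2_commute)
  qed (use i in auto)
  also have "\<dots> = 2 * (\<integral>t. (f t - poly p t)\<^sup>2 \<partial>\<mu> x) + 2 * (\<integral>t. (f t - poly r t)\<^sup>2 \<partial>\<mu> x)"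
    using i by simp
  finally show ?thesis .
qed

text \<open>The limit defining \<open>f(C) x\<close> does not depend on the sequence, since
  \<open>\<parallel>p(C) x - r(C) x\<parallel>\<close> is the distance of \<open>p\<close> and \<open>r\<close> in \<open>L\<^sup>2(\<mu>\<^sub>x)\<close>.\<close>
lemma fcalc_lim:
  assumes f: "f \<in> borel_measurable borel" "x \<in> fdom f"
    and p: "(\<lambda>n. \<integral>t. (f t - poly (p n) t)\<^sup>2 \<partial>\<mu> x) \<longlonglongrightarrow> 0"
  shows "(\<lambda>n. pcalc (p n) x) \<longlonglongrightarrow> fcalc f x"
proof -
  let ?I = "\<lambda>p. \<integral>t. (f t - poly p t)\<^sup>2 \<partial>\<mu> x"
  have "Cauchy (\<lambda>n. pcalc (p n) x)"
  proof (rule CauchyI)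
    fix e :: real assume e: "e > 0"
    then have "\<forall>\<^sub>F n in sequentially. ?I (p n) < e\<^sup>2 / 4"
      using p by (intro order_tendstoD(2)[of _ 0]) auto
    then obtain N where N: "\<And>n. n \<ge> N \<Longrightarrow> ?I (p n) < e\<^sup>2 / 4"
      by (auto simp: eventually_sequentially)
    have "norm (pcalc (p m) x - pcalc (p n) x) < e" if "m \<ge> N" "n \<ge> N" for m n
    proof -
      have "(norm (pcalc (p m) x - pcalc (p n) x))\<^sup>2 < e\<^sup>2"
        using pcalc_dist[OF f, of "p m" "p n"] N[OF that(1)] N[OF that(2)] by linarith
      then show ?thesis using e by (intro power_less_imp_less_base[of _ 2 e]) auto
    qed
    then show "\<exists>M. \<forall>m\<ge>M. \<forall>n\<ge>M. norm (pcalc (p m) x - pcalc (p n) x) < e" by blast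
  qed
  then obtain y where y: "(\<lambda>n. pcalc (p n) x) \<longlonglongrightarrow> y" using Cauchy_convergent convergent_def by blast
  have "\<exists>r. (\<lambda>n. ?I (r n)) \<longlonglongrightarrow> 0 \<and> (\<lambda>n. pcalc (r n) x) \<longlonglongrightarrow> fcalc f x"
    unfolding fcalc_def by (rule someI_ex) (use p y in blast)
  then obtain r where r: "(\<lambda>n. ?I (r n)) \<longlonglongrightarrow> 0" "(\<lambda>n. pcalc (r n) x) \<longlonglongrightarrow> fcalc f x" by blast
  have "(\<lambda>n. 2 * ?I (p n) + 2 * ?I (r n)) \<longlonglongrightarrow> 2 * 0 + 2 * 0"
    by (intro tendsto_intros p r)
  then have "(\<lambda>n. (norm (pcalc (p n) x - pcalc (r n) x))\<^sup>2) \<longlonglongrightarrow> 0"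
    by (intro tendsto_sandwich[of "\<lambda>_. 0" "\<lambda>n. (norm (pcalc (p n) x - pcalc (r n) x))\<^sup>2" _ "\<lambda>n. 2 * ?I (p n) + 2 * ?I (r n)"])
       (use pcalc_dist[OF f] in auto)
  then have "(\<lambda>n. sqrt ((norm (pcalc (p n) x - pcalc (r n) x))\<^sup>2)) \<longlonglongrightarrow> sqrt 0"
    by (rule tendsto_real_sqrt)
  then have "(\<lambda>n. pcalc (p n) x - pcalc (r n) x) \<longlonglongrightarrow> 0"
    by (simp add: tendsto_norm_zero_iff)
  from tendsto_add[OF this r(2)] show ?thesis by simp
qed

lemma common_approximation:
  assumes f: "f \<in> borel_measurable borel" and X: "finite X" "X \<subseteq> fdom f"
  obtains p where "\<And>x. x \<in> X \<Longrightarrow> (\<lambda>n. \<integral>t. (f t - poly (p n) t)\<^sup>2 \<partial>\<mu> x) \<longlonglongrightarrow> 0"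
    "\<And>x. x \<in> X \<Longrightarrow> (\<lambda>n. pcalc (p n) x) \<longlonglongrightarrow> fcalc f x"
proof -
  interpret unit_measure_family X \<mu> by unfold_locales (use X mu in auto)
  obtain p where p: "\<And>x. x \<in> X \<Longrightarrow> (\<lambda>n. \<integral>t. (f t - poly (p n) t)\<^sup>2 \<partial>\<mu> x) \<longlonglongrightarrow> 0"
    using poly_dense[OF f] X unfolding fdom_def by blast
  moreover have "(\<lambda>n. pcalc (p n) x) \<longlonglongrightarrow> fcalc f x" if "x \<in> X" for x
    using fcalc_lim[OF f _ p[OF that]] X that by blast
  ultimately show ?thesis by (rule that)
qed

lemma norm_fcalc:
  assumes f: "f \<in> borel_measurable borel" "x \<in> fdom f"
  shows "(norm (fcalc f x))\<^sup>2 = (\<integral>t. (f t)\<^sup>2 \<partial>\<mu> x)"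
proof -
  obtain p where p: "(\<lambda>n. \<integral>t. (f t - poly (p n) t)\<^sup>2 \<partial>\<mu> x) \<longlonglongrightarrow> 0" "(\<lambda>n. pcalc (p n) x) \<longlonglongrightarrow> fcalc f x"
    using common_approximation[OF f(1), of "{x}"] f(2) by auto
  have "(\<lambda>n. (norm (pcalc (p n) x))\<^sup>2) \<longlonglongrightarrow> (norm (fcalc f x))\<^sup>2"
    by (intro tendsto_intros p)
  moreover have "(\<lambda>n. (norm (pcalc (p n) x))\<^sup>2) \<longlonglongrightarrow> (\<integral>t. (f t)\<^sup>2 \<partial>\<mu> x)"
    using norm_limit[OF mu(1) f(1) _ p(1)] f(2) by (simp add: mu_square fdom_def)
  ultimately show ?thesis by (rule LIMSEQ_unique)
qed

lemma fcalc_poly: "x \<in> fdom (poly p)" "fcalc (poly p) x = pcalc p x"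
proof -
  show d: "x \<in> fdom (poly p)"
    unfolding fdom_def using unit_measure_integrable_poly[OF mu(1), where p = "p * p"] by (simp only: poly_square mem_Collect_eq)
  have "(\<lambda>n. pcalc p x) \<longlonglongrightarrow> fcalc (poly p) x"
    by (rule fcalc_lim[OF _ d]) auto
  then show "fcalc (poly p) x = pcalc p x" by (simp add: LIMSEQ_const_iff)
qed

lemma L2_add:
  assumes f: "f \<in> borel_measurable borel" "x \<in> fdom f" and g: "g \<in> borel_measurable borel" "x \<in> fdom g"
  shows "x \<in> fdom (\<lambda>t. f t + g t)"
    and "(\<integral>t. (f t + g t)\<^sup>2 \<partial>\<mu> x) \<le> 2 * (\<integral>t. (f t)\<^sup>2 \<partial>\<mu> x) + 2 * (\<integral>t. (g t)\<^sup>2 \<partial>\<mu> x)"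
proof -
  note [measurable] = borel_mu[OF f(1), of x] borel_mu[OF g(1), of x]
  have i: "integrable (\<mu> x) (\<lambda>t. (f t)\<^sup>2)" "integrable (\<mu> x) (\<lambda>t. (g t)\<^sup>2)"
    using f g by (auto simp: fdom_def)
  have le: "(f t + g t)\<^sup>2 \<le> 2 * (f t)\<^sup>2 + 2 * (g t)\<^sup>2" for t
    using square_triangle[of "f t" "- g t" 0] by simp
  show "x \<in> fdom (\<lambda>t. f t + g t)"
    unfolding fdom_def mem_Collect_eq
    by (rule Bochner_Integration.integrable_bound[where f = "\<lambda>t. 2 * (f t)\<^sup>2 + 2 * (g t)\<^sup>2"])
       (use i le in auto)
  then have "(\<integral>t. (f t + g t)\<^sup>2 \<partial>\<mu> x) \<le> (\<integral>t. 2 * (f t)\<^sup>2 + 2 * (g t)\<^sup>2 \<partial>\<mu> x)"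
    using i le by (intro integral_mono) (auto simp: fdom_def)
  then show "(\<integral>t. (f t + g t)\<^sup>2 \<partial>\<mu> x) \<le> 2 * (\<integral>t. (f t)\<^sup>2 \<partial>\<mu> x) + 2 * (\<integral>t. (g t)\<^sup>2 \<partial>\<mu> x)"
    using i by simp
qed

lemma fcalc_add_fun:
  assumes f: "f \<in> borel_measurable borel" "x \<in> fdom f" and g: "g \<in> borel_measurable borel" "x \<in> fdom g"
  shows "fcalc (\<lambda>t. f t + g t) x = fcalc f x + fcalc g x"
proof -
  obtain p where p: "(\<lambda>n. \<integral>t. (f t - poly (p n) t)\<^sup>2 \<partial>\<mu> x) \<longlonglongrightarrow> 0" "(\<lambda>n. pcalc (p n) x) \<longlonglongrightarrow> fcalc f x"
    using common_approximation[OF f(1), of "{x}"] f(2) by auto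
  obtain r where r: "(\<lambda>n. \<integral>t. (g t - poly (r n) t)\<^sup>2 \<partial>\<mu> x) \<longlonglongrightarrow> 0" "(\<lambda>n. pcalc (r n) x) \<longlonglongrightarrow> fcalc g x"
    using common_approximation[OF g(1), of "{x}"] g(2) by auto
  have d: "x \<in> fdom (\<lambda>t. f t - poly p t)" if "f \<in> borel_measurable borel" "x \<in> fdom f" for f p
    using that unit_measure_integrable_diff_poly[OF mu(1) that(1)] by (auto simp: fdom_def)
  have "(\<lambda>n. 2 * (\<integral>t. (f t - poly (p n) t)\<^sup>2 \<partial>\<mu> x) + 2 * (\<integral>t. (g t - poly (r n) t)\<^sup>2 \<partial>\<mu> x)) \<longlonglongrightarrow> 2 * 0 + 2 * 0"
    by (intro tendsto_intros p r)
  moreover have "(\<integral>t. (f t + g t - poly (p n + r n) t)\<^sup>2 \<partial>\<mu> x) \<le>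
      2 * (\<integral>t. (f t - poly (p n) t)\<^sup>2 \<partial>\<mu> x) + 2 * (\<integral>t. (g t - poly (r n) t)\<^sup>2 \<partial>\<mu> x)" for n
    using L2_add(2)[OF _ d[OF f, of "p n"] _ d[OF g, of "r n"]] f(1) g(1)
    by (simp add: algebra_simps)
  ultimately have "(\<lambda>n. \<integral>t. (f t + g t - poly (p n + r n) t)\<^sup>2 \<partial>\<mu> x) \<longlonglongrightarrow> 0"
    by (intro tendsto_sandwich[of "\<lambda>_. 0" "\<lambda>n. \<integral>t. (f t + g t - poly (p n + r n) t)\<^sup>2 \<partial>\<mu> x" _
      "\<lambda>n. 2 * (\<integral>t. (f t - poly (p n) t)\<^sup>2 \<partial>\<mu> x) + 2 * (\<integral>t. (g t - poly (r n) t)\<^sup>2 \<partial>\<mu> x)"]) auto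
  then have "(\<lambda>n. pcalc (p n + r n) x) \<longlonglongrightarrow> fcalc (\<lambda>t. f t + g t) x"
    using f g by (intro fcalc_lim L2_add) auto
  moreover have "(\<lambda>n. pcalc (p n + r n) x) \<longlonglongrightarrow> fcalc f x + fcalc g x"
    unfolding pcalc_add by (intro tendsto_intros p r)
  ultimately show ?thesis by (rule LIMSEQ_unique)
qed

lemma fcalc_scale_fun:
  assumes f: "f \<in> borel_measurable borel" "x \<in> fdom f"
  shows "x \<in> fdom (\<lambda>t. c * f t)" "fcalc (\<lambda>t. c * f t) x = c *\<^sub>R fcalc f x"
proof -
  show d: "x \<in> fdom (\<lambda>t. c * f t)" using f by (simp add: fdom_def power_mult_distrib)
  obtain p where p: "(\<lambda>n. \<integral>t. (f t - poly (p n) t)\<^sup>2 \<partial>\<mu> x) \<longlonglongrightarrow> 0" "(\<lambda>n. pcalc (p n) x) \<longlonglongrightarrow> fcalc f x"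
    using common_approximation[OF f(1), of "{x}"] f(2) by auto
  have "(\<lambda>n. c\<^sup>2 * (\<integral>t. (f t - poly (p n) t)\<^sup>2 \<partial>\<mu> x)) \<longlonglongrightarrow> c\<^sup>2 * 0"
    by (intro tendsto_intros p)
  also have "(\<lambda>n. c\<^sup>2 * (\<integral>t. (f t - poly (p n) t)\<^sup>2 \<partial>\<mu> x)) = (\<lambda>n. (\<integral>t. (c * f t - poly (smult c (p n)) t)\<^sup>2 \<partial>\<mu> x))"
    by (simp add: integral_mult_right_zero[symmetric] power_mult_distrib[symmetric] right_diff_distrib
       del: integral_mult_right_zero)
  finally have "(\<lambda>n. pcalc (smult c (p n)) x) \<longlonglongrightarrow> fcalc (\<lambda>t. c * f t) x"
    using f by (intro fcalc_lim d) auto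
  moreover have "(\<lambda>n. pcalc (smult c (p n)) x) \<longlonglongrightarrow> c *\<^sub>R fcalc f x"
    unfolding pcalc_smult by (intro tendsto_intros p)
  ultimately show "fcalc (\<lambda>t. c * f t) x = c *\<^sub>R fcalc f x" by (rule LIMSEQ_unique)
qed

lemma fcalc_diff_fun:
  assumes f: "f \<in> borel_measurable borel" "x \<in> fdom f" and g: "g \<in> borel_measurable borel" "x \<in> fdom g"
  shows "x \<in> fdom (\<lambda>t. f t - g t)" "fcalc (\<lambda>t. f t - g t) x = fcalc f x - fcalc g x"
proof -
  have gm: "(\<lambda>t. -1 * g t) \<in> borel_measurable borel" using g by measurable
  note gs = fcalc_scale_fun[OF g, of "-1"]
  show "x \<in> fdom (\<lambda>t. f t - g t)" using L2_add(1)[OF f gm gs(1)] by simp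
  show "fcalc (\<lambda>t. f t - g t) x = fcalc f x - fcalc g x"
    using fcalc_add_fun[OF f gm gs(1)] gs(2) by simp
qed

lemma fcalc_cong_AE:
  assumes f: "f \<in> borel_measurable borel" "x \<in> fdom f" and g: "g \<in> borel_measurable borel"
    and eq: "AE t in \<mu> x. f t = g t"
  shows "x \<in> fdom g" "fcalc f x = fcalc g x"
proof -
  note [measurable] = borel_mu[OF f(1), of x] borel_mu[OF g(1), of x]
  have "integrable (\<mu> x) (\<lambda>t. (f t)\<^sup>2) \<longleftrightarrow> integrable (\<mu> x) (\<lambda>t. (g t)\<^sup>2)"
    using eq by (intro integrable_cong_AE) (auto elim!: eventually_mono)
  then show d: "x \<in> fdom g" using f by (simp add: fdom_def)
  have "(norm (fcalc f x - fcalc g x))\<^sup>2 = (\<integral>t. (f t - g t)\<^sup>2 \<partial>\<mu> x)"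
    using f g d by (simp add: norm_fcalc fcalc_diff_fun flip: fcalc_diff_fun(2))
  also have "\<dots> = (\<integral>t. 0 \<partial>\<mu> x)"
    using eq by (intro integral_cong_AE) (auto elim!: eventually_mono)
  finally show "fcalc f x = fcalc g x" by simp
qed

lemma fcalc_one: "x \<in> fdom (\<lambda>_. 1)" "fcalc (\<lambda>_. 1) x = x"
proof -
  have "poly 1 = (\<lambda>_. 1 :: real)" by auto
  then show "x \<in> fdom (\<lambda>_. 1)" "fcalc (\<lambda>_. 1) x = x"
    using fcalc_poly[where p = 1 and x = x] by simp_all
qed

lemma integrable_prod:
  assumes f: "f \<in> borel_measurable borel" "x \<in> fdom f" and g: "g \<in> borel_measurable borel" "x \<in> fdom g"
  shows "integrable (\<mu> x) (\<lambda>t. f t * g t)"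
proof (rule Bochner_Integration.integrable_bound[where f = "\<lambda>t. (f t)\<^sup>2 + (g t)\<^sup>2"])
  note [measurable] = borel_mu[OF f(1), of x] borel_mu[OF g(1), of x]
  show "integrable (\<mu> x) (\<lambda>t. (f t)\<^sup>2 + (g t)\<^sup>2)" using f g by (simp add: fdom_def)
  show "(\<lambda>t. f t * g t) \<in> borel_measurable (\<mu> x)" by measurable
  have "\<bar>a * b\<bar> \<le> a\<^sup>2 + b\<^sup>2" for a b :: real
  proof -
    have "0 \<le> (\<bar>a\<bar> - \<bar>b\<bar>)\<^sup>2" by simp
    then have "2 * (\<bar>a\<bar> * \<bar>b\<bar>) \<le> a\<^sup>2 + b\<^sup>2" by (simp add: power2_diff)
    then show ?thesis unfolding abs_mult
      by (smt (verit) abs_ge_zero mult_nonneg_nonneg)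
  qed
  then show "AE t in \<mu> x. norm (f t * g t) \<le> norm ((f t)\<^sup>2 + (g t)\<^sup>2)" by simp
qed

lemma inner_fcalc_fcalc:
  assumes f: "f \<in> borel_measurable borel" "x \<in> fdom f" and g: "g \<in> borel_measurable borel" "x \<in> fdom g"
  shows "inner (fcalc f x) (fcalc g x) = (\<integral>t. f t * g t \<partial>\<mu> x)"
proof -
  have i: "integrable (\<mu> x) (\<lambda>t. (f t)\<^sup>2)" "integrable (\<mu> x) (\<lambda>t. (g t)\<^sup>2)"
    using f g by (auto simp: fdom_def)
  have "(norm (fcalc f x + fcalc g x))\<^sup>2 = (\<integral>t. (f t + g t)\<^sup>2 \<partial>\<mu> x)"
    using f g by (simp add: norm_fcalc L2_add flip: fcalc_add_fun)
  also have "\<dots> = (\<integral>t. (f t)\<^sup>2 + (g t)\<^sup>2 + 2 * (f t * g t) \<partial>\<mu> x)"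
    by (simp add: power2_sum mult.assoc)
  also have "\<dots> = (norm (fcalc f x))\<^sup>2 + (norm (fcalc g x))\<^sup>2 + 2 * (\<integral>t. f t * g t \<partial>\<mu> x)"
    using i f g integrable_prod[OF f g] by (simp add: norm_fcalc)
  finally show ?thesis
    by (simp add: power2_norm_eq_inner inner_add inner_commute)
qed

lemma fcalc_sym:
  assumes f: "f \<in> borel_measurable borel" "x \<in> fdom f" "y \<in> fdom f"
  shows "cinner (fcalc f x) y = cinner x (fcalc f y)"
proof -
  obtain p where p: "\<And>z. z \<in> {x, y} \<Longrightarrow> (\<lambda>n. pcalc (p n) z) \<longlonglongrightarrow> fcalc f z"
    by (rule common_approximation[OF f(1), of "{x, y}"]) (use f in auto)
  have "(\<lambda>n. cinner (pcalc (p n) x) y) \<longlonglongrightarrow> cinner (fcalc f x) y"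
    by (intro tendsto_cinner p tendsto_const) auto
  moreover have "(\<lambda>n. cinner x (pcalc (p n) y)) \<longlonglongrightarrow> cinner x (fcalc f y)"
    by (intro tendsto_cinner p tendsto_const) auto
  ultimately show ?thesis unfolding pcalc_sym by (rule LIMSEQ_unique)
qed

lemma cinner_fcalc:
  assumes f: "f \<in> borel_measurable borel" "x \<in> fdom f"
  shows "integrable (\<mu> x) f" "cinner x (fcalc f x) = of_real (\<integral>t. f t \<partial>\<mu> x)"
proof -
  note one = fcalc_one[of x]
  show "integrable (\<mu> x) f" using integrable_prod[OF _ one(1) f] by simp
  have "Re (cinner x (fcalc f x)) = (\<integral>t. f t \<partial>\<mu> x)"
    using inner_fcalc_fcalc[OF _ one(1) f] one(2) by (simp add: Re_cinner)
  moreover have "Im (cinner x (fcalc f x)) = 0"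
    using fcalc_sym[OF f f(2)] cinner_commute[of x "fcalc f x"] by (metis Reals_cnj_iff complex_is_Real_iff)
  ultimately show "cinner x (fcalc f x) = of_real (\<integral>t. f t \<partial>\<mu> x)"
    by (simp add: complex_eq_iff)
qed

lemma fcalc_limit_fun:
  assumes f: "f \<in> borel_measurable borel" "x \<in> fdom f"
    and g: "\<And>n. g n \<in> borel_measurable borel" "\<And>n. x \<in> fdom (g n)"
    and lim: "(\<lambda>n. \<integral>t. (g n t - f t)\<^sup>2 \<partial>\<mu> x) \<longlonglongrightarrow> 0"
  shows "(\<lambda>n. fcalc (g n) x) \<longlonglongrightarrow> fcalc f x"
proof -
  have "(norm (fcalc (g n) x - fcalc f x))\<^sup>2 = (\<integral>t. (g n t - f t)\<^sup>2 \<partial>\<mu> x)" for n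
  proof -
    have "(norm (fcalc (\<lambda>t. g n t - f t) x))\<^sup>2 = (\<integral>t. (g n t - f t)\<^sup>2 \<partial>\<mu> x)"
      using f g by (intro norm_fcalc fcalc_diff_fun(1)) auto
    then show ?thesis using fcalc_diff_fun(2)[OF g(1) g(2) f, of n] by simp
  qed
  then have "(\<lambda>n. sqrt ((norm (fcalc (g n) x - fcalc f x))\<^sup>2)) \<longlonglongrightarrow> sqrt 0"
    using lim by (intro tendsto_real_sqrt) simp
  then show ?thesis
    by (subst LIM_zero_iff[symmetric]) (simp add: tendsto_norm_zero_iff)
qed

lemma pcalc_fcalc:
  assumes g: "g \<in> borel_measurable borel" "x \<in> fdom g"
  shows "x \<in> fdom (\<lambda>t. poly p t * g t)" "pcalc p (fcalc g x) = fcalc (\<lambda>t. poly p t * g t) x"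
proof -
  obtain B where B: "B \<ge> 0" "\<And>t::real. 0 \<le> t \<Longrightarrow> t \<le> 1 \<Longrightarrow> \<bar>poly p t\<bar> \<le> B"
    using poly_bounded_unit_interval[of p] by metis
  note [measurable] = borel_mu[OF g(1), of x] borel_mu[OF borel_measurable_poly, of _ x]
  have ae: "AE t in \<mu> x. 0 \<le> t \<and> t \<le> 1" using mu(1)[of x] by (simp add: unit_measure_def)
  have bd: "AE t in \<mu> x. (poly p t * h t)\<^sup>2 \<le> B\<^sup>2 * (h t)\<^sup>2" for h
    using ae
  proof (rule eventually_mono)
    fix t :: real assume "0 \<le> t \<and> t \<le> 1"
    then have "\<bar>poly p t\<bar>\<^sup>2 \<le> B\<^sup>2" using B by (intro power_mono) auto
    then show "(poly p t * h t)\<^sup>2 \<le> B\<^sup>2 * (h t)\<^sup>2" by (simp add: power_mult_distrib mult_right_mono)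
  qed
  have int: "integrable (\<mu> x) (\<lambda>t. (poly p t * h t)\<^sup>2)"
    if [measurable]: "h \<in> borel_measurable (\<mu> x)" and "integrable (\<mu> x) (\<lambda>t. (h t)\<^sup>2)" for h
    by (rule Bochner_Integration.integrable_bound[where f = "\<lambda>t. B\<^sup>2 * (h t)\<^sup>2"])
       (use that bd[of h] in auto)
  have gi: "integrable (\<mu> x) (\<lambda>t. (g t)\<^sup>2)" using g by (simp add: fdom_def)
  show d: "x \<in> fdom (\<lambda>t. poly p t * g t)" unfolding fdom_def using gi by (simp add: int)
  obtain r where r: "(\<lambda>n. \<integral>t. (g t - poly (r n) t)\<^sup>2 \<partial>\<mu> x) \<longlonglongrightarrow> 0" "(\<lambda>n. pcalc (r n) x) \<longlonglongrightarrow> fcalc g x"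
    using common_approximation[OF g(1), of "{x}"] g(2) by auto
  have "(\<lambda>n. B\<^sup>2 * (\<integral>t. (g t - poly (r n) t)\<^sup>2 \<partial>\<mu> x)) \<longlonglongrightarrow> B\<^sup>2 * 0"
    by (intro tendsto_intros r)
  moreover have "(\<integral>t. (poly p t * g t - poly (p * r n) t)\<^sup>2 \<partial>\<mu> x) \<le> B\<^sup>2 * (\<integral>t. (g t - poly (r n) t)\<^sup>2 \<partial>\<mu> x)" for n
  proof -
    note i = unit_measure_integrable_diff_poly[OF mu(1) g(1) gi, of "r n"]
    have "(\<integral>t. (poly p t * g t - poly (p * r n) t)\<^sup>2 \<partial>\<mu> x) = (\<integral>t. (poly p t * (g t - poly (r n) t))\<^sup>2 \<partial>\<mu> x)"
      by (simp add: right_diff_distrib)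
    also have "\<dots> \<le> (\<integral>t. B\<^sup>2 * (g t - poly (r n) t)\<^sup>2 \<partial>\<mu> x)"
      using i bd by (intro integral_mono_AE int) auto
    finally show ?thesis by simp
  qed
  ultimately have "(\<lambda>n. \<integral>t. (poly p t * g t - poly (p * r n) t)\<^sup>2 \<partial>\<mu> x) \<longlonglongrightarrow> 0"
    by (intro tendsto_sandwich[of "\<lambda>_. 0" "\<lambda>n. \<integral>t. (poly p t * g t - poly (p * r n) t)\<^sup>2 \<partial>\<mu> x" _
       "\<lambda>n. B\<^sup>2 * (\<integral>t. (g t - poly (r n) t)\<^sup>2 \<partial>\<mu> x)"]) auto
  then have "(\<lambda>n. pcalc (p * r n) x) \<longlonglongrightarrow> fcalc (\<lambda>t. poly p t * g t) x"
    using g by (intro fcalc_lim d) auto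
  moreover have "(\<lambda>n. pcalc (p * r n) x) \<longlonglongrightarrow> pcalc p (fcalc g x)"
    unfolding pcalc_mult by (intro bounded_linear.tendsto[OF pcalc_bounded_linear] r)
  ultimately show "pcalc p (fcalc g x) = fcalc (\<lambda>t. poly p t * g t) x" by (rule LIMSEQ_unique[symmetric])
qed

text \<open>Both measures have the moments \<open>\<integral> t\<^sup>k g(t)\<^sup>2 d\<mu>\<^sub>x\<close>. This is what makes the calculus
  multiplicative, unbounded functions included.\<close>
lemma mu_fcalc:
  assumes g: "g \<in> borel_measurable borel" "x \<in> fdom g"
  shows "\<mu> (fcalc g x) = density (\<mu> x) (\<lambda>t. ennreal ((g t)\<^sup>2))"
proof (rule unit_measure_eqI[OF mu(1)])
  note [measurable] = borel_mu[OF g(1), of x] borel_mu[OF borel_measurable_poly, of _ x]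
  have gi: "integrable (\<mu> x) (\<lambda>t. (g t)\<^sup>2)" using g by (simp add: fdom_def)
  have gm: "(\<lambda>t. ennreal ((g t)\<^sup>2)) \<in> borel_measurable (\<mu> x)" by measurable
  have "AE t in \<mu> x. 0 \<le> t \<and> t \<le> 1" using mu(1)[of x] by (simp add: unit_measure_def)
  then have "AE t in density (\<mu> x) (\<lambda>t. ennreal ((g t)\<^sup>2)). 0 \<le> t \<and> t \<le> 1"
    unfolding AE_density[OF gm] by (rule eventually_mono) simp
  moreover have "emeasure (density (\<mu> x) (\<lambda>t. ennreal ((g t)\<^sup>2))) UNIV \<noteq> \<infinity>"
    using gi by (simp add: emeasure_density nn_integral_eq_integral sets_mu)
  ultimately show "unit_measure (density (\<mu> x) (\<lambda>t. ennreal ((g t)\<^sup>2)))"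
    unfolding unit_measure_def by (auto intro!: finite_measureI simp: sets_mu space_mu)
  fix p
  have "integral\<^sup>L (\<mu> (fcalc g x)) (poly p) = inner (fcalc g x) (fcalc (\<lambda>t. poly p t * g t) x)"
    using g by (simp add: mu pcalc_fcalc)
  also have "\<dots> = (\<integral>t. g t * (poly p t * g t) \<partial>\<mu> x)"
    using g by (intro inner_fcalc_fcalc pcalc_fcalc) auto
  also have "\<dots> = integral\<^sup>L (density (\<mu> x) (\<lambda>t. ennreal ((g t)\<^sup>2))) (poly p)"
    by (subst integral_density) (auto simp: power2_eq_square ac_simps)
  finally show "integral\<^sup>L (\<mu> (fcalc g x)) (poly p) = integral\<^sup>L (density (\<mu> x) (\<lambda>t. ennreal ((g t)\<^sup>2))) (poly p)" .
qed

text \<open>Multiplicativity with exact domains: by \<open>mu_fcalc\<close>, \<open>p\<^sub>n \<rightarrow> f\<close> in the measure of \<open>g(C) x\<close> means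
  \<open>p\<^sub>n g \<rightarrow> f g\<close> in the measure of \<open>x\<close>.\<close>
lemma fcalc_fcalc:
  assumes f: "f \<in> borel_measurable borel" and g: "g \<in> borel_measurable borel" "x \<in> fdom g"
  shows "fcalc g x \<in> fdom f \<longleftrightarrow> x \<in> fdom (\<lambda>t. f t * g t)"
    and "x \<in> fdom (\<lambda>t. f t * g t) \<Longrightarrow> fcalc f (fcalc g x) = fcalc (\<lambda>t. f t * g t) x"
proof -
  note [measurable] = borel_mu[OF g(1), of x] borel_mu[OF f(1), of x] borel_mu[OF borel_measurable_poly, of _ x]
  show iff: "fcalc g x \<in> fdom f \<longleftrightarrow> x \<in> fdom (\<lambda>t. f t * g t)"
    unfolding fdom_def using g by (simp add: mu_fcalc integrable_density power_mult_distrib mult.commute)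
  assume d: "x \<in> fdom (\<lambda>t. f t * g t)"
  obtain p where p: "(\<lambda>n. \<integral>t. (f t - poly (p n) t)\<^sup>2 \<partial>\<mu> (fcalc g x)) \<longlonglongrightarrow> 0" "(\<lambda>n. pcalc (p n) (fcalc g x)) \<longlonglongrightarrow> fcalc f (fcalc g x)"
    using common_approximation[OF f(1), of "{fcalc g x}"] d iff by auto
  have "(\<lambda>n. fcalc (\<lambda>t. poly (p n) t * g t) x) \<longlonglongrightarrow> fcalc (\<lambda>t. f t * g t) x"
  proof (rule fcalc_limit_fun)
    have "(\<integral>t. (f t - poly (p n) t)\<^sup>2 \<partial>\<mu> (fcalc g x)) = (\<integral>t. (poly (p n) t * g t - f t * g t)\<^sup>2 \<partial>\<mu> x)" for n
      unfolding mu_fcalc[OF g]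
      by (subst integral_density) (auto simp: power2_eq_square algebra_simps)
    then show "(\<lambda>n. \<integral>t. (poly (p n) t * g t - f t * g t)\<^sup>2 \<partial>\<mu> x) \<longlonglongrightarrow> 0" using p(1) by simp
  qed (use f g d pcalc_fcalc in auto)
  then show "fcalc f (fcalc g x) = fcalc (\<lambda>t. f t * g t) x"
    using p(2) g by (simp add: pcalc_fcalc LIMSEQ_unique)
qed

end

section \<open>Intertwining operators and linearity of the calculus\<close>

text \<open>A bound on polynomials passes to bounded functions by density, and from the truncations of \<open>f\<close> to
  \<open>f\<close> by monotone convergence. It transports square-integrability from the measures of some vectors
  to the measure of another.\<close>
lemma L2_dominated:
  fixes f :: "real \<Rightarrow> real" and K :: real
  assumes M: "unit_measure M" and N1: "unit_measure N1" and N2: "unit_measure N2"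
    and le: "\<And>p. (\<integral>t. (poly p t)\<^sup>2 \<partial>M) \<le> K * ((\<integral>t. (poly p t)\<^sup>2 \<partial>N1) + (\<integral>t. (poly p t)\<^sup>2 \<partial>N2))"
    and K: "K \<ge> 0" and f: "f \<in> borel_measurable borel"
    and int: "integrable N1 (\<lambda>t. (f t)\<^sup>2)" "integrable N2 (\<lambda>t. (f t)\<^sup>2)"
  shows "integrable M (\<lambda>t. (f t)\<^sup>2)"
proof -
  define c where "c = K * ((\<integral>t. (f t)\<^sup>2 \<partial>N1) + (\<integral>t. (f t)\<^sup>2 \<partial>N2))"
  \<comment> \<open>Truncations of \<open>f\<close>.\<close>
  define g where "g k t = max (- real k) (min (real k) (f t))" for k t
  have g [measurable]: "g k \<in> borel_measurable borel" for k
    unfolding g_def using f by measurable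
  have gk: "(g k t)\<^sup>2 \<le> (real k)\<^sup>2" for k t
    using abs_le_square_iff[of "g k t" "real k"] by (auto simp: g_def)
  have gf: "(g k t)\<^sup>2 \<le> (f t)\<^sup>2" for k t
    using abs_le_square_iff[of "g k t" "f t"] by (auto simp: g_def)
  have gmono: "(g k t)\<^sup>2 \<le> (g l t)\<^sup>2" if "k \<le> l" for k l t
    using abs_le_square_iff[of "g k t" "g l t"] that by (auto simp: g_def)
  have gint: "integrable N (\<lambda>t. (g k t)\<^sup>2)" if N: "unit_measure N" for N k
  proof -
    interpret finite_measure N using N by (simp add: unit_measure_def)
    show ?thesis
      using gk unit_measure_borel[OF N g[of k]] by (intro integrable_const_bound[of _ "(real k)\<^sup>2"]) auto
  qed
  have bound: "(\<integral>t. (g k t)\<^sup>2 \<partial>M) \<le> c" for k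
  proof -
    define N where "N i = (if i = (0::nat) then M else if i = 1 then N1 else N2)" for i
    interpret unit_measure_family "{0, 1, 2}" N
      by unfold_locales (use M N1 N2 in \<open>auto simp: N_def\<close>)
    obtain p where p: "\<forall>i\<in>{0,1,2}. (\<lambda>n. \<integral>t. (g k t - poly (p n) t)\<^sup>2 \<partial>N i) \<longlonglongrightarrow> 0"
      using poly_dense[OF g[of k]] gint M N1 N2 by (auto simp: N_def)
    have lim: "(\<lambda>n. \<integral>t. (poly (p n) t)\<^sup>2 \<partial>N i) \<longlonglongrightarrow> (\<integral>t. (g k t)\<^sup>2 \<partial>N i)" if "i \<in> {0, 1, 2}" for i
      using p that unit[OF that] by (intro norm_limit[OF _ g gint]) auto
    have "(\<integral>t. (g k t)\<^sup>2 \<partial>N 0) \<le> K * ((\<integral>t. (g k t)\<^sup>2 \<partial>N 1) + (\<integral>t. (g k t)\<^sup>2 \<partial>N 2))"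
      by (rule LIMSEQ_le[OF lim tendsto_mult[OF tendsto_const tendsto_add[OF lim lim]]])
         (use le in \<open>auto simp: N_def\<close>)
    also have "\<dots> \<le> c"
      unfolding c_def N_def using gint[OF N1] gint[OF N2] int gf K
      by (auto intro!: mult_left_mono add_mono integral_mono)
    finally show ?thesis by (simp add: N_def)
  qed
  have "(\<lambda>k. \<integral>\<^sup>+t. ennreal ((g k t)\<^sup>2) \<partial>M) \<longlonglongrightarrow> (\<integral>\<^sup>+t. ennreal ((f t)\<^sup>2) \<partial>M)"
  proof (rule nn_integral_LIMSEQ)
    show "incseq (\<lambda>k t. ennreal ((g k t)\<^sup>2))"
      by (auto simp: incseq_def le_fun_def intro!: ennreal_leI gmono)
    show "(\<lambda>k. ennreal ((g k t)\<^sup>2)) \<longlonglongrightarrow> ennreal ((f t)\<^sup>2)" for t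
    proof (rule tendsto_eventually)
      obtain k0 where "\<bar>f t\<bar> \<le> real k0" using real_arch_simple by blast
      then have "g k t = f t" if "k \<ge> k0" for k using that by (auto simp: g_def)
      then show "\<forall>\<^sub>F k in sequentially. ennreal ((g k t)\<^sup>2) = ennreal ((f t)\<^sup>2)"
        by (auto intro!: eventually_sequentiallyI[of k0])
    qed
    show "(\<lambda>t. ennreal ((g k t)\<^sup>2)) \<in> borel_measurable M" for k
      using unit_measure_borel[OF M g[of k]] by measurable
  qed
  then have "(\<integral>\<^sup>+t. ennreal ((f t)\<^sup>2) \<partial>M) \<le> ennreal c"
    using bound gint[OF M] by (intro LIMSEQ_le_const2) (auto simp: nn_integral_eq_integral intro!: ennreal_leI)
  then show ?thesis
    using unit_measure_borel[OF M f]
    by (intro integrableI_nonneg) (auto intro: le_less_trans)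
qed

text \<open>Functions of an operator inherit commutation and intertwining relations by one principle: a bounded \<open>S\<close> with
  \<open>S C = C' S\<close> satisfies \<open>S f(C) \<subseteq> f(C') S\<close>.\<close>
locale intertwining =
  A: positive_contraction C + B: positive_contraction C'
  for C :: "'a::complex_hilbert \<Rightarrow> 'a" and C' :: "'b::complex_hilbert \<Rightarrow> 'b" +
  fixes S :: "'a \<Rightarrow> 'b"
  assumes S_bounded_linear: "bounded_linear S"
    and S_intertwines: "S (C x) = C' (S x)"
begin

lemma S_pcalc: "S (A.pcalc p x) = B.pcalc p (S x)"
proof (induction p)
  case 0
  show ?case using S_bounded_linear by (simp add: bounded_linear.linear linear_0)
next
  case (pCons a p)
  show ?case
    using S_bounded_linear pCons
    by (simp add: A.pcalc_pCons B.pcalc_pCons bounded_linear.linear linear_add linear_scale S_intertwines)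
qed

lemma S_fdom:
  assumes f: "f \<in> borel_measurable borel" "x \<in> A.fdom f"
  shows "S x \<in> B.fdom f"
proof -
  obtain K where K: "K \<ge> 0" "\<And>x. norm (S x) \<le> norm x * K"
    using bounded_linear.nonneg_bounded[OF S_bounded_linear] by blast
  have le: "(\<integral>t. (poly p t)\<^sup>2 \<partial>B.\<mu> (S x)) \<le> K\<^sup>2 * ((\<integral>t. (poly p t)\<^sup>2 \<partial>A.\<mu> x) + (\<integral>t. (poly p t)\<^sup>2 \<partial>A.\<mu> x))" for p
  proof -
    have "norm (S (A.pcalc p x)) \<le> norm (A.pcalc p x) * K" by (rule K)
    then have "(norm (S (A.pcalc p x)))\<^sup>2 \<le> K\<^sup>2 * (norm (A.pcalc p x))\<^sup>2"
      unfolding power_mult_distrib[symmetric] by (intro power_mono) (simp_all add: mult.commute)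
    also have "\<dots> \<le> K\<^sup>2 * ((norm (A.pcalc p x))\<^sup>2 + (norm (A.pcalc p x))\<^sup>2)"
      by (intro mult_left_mono) auto
    finally show ?thesis by (simp add: A.mu_square B.mu_square S_pcalc)
  qed
  then show ?thesis
    using L2_dominated[OF B.mu(1) A.mu(1) A.mu(1) le _ f(1)] f(2)
    by (simp add: A.fdom_def B.fdom_def)
qed

lemma S_fcalc:
  assumes f: "f \<in> borel_measurable borel" "x \<in> A.fdom f"
  shows "S (A.fcalc f x) = B.fcalc f (S x)"
proof -
  define N where "N b = (if b then A.\<mu> x else B.\<mu> (S x))" for b
  interpret unit_measure_family UNIV N
    by unfold_locales (auto simp: N_def A.mu B.mu)
  have "\<exists>p. \<forall>b\<in>UNIV. (\<lambda>n. \<integral>t. (f t - poly (p n) t)\<^sup>2 \<partial>N b) \<longlonglongrightarrow> 0"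
    by (rule poly_dense[OF f(1)]) (use f S_fdom[OF f] in \<open>auto simp: N_def A.fdom_def B.fdom_def\<close>)
  then obtain p where p: "\<And>b. (\<lambda>n. \<integral>t. (f t - poly (p n) t)\<^sup>2 \<partial>N b) \<longlonglongrightarrow> 0" by blast
  have "(\<lambda>n. S (A.pcalc (p n) x)) \<longlonglongrightarrow> S (A.fcalc f x)"
    using p[of True] by (intro bounded_linear.tendsto[OF S_bounded_linear] A.fcalc_lim f) (simp add: N_def)
  moreover have "(\<lambda>n. S (A.pcalc (p n) x)) \<longlonglongrightarrow> B.fcalc f (S x)"
    unfolding S_pcalc using p[of False] by (intro B.fcalc_lim S_fdom f) (simp add: N_def)
  ultimately show ?thesis by (rule LIMSEQ_unique)
qed

end

definition op_val :: "'a oper \<Rightarrow> 'a \<Rightarrow> 'a" where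
  "op_val T x = (THE y. (x, y) \<in> T)"

lemma linear_op_single: "linear_op T \<Longrightarrow> (x, y) \<in> T \<Longrightarrow> (x, z) \<in> T \<Longrightarrow> y = z"
  unfolding linear_op_def by (metis single_valuedD)

lemma linear_op_add: "linear_op T \<Longrightarrow> (x, y) \<in> T \<Longrightarrow> (u, v) \<in> T \<Longrightarrow> (x + u, y + v) \<in> T"
  unfolding linear_op_def by blast

lemma linear_op_scale: "linear_op T \<Longrightarrow> (x, y) \<in> T \<Longrightarrow> (scaleC c x, scaleC c y) \<in> T"
  unfolding linear_op_def by blast

lemma linear_op_zero: "linear_op T \<Longrightarrow> (0, 0) \<in> T"
  unfolding linear_op_def by blast

lemma linear_op_diff: "linear_op T \<Longrightarrow> (x, y) \<in> T \<Longrightarrow> (u, v) \<in> T \<Longrightarrow> (x - u, y - v) \<in> T"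
  using linear_op_add[OF _ _ linear_op_scale[of T u v "-1"], of x y] scaleC_of_real[of "-1" u] scaleC_of_real[of "-1" v]
  by simp

lemma op_val_eq: "linear_op T \<Longrightarrow> (x, y) \<in> T \<Longrightarrow> op_val T x = y"
  unfolding op_val_def by (rule the_equality) (auto intro: linear_op_single)

lemma op_val_mem: "linear_op T \<Longrightarrow> x \<in> Domain T \<Longrightarrow> (x, op_val T x) \<in> T"
  by (auto simp: op_val_eq)

lemma csubspace_Domain: "linear_op T \<Longrightarrow> csubspace (Domain T)"
  unfolding csubspace_def
  by (auto intro: linear_op_zero linear_op_add linear_op_scale)

lemma op_val_add: "linear_op T \<Longrightarrow> x \<in> Domain T \<Longrightarrow> y \<in> Domain T \<Longrightarrow> op_val T (x + y) = op_val T x + op_val T y"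
  by (intro op_val_eq linear_op_add op_val_mem)

lemma op_val_scaleC: "linear_op T \<Longrightarrow> x \<in> Domain T \<Longrightarrow> op_val T (scaleC c x) = scaleC c (op_val T x)"
  by (intro op_val_eq linear_op_scale op_val_mem)

context positive_contraction
begin

lemma fdom_add:
  assumes f: "f \<in> borel_measurable borel" "x \<in> fdom f" "y \<in> fdom f"
  shows "x + y \<in> fdom f"
proof -
  have "(\<integral>t. (poly p t)\<^sup>2 \<partial>\<mu> (x + y)) \<le> 2 * ((\<integral>t. (poly p t)\<^sup>2 \<partial>\<mu> x) + (\<integral>t. (poly p t)\<^sup>2 \<partial>\<mu> y))" for p
  proof -
    have "0 \<le> (norm (pcalc p x - pcalc p y))\<^sup>2" by simp
    then have "(norm (pcalc p x + pcalc p y))\<^sup>2 \<le> 2 * (norm (pcalc p x))\<^sup>2 + 2 * (norm (pcalc p y))\<^sup>2"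
      unfolding power2_norm_eq_inner by (simp add: inner_diff inner_add inner_commute)
    then show ?thesis by (simp add: mu_square pcalc_add_right)
  qed
  from L2_dominated[OF mu(1) mu(1) mu(1) this _ f(1)] f show ?thesis by (simp add: fdom_def)
qed

lemma fcalc_add:
  assumes f: "f \<in> borel_measurable borel" "x \<in> fdom f" "y \<in> fdom f"
  shows "fcalc f (x + y) = fcalc f x + fcalc f y"
proof -
  obtain p where p: "\<And>z. z \<in> {x, y, x + y} \<Longrightarrow> (\<lambda>n. pcalc (p n) z) \<longlonglongrightarrow> fcalc f z"
    by (rule common_approximation[OF f(1), of "{x, y, x + y}"]) (use f fdom_add[OF f] in auto)
  have "(\<lambda>n. pcalc (p n) (x + y)) \<longlonglongrightarrow> fcalc f (x + y)" by (rule p) simp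
  moreover have "(\<lambda>n. pcalc (p n) (x + y)) \<longlonglongrightarrow> fcalc f x + fcalc f y"
    unfolding pcalc_add_right by (intro tendsto_add p) auto
  ultimately show ?thesis by (rule LIMSEQ_unique)
qed

lemma fcalc_scaleC:
  assumes f: "f \<in> borel_measurable borel" "x \<in> fdom f"
  shows "scaleC c x \<in> fdom f" "fcalc f (scaleC c x) = scaleC c (fcalc f x)"
proof -
  interpret intertwining C C "scaleC c"
    by (intro intertwining.intro intertwining_axioms.intro positive_contraction_axioms
        bounded_linear_scaleC C_scaleC[symmetric])
  show "scaleC c x \<in> fdom f" "fcalc f (scaleC c x) = scaleC c (fcalc f x)"
    using S_fdom[OF f] S_fcalc[OF f] by auto
qed

lemma fcalc_zero_fun [simp]: "fcalc (\<lambda>_. 0) x = 0"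
proof -
  have "poly 0 = (\<lambda>_. 0 :: real)" by auto
  then show ?thesis using fcalc_poly(2)[where p = 0 and x = x] by simp
qed

lemma zero_fdom: "f \<in> borel_measurable borel \<Longrightarrow> 0 \<in> fdom f"
  "f \<in> borel_measurable borel \<Longrightarrow> fcalc f 0 = 0"
proof -
  assume f: "f \<in> borel_measurable borel"
  have d: "0 \<in> fdom (\<lambda>_. 0 :: real)" by (simp add: fdom_def)
  have "fcalc (\<lambda>_. 0) 0 \<in> fdom f \<longleftrightarrow> 0 \<in> fdom (\<lambda>t. f t * 0)" by (rule fcalc_fcalc(1)[OF f _ d]) simp
  then show z: "0 \<in> fdom f" using d by simp
  show "fcalc f 0 = 0" using fcalc_scaleC(2)[OF f z, of 0] by simp
qed

text \<open>The operator \<open>f(C)\<close> with its natural domain.\<close>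
definition fgraph :: "(real \<Rightarrow> real) \<Rightarrow> 'a oper" where
  "fgraph f = {(x, fcalc f x) | x. x \<in> fdom f}"

lemma linear_op_fgraph:
  assumes f: "f \<in> borel_measurable borel"
  shows "linear_op (fgraph f)"
  unfolding linear_op_def single_valued_def fgraph_def
  by (auto simp: zero_fdom[OF f] fdom_add[OF f] fcalc_add[OF f] fcalc_scaleC[OF f])

lemma Domain_fgraph: "Domain (fgraph f) = fdom f"
  by (auto simp: fgraph_def)

lemma fcalc_cutoff_limit:
  assumes A: "\<And>n. A n \<in> sets (borel :: real measure)" "A0 \<in> sets borel"
    and lim: "\<And>t. (\<lambda>n. indicator (A n) t :: real) \<longlonglongrightarrow> indicator A0 t"
  shows "(\<lambda>n. fcalc (indicator (A n)) x) \<longlonglongrightarrow> fcalc (indicator A0) x"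
proof (rule fcalc_limit_fun)
  show d: "x \<in> fdom (indicator (A n))" "x \<in> fdom (indicator A0)" for n
    using A by (auto intro!: fdom_bounded[where B = 1] simp: indicator_def)
  interpret finite_measure "\<mu> x" by (rule finite_mu)
  note [measurable] = borel_mu[OF borel_measurable_indicator[OF A(1)], where x = x] borel_mu[OF borel_measurable_indicator[OF A(2)], where x = x]
  have "(\<lambda>n. \<integral>t. (indicator (A n) t - indicator A0 t :: real)\<^sup>2 \<partial>\<mu> x) \<longlonglongrightarrow> (\<integral>t. 0 \<partial>\<mu> x)"
  proof (rule integral_dominated_convergence[where w = "\<lambda>_. 1"])
    show "AE t in \<mu> x. (\<lambda>n. (indicator (A n) t - indicator A0 t :: real)\<^sup>2) \<longlonglongrightarrow> 0"
    proof (rule AE_I2)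
      fix t
      have "(\<lambda>n. (indicator (A n) t - indicator A0 t :: real)\<^sup>2) \<longlonglongrightarrow> (indicator A0 t - indicator A0 t)\<^sup>2"
        by (intro tendsto_intros lim)
      then show "(\<lambda>n. (indicator (A n) t - indicator A0 t :: real)\<^sup>2) \<longlonglongrightarrow> 0" by simp
    qed
    show "AE t in \<mu> x. norm ((indicator (A n) t - indicator A0 t :: real)\<^sup>2) \<le> 1" for n
      by (rule AE_I2) (auto simp: indicator_def)
  qed auto
  then show "(\<lambda>n. \<integral>t. (indicator (A n) t - indicator A0 t :: real)\<^sup>2 \<partial>\<mu> x) \<longlonglongrightarrow> 0" by simp
qed (use A in auto)

lemma fdom_dense:
  assumes f [measurable]: "f \<in> borel_measurable borel"
  shows "closure (fdom f) = UNIV"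
proof -
  have "x \<in> closure (fdom f)" for x
  proof -
    define A where "A n = {t. \<bar>f t\<bar> \<le> real n}" for n
    have A [measurable]: "A n \<in> sets borel" for n unfolding A_def by measurable
    have "fcalc (indicator (A n)) x \<in> fdom f" for n
    proof (subst fcalc_fcalc(1)[OF f])
      show "x \<in> fdom (indicator (A n))"
        by (auto intro!: fdom_bounded[where B = 1] simp: indicator_def)
      show "x \<in> fdom (\<lambda>t. f t * indicator (A n) t)"
        by (auto intro!: fdom_bounded[where B = "real n"] simp: indicator_def A_def)
    qed auto
    moreover have "(\<lambda>n. fcalc (indicator (A n)) x) \<longlonglongrightarrow> fcalc (indicator UNIV) x"
    proof (rule fcalc_cutoff_limit)
      fix t
      obtain k0 where "\<bar>f t\<bar> \<le> real k0" using real_arch_simple by blast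
      then have "t \<in> A k" if "k \<ge> k0" for k using that by (auto simp: A_def)
      then show "(\<lambda>n. indicator (A n) t :: real) \<longlonglongrightarrow> indicator UNIV t"
        by (auto intro!: tendsto_eventually eventually_sequentiallyI[of k0])
    qed auto
    moreover have "fcalc (indicator UNIV) x = x"
      using fcalc_one(2)[of x] by (simp add: indicator_def[abs_def])
    ultimately show ?thesis
      unfolding closure_sequential by (intro exI[of _ "\<lambda>n. fcalc (indicator (A n)) x"]) simp
  qed
  then show ?thesis by blast
qed

end

section \<open>Positive selfadjoint operators as functions of their resolvents\<close>

text \<open>A symmetric positive operator is selfadjoint if and only if \<open>1 + T\<close> is onto. Surjectivity is the form
  in which selfadjointness is verified and used here.\<close>
locale positive_selfadjoint =
  fixes T :: "'a::complex_hilbert oper"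
  assumes linear: "linear_op T"
    and symmetric: "(x, y) \<in> T \<Longrightarrow> (u, v) \<in> T \<Longrightarrow> cinner x v = cinner y u"
    and positive: "(x, y) \<in> T \<Longrightarrow> 0 \<le> inner x y"
    and onto: "\<exists>x. (x, z - x) \<in> T"

text \<open>Positivity of \<open>T\<close> makes \<open>1 + T\<close> injective.\<close>
lemma positive_injective:
  assumes T: "linear_op T" and pos: "\<And>x y. (x, y) \<in> T \<Longrightarrow> 0 \<le> inner x y"
    and xy: "(x, y) \<in> T" "(u, v) \<in> T" "x + y = u + v"
  shows "x = u"
proof -
  have "(x - u, y - v) \<in> T" by (rule linear_op_diff[OF T xy(1,2)])
  moreover have "y - v = - (x - u)" using xy(3) by (simp add: algebra_simps)
  ultimately have "0 \<le> inner (x - u) (- (x - u))" using pos by metis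
  then have "inner (x - u) (x - u) \<le> 0" by (simp del: minus_diff_eq)
  then have "inner (x - u) (x - u) = 0" by (intro antisym) auto
  then show ?thesis by simp
qed

text \<open>The inverse of \<open>t \<mapsto> (1 + t)\<^sup>-\<^sup>1\<close> on \<open>(0, 1]\<close>, where the spectral measures of the resolvent
  are concentrated; truncation at 0 makes the function nonnegative on the whole line.\<close>
definition unresolvent :: "real \<Rightarrow> real" where "unresolvent s = max 0 (1 / s - 1)"

lemma unresolvent_nonneg: "0 \<le> unresolvent s" by (simp add: unresolvent_def)

lemma unresolvent_measurable [measurable]: "unresolvent \<in> borel_measurable borel"
  unfolding unresolvent_def by measurable

context positive_selfadjoint
begin

text \<open>The operator \<open>(1 + T)\<^sup>-\<^sup>1\<close>.\<close>
definition resolvent :: "'a \<Rightarrow> 'a" where "resolvent z = (SOME x. (x, z - x) \<in> T)"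

lemma resolvent_mem: "(resolvent z, z - resolvent z) \<in> T"
  unfolding resolvent_def using onto by (rule someI_ex)

lemma resolvent_eq: "(x, y) \<in> T \<Longrightarrow> resolvent (x + y) = x"
  by (rule positive_injective[OF linear positive resolvent_mem]) auto

lemma resolvent_eq': "(x, z - x) \<in> T \<Longrightarrow> resolvent z = x"
  using resolvent_eq[of x "z - x"] by simp

sublocale positive_contraction resolvent
proof
  fix x y :: 'a and c
  have "(resolvent x + resolvent y, (x - resolvent x) + (y - resolvent y)) \<in> T"
    by (intro linear_op_add linear resolvent_mem)
  then show "resolvent (x + y) = resolvent x + resolvent y" by (intro resolvent_eq') (simp add: algebra_simps)
  have "(scaleC c (resolvent x), scaleC c (x - resolvent x)) \<in> T"
    by (intro linear_op_scale linear resolvent_mem)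
  then show "resolvent (scaleC c x) = scaleC c (resolvent x)" by (intro resolvent_eq') (simp add: scaleC_diff_right)
  show "cinner (resolvent x) y = cinner x (resolvent y)"
    using symmetric[OF resolvent_mem[of x] resolvent_mem[of y]] by (simp add: cinner_diff_left cinner_diff_right)
  have "inner x (resolvent x) = (norm (resolvent x))\<^sup>2 + inner (resolvent x) (x - resolvent x)"
    by (simp add: inner_diff power2_norm_eq_inner inner_commute)
  then have ge: "(norm (resolvent x))\<^sup>2 \<le> inner x (resolvent x)" using positive[OF resolvent_mem[of x]] by simp
  then show "0 \<le> inner x (resolvent x)" by (rule order_trans[rotated]) simp
  have "norm (resolvent x) * norm (resolvent x) \<le> norm x * norm (resolvent x)"
    using ge norm_cauchy_schwarz[of x "resolvent x"] by (simp add: power2_eq_square)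
  then show "norm (resolvent x) \<le> norm x"
    by (cases "resolvent x = 0") auto
qed

lemma resolvent_zero_iff: "resolvent z = 0 \<Longrightarrow> z = 0"
  using resolvent_mem[of z] linear_op_single[OF linear linear_op_zero[OF linear], of z] by simp

text \<open>The resolvent is injective and annihilates \<open>1\<^bsub>{0}\<^esub>(C) x\<close>, so the point 0 carries no mass.\<close>
lemma AE_positive: "AE t in \<mu> x. 0 < t \<and> t \<le> 1"
proof -
  define z where "z = fcalc (indicator {0}) x"
  have d: "x \<in> fdom (indicator {0})" by (auto intro!: fdom_bounded[where B = 1] simp: indicator_def)
  have "resolvent z = pcalc [:0, 1:] z" by (simp add: pcalc_X)
  also have "\<dots> = fcalc (\<lambda>t. poly [:0, 1:] t * indicator {0} t) x"
    unfolding z_def using d by (intro pcalc_fcalc) auto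
  also have "(\<lambda>t. poly [:0, 1:] t * indicator {0} t) = (\<lambda>_. 0 :: real)" by (auto simp: indicator_def)
  finally have "resolvent z = 0" by simp
  then have "z = 0" by (rule resolvent_zero_iff)
  then have "(\<integral>t. (indicator {0} t :: real)\<^sup>2 \<partial>\<mu> x) = 0"
    using norm_fcalc[OF _ d] by (simp add: z_def)
  then have "AE t in \<mu> x. (indicator {0} t :: real)\<^sup>2 = 0"
    using d by (subst (asm) integral_nonneg_eq_0_iff_AE) (auto simp: fdom_def)
  moreover have "AE t in \<mu> x. 0 \<le> t \<and> t \<le> 1" using mu(1)[of x] by (simp add: unit_measure_def)
  ultimately show ?thesis
    by eventually_elim (auto simp: indicator_def split: if_splits)
qed

text \<open>With \<open>h\<close> for the function \<open>unresolvent\<close>: if \<open>w = x + T x\<close>, then \<open>x = C w\<close> and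
  \<open>h(C) C w = (1 - C) w = T x\<close>; conversely \<open>C (1 + h(C)) x = x\<close> for every \<open>x\<close> in the domain of \<open>h(C)\<close>.\<close>
lemma T_eq_fgraph: "T = fgraph unresolvent"
proof (intro set_eqI iffI)
  fix z assume "z \<in> T"
  then obtain x y where z: "z = (x, y)" and xy: "(x, y) \<in> T" by (cases z) auto
  define w where "w = x + y"
  have Xd: "w \<in> fdom (poly [:0, 1:])" by (rule fcalc_poly)
  have x: "x = fcalc (poly [:0, 1:]) w" using resolvent_eq[OF xy] by (simp add: fcalc_poly pcalc_X w_def)
  have ae: "AE t in \<mu> w. poly [:1, -1:] t = unresolvent t * poly [:0, 1:] t"
    using AE_positive[of w]
  proof eventually_elim
    case (elim t)
    then have "1 / t \<ge> 1" by simp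
    then have "unresolvent t * t = 1 - t" using elim by (simp add: unresolvent_def algebra_simps)
    then show ?case by simp
  qed
  have m: "(\<lambda>t. unresolvent t * poly [:0, 1:] t) \<in> borel_measurable borel" by measurable
  note c = fcalc_cong_AE[OF borel_measurable_poly fcalc_poly(1) m ae]
  have "x \<in> fdom unresolvent" unfolding x using c(1) by (subst fcalc_fcalc(1)) (auto intro: fcalc_poly)
  moreover have "fcalc unresolvent x = y"
  proof -
    have "fcalc unresolvent x = fcalc (poly [:1, -1:]) w"
      using fcalc_fcalc(2)[OF unresolvent_measurable borel_measurable_poly Xd c(1)] c(2) unfolding x[symmetric] by (simp only:)
    also have "\<dots> = w - resolvent w" by (simp only: fcalc_poly pcalc_1_minus_X)
    finally show ?thesis using resolvent_eq[OF xy] by (simp add: w_def)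
  qed
  ultimately show "z \<in> fgraph unresolvent" by (auto simp: fgraph_def z)
next
  fix z assume "z \<in> fgraph unresolvent"
  then obtain x where z: "z = (x, fcalc unresolvent x)" and x: "x \<in> fdom unresolvent" by (auto simp: fgraph_def)
  define w where "w = x + fcalc unresolvent x"
  define g where "g t = 1 + unresolvent t" for t
  have g: "g \<in> borel_measurable borel" unfolding g_def by measurable
  have gd: "x \<in> fdom g" unfolding g_def by (intro L2_add fcalc_one unresolvent_measurable x) simp
  have w: "w = fcalc g x"
    unfolding g_def w_def using fcalc_add_fun[OF _ fcalc_one(1) unresolvent_measurable x] fcalc_one by simp
  have ae: "AE t in \<mu> x. 1 = poly [:0, 1:] t * g t"
    using AE_positive[of x]
  proof eventually_elim
    case (elim t)
    then have "1 / t \<ge> 1" by simp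
    then have "t * g t = 1" using elim by (simp add: unresolvent_def g_def algebra_simps)
    then show ?case by simp
  qed
  have m: "(\<lambda>t. poly [:0, 1:] t * g t) \<in> borel_measurable borel" using g by measurable
  have "resolvent w = fcalc (\<lambda>t. poly [:0, 1:] t * g t) x"
    unfolding w using pcalc_fcalc(2)[OF g gd, of "[:0, 1:]"] by (simp add: pcalc_X)
  also have "\<dots> = fcalc (\<lambda>_. 1) x"
    by (rule fcalc_cong_AE(2)[symmetric]) (use ae m fcalc_one in auto)
  finally have "resolvent w = x" by (simp add: fcalc_one)
  then show "z \<in> T" using resolvent_mem[of w] by (simp add: z w_def)
qed

end

section \<open>Projection-valued measures\<close>

lemma quadratic_form_determines:
  fixes R R' :: "'a::complex_hilbert oper"
  assumes R: "linear_op R" "linear_op R'" and dom: "Domain R = Domain R'" and dense: "closure (Domain R) = UNIV"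
    and eq: "\<And>x y z. (x, y) \<in> R \<Longrightarrow> (x, z) \<in> R' \<Longrightarrow> cinner x y = cinner x z"
  shows "R = R'"
proof -
  define B where "B x y = cinner x (op_val R y - op_val R' y)" for x y
  have zero: "B x y = 0" if "x \<in> Domain R" "y \<in> Domain R" for x y
  proof (rule sesquilinear_zero[OF csubspace_Domain[OF R(1)] _ _ _ _ _ that])
    show "B (x + y) z = B x z + B y z" for x y z
      by (simp add: B_def cinner_add_left)
    show "B x (y + z) = B x y + B x z" if "y \<in> Domain R" "z \<in> Domain R" for x y z
      using that dom by (simp add: B_def op_val_add R cinner_diff_right cinner_add_right)
    show "B (scaleC c x) y = cnj c * B x y" for c x y
      by (simp add: B_def cinner_scaleC_left)
    show "B x (scaleC c y) = c * B x y" if "y \<in> Domain R" for c x y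
      using that dom by (simp add: B_def op_val_scaleC R cinner_diff_right cinner_scaleC_right right_diff_distrib)
    show "B x x = 0" if "x \<in> Domain R" for x
      using eq[OF op_val_mem[OF R(1) that] op_val_mem[OF R(2)]] that dom
      by (simp add: B_def cinner_diff_right)
  qed
  have val: "op_val R y = op_val R' y" if "y \<in> Domain R" for y
    using orthogonal_dense_zero[OF dense, of "op_val R y - op_val R' y"] zero that by (simp add: B_def)
  have "(x, y) \<in> R \<longleftrightarrow> (x, y) \<in> R'" for x y
    using val[of x] dom op_val_eq[OF R(1), of x] op_val_eq[OF R(2), of x] op_val_mem[OF R(1), of x] op_val_mem[OF R(2), of x]
    by (metis Domain.DomainI)
  then show ?thesis by auto
qed

lemma is_spectral_integral_unique:
  assumes "is_spectral_integral E f R" "is_spectral_integral E f R'" "closure (Domain R) = UNIV"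
  shows "R = R'"
proof (rule quadratic_form_determines)
  show "cinner x y = cinner x z" if "(x, y) \<in> R" "(x, z) \<in> R'" for x y z
    using assms(1,2) that unfolding is_spectral_integral_def by fastforce
qed (use assms in \<open>auto simp: is_spectral_integral_def\<close>)

lemma spectral_integral_eq:
  assumes "is_spectral_integral E f R" "closure (Domain R) = UNIV"
  shows "spectral_integral E f = R"
  unfolding spectral_integral_def
  using assms by (intro the_equality) (auto dest: is_spectral_integral_unique)

lemma orth_projection_linear:
  assumes P: "orth_projection P"
  shows "P (x + y) = P x + P y" "P (scaleC c x) = scaleC c (P x)" "P (P x) = P x"
    "cinner (P x) y = cinner x (P y)" "P 0 = 0" "P (x - y) = P x - P y" "P (r *\<^sub>R x) = r *\<^sub>R P x"
    "inner x (P x) = (norm (P x))\<^sup>2" "norm (P x) \<le> norm x"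
proof -
  show add: "P (x + y) = P x + P y" for x y using P by (simp add: orth_projection_def)
  show sc: "P (scaleC c x) = scaleC c (P x)" for c x using P by (simp add: orth_projection_def)
  show idem: "P (P x) = P x" using P by (simp add: orth_projection_def)
  show sym: "cinner (P x) y = cinner x (P y)" for x y using P by (simp add: orth_projection_def)
  show "P 0 = 0" using sc[of 0 0] by simp
  show "P (x - y) = P x - P y" using add[of "x - y" y] by simp
  show "P (r *\<^sub>R x) = r *\<^sub>R P x" using sc[of "of_real r"] by (simp add: scaleC_of_real)
  have "cinner x (P x) = cinner (P x) (P x)" using sym[of x "P x"] idem by simp
  then show e: "inner x (P x) = (norm (P x))\<^sup>2"
    by (simp add: Re_cinner[symmetric] power2_norm_eq_inner)
  have "norm (P x) * norm (P x) \<le> norm x * norm (P x)"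
    using e norm_cauchy_schwarz[of x "P x"] by (simp add: power2_eq_square)
  then show "norm (P x) \<le> norm x" by (cases "P x = 0") auto
qed

lemma orth_projection_bounded_linear: "orth_projection P \<Longrightarrow> bounded_linear P"
  by (rule bounded_linear_intro[of _ 1]) (auto simp: orth_projection_linear)

text \<open>An arbitrary projection-valued measure. Uniqueness of the spectral resolution compares two of them,
  so their properties are derived from the axioms alone.\<close>
locale pvm =
  fixes E :: "real set \<Rightarrow> 'a::complex_hilbert \<Rightarrow> 'a"
  assumes pvm: "proj_valued_measure E"
begin

lemma proj: "B \<in> sets borel \<Longrightarrow> orth_projection (E B)"
  using pvm by (simp add: proj_valued_measure_def)

lemmas E_add = orth_projection_linear(1)[OF proj]
  and E_scaleC = orth_projection_linear(2)[OF proj]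
  and E_idem = orth_projection_linear(3)[OF proj]
  and E_sym = orth_projection_linear(4)[OF proj]
  and E_zero = orth_projection_linear(5)[OF proj]
  and E_diff = orth_projection_linear(6)[OF proj]
  and E_norm = orth_projection_linear(8)[OF proj]
  and E_bounded_linear = orth_projection_bounded_linear[OF proj]

lemma E_UNIV: "E UNIV x = x"
  using pvm by (simp add: proj_valued_measure_def)

lemma E_sums: "range B \<subseteq> sets borel \<Longrightarrow> disjoint_family B \<Longrightarrow> (\<lambda>k. E (B k) x) sums E (\<Union>k. B k) x"
  for B :: "nat \<Rightarrow> real set"
  using pvm by (simp add: proj_valued_measure_def)

lemma E_empty: "E {} x = 0"
proof -
  have "(\<lambda>k::nat. E {} x) sums E {} x" using E_sums[of "\<lambda>_. {}" x] by (simp add: disjoint_family_on_def)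
  then have "(\<lambda>k::nat. E {} x) \<longlonglongrightarrow> 0" by (intro summable_LIMSEQ_zero sums_summable)
  then show ?thesis by (simp add: LIMSEQ_const_iff)
qed

lemma E_Un:
  assumes "A \<in> sets borel" "B \<in> sets borel" "A \<inter> B = {}"
  shows "E (A \<union> B) x = E A x + E B x"
proof -
  have "(\<lambda>k. E (binaryset A B k) x) sums E (\<Union>k. binaryset A B k) x"
    using assms by (intro E_sums) (auto simp: binaryset_def disjoint_family_on_def)
  moreover have "(\<lambda>k. E (binaryset A B k) x) sums (\<Sum>k\<in>{0, 1}. E (binaryset A B k) x)"
    by (rule sums_finite) (auto simp: binaryset_def E_empty)
  ultimately show ?thesis
    by (auto simp: UN_binaryset_eq binaryset_def dest: sums_unique2)
qed

text \<open>If \<open>P\<close>, \<open>Q\<close> and \<open>P + Q\<close> are orthogonal projections, then \<open>P Q = 0\<close>: for \<open>y\<close> in the range of \<open>Q\<close>,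
  expanding \<open>\<parallel>(P + Q) y\<parallel>\<^sup>2 = \<parallel>P y\<parallel>\<^sup>2 + \<parallel>Q y\<parallel>\<^sup>2\<close> leaves \<open>\<langle>P y, y\<rangle> = 0\<close>.\<close>
lemma E_disjoint:
  assumes [measurable]: "A \<in> sets borel" "B \<in> sets borel" and "A \<inter> B = {}"
  shows "E A (E B x) = 0"
proof -
  define y where "y = E B x"
  have By: "E B y = y" by (simp add: y_def E_idem)
  have AB: "E (A \<union> B) z = E A z + E B z" for z using assms by (intro E_Un) auto
  have "(norm (E (A \<union> B) y))\<^sup>2 = (norm (E A y))\<^sup>2 + (norm (E B y))\<^sup>2"
    using E_norm[of "A \<union> B" y] E_norm[of A y] E_norm[of B y] by (simp add: AB inner_add_right)
  then have "inner (E A y) y = 0"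
    unfolding AB By by (simp add: power2_norm_eq_inner inner_add inner_commute)
  then have "(norm (E A y))\<^sup>2 = 0" using E_norm[of A y] by (simp add: inner_commute)
  then show ?thesis by (simp add: y_def)
qed

lemma E_Int:
  assumes [measurable]: "A \<in> sets borel" "B \<in> sets borel"
  shows "E A (E B x) = E (A \<inter> B) x"
proof -
  have "E B x = E (A \<inter> B) x + E (B - A) x" 
  proof -
    have "(A \<inter> B) \<union> (B - A) = B" "(A \<inter> B) \<inter> (B - A) = {}" by auto
    then show ?thesis using E_Un[of "A \<inter> B" "B - A" x] by simp
  qed
  moreover have "E A y = E (A \<inter> B) y + E (A - B) y" for y
  proof -
    have "(A \<inter> B) \<union> (A - B) = A" "(A \<inter> B) \<inter> (A - B) = {}" by auto
    then show ?thesis using E_Un[of "A \<inter> B" "A - B" y] by simp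
  qed
  moreover have "E A (E (B - A) x) = 0" "E (A - B) (E (A \<inter> B) x) = 0" by (auto intro!: E_disjoint)
  ultimately show ?thesis by (simp add: E_add E_idem)
qed

lemma E_Compl: "B \<in> sets borel \<Longrightarrow> E (- B) x = x - E B x"
  using E_Un[of B "- B" x] add_diff_cancel_left'[of "E B x" "E (- B) x"] by (simp add: E_UNIV)

abbreviation \<nu> where "\<nu> \<equiv> scalar_measure E"

lemma sets_nu: "sets (\<nu> x) = sets borel"
  unfolding scalar_measure_def using sets.sigma_sets_eq[of "borel :: real measure"] by (simp add: sets_measure_of_conv)

lemma space_nu: "space (\<nu> x) = UNIV"
  using sets_eq_imp_space_eq[OF sets_nu] by simp

lemma emeasure_nu:
  assumes "B \<in> sets borel"
  shows "emeasure (\<nu> x) B = ennreal ((norm (E B x))\<^sup>2)"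
proof -
  have "emeasure (\<nu> x) B = ennreal (Re (cinner x (E B x)))"
    unfolding scalar_measure_def
  proof (rule emeasure_measure_of_sigma)
    show "sigma_algebra UNIV (sets (borel :: real measure))"
      using sets.sigma_algebra_axioms[of "borel :: real measure"] by simp
    show "positive (sets borel) (\<lambda>B. ennreal (Re (cinner x (E B x))))"
      by (simp add: positive_def E_empty)
    show "countably_additive (sets borel) (\<lambda>B. ennreal (Re (cinner x (E B x))))"
      unfolding countably_additive_def
    proof (intro allI impI)
      fix A :: "nat \<Rightarrow> real set" assume A: "range A \<subseteq> sets borel" "disjoint_family A"
      have "(\<lambda>k. inner x (E (A k) x)) sums inner x (E (\<Union>k. A k) x)"
        by (rule bounded_linear.sums[OF bounded_linear_inner_right E_sums[OF A]])
      moreover have "0 \<le> inner x (E (A k) x)" for k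
        using A(1) E_norm[of "A k" x] by (simp add: range_subsetD)
      ultimately show "(\<Sum>k. ennreal (Re (cinner x (E (A k) x)))) = ennreal (Re (cinner x (E (\<Union>k. A k) x)))"
        unfolding Re_cinner by (intro suminf_ennreal_eq)
    qed
  qed (use assms in auto)
  then show ?thesis using assms by (simp add: Re_cinner E_norm)
qed

lemma finite_nu: "finite_measure (\<nu> x)"
  by (rule finite_measureI) (simp add: space_nu emeasure_nu)

lemma measure_nu: "B \<in> sets borel \<Longrightarrow> measure (\<nu> x) B = (norm (E B x))\<^sup>2"
  by (simp add: measure_def emeasure_nu)

lemma borel_nu: "f \<in> borel_measurable borel \<Longrightarrow> f \<in> borel_measurable (\<nu> x)"
  using measurable_cong_sets[OF sets_nu refl] by blast

lemma nu_E:
  assumes B [measurable]: "B \<in> sets borel"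
  shows "\<nu> (E B x) = density (\<nu> x) (\<lambda>t. ennreal (indicator B t))"
proof (rule measure_eqI)
  fix A assume "A \<in> sets (\<nu> (E B x))"
  then have A [measurable]: "A \<in> sets borel" by (simp add: sets_nu)
  have s: "A \<in> sets (\<nu> x)" "B \<in> sets (\<nu> x)" by (auto simp: sets_nu)
  have "emeasure (density (\<nu> x) (\<lambda>t. ennreal (indicator B t))) A =
      (\<integral>\<^sup>+t. ennreal (indicator B t) * indicator A t \<partial>\<nu> x)"
    using s by (intro emeasure_density) auto
  also have "\<dots> = (\<integral>\<^sup>+t. indicator (A \<inter> B) t \<partial>\<nu> x)"
    by (intro nn_integral_cong) (auto simp: indicator_def)
  also have "\<dots> = emeasure (\<nu> x) (A \<inter> B)" using s by simp
  finally show "emeasure (\<nu> (E B x)) A = emeasure (density (\<nu> x) (\<lambda>t. ennreal (indicator B t))) A"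
    by (simp add: emeasure_nu E_Int)
qed (simp add: sets_nu)

lemma nu_AE:
  assumes B [measurable]: "B \<in> sets borel" and x: "E B x = x"
  shows "AE t in \<nu> x. t \<in> B"
proof -
  have "emeasure (\<nu> x) (- B) = 0" using B by (simp add: emeasure_nu E_Compl x)
  then show ?thesis
    by (intro AE_I[of _ _ "- B"]) (use B in \<open>auto simp: sets_nu\<close>)
qed

lemma E_incseq:
  assumes A: "\<And>n. A n \<in> sets borel" "incseq A"
  shows "(\<lambda>n. E (A n) x) \<longlonglongrightarrow> E (\<Union>n. A n) x"
proof -
  interpret finite_measure "\<nu> x" by (rule finite_nu)
  let ?U = "\<Union>n. A n"
  have U [measurable]: "?U \<in> sets borel" using A by auto
  have "(norm (E ?U x - E (A n) x))\<^sup>2 = measure (\<nu> x) ?U - measure (\<nu> x) (A n)" for n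
  proof -
    note [measurable] = A(1)
    have "E ?U x = E (A n) x + E (?U - A n) x"
      using E_Un[of "A n" "?U - A n" x] by (auto simp: Un_absorb1 UN_upper)
    then have "norm (E ?U x - E (A n) x) = norm (E (?U - A n) x)" by simp
    also have "(norm (E (?U - A n) x))\<^sup>2 = measure (\<nu> x) (?U - A n)" by (simp add: measure_nu)
    also have "\<dots> = measure (\<nu> x) ?U - measure (\<nu> x) (A n)"
      by (rule finite_measure_Diff) (auto simp: sets_nu)
    finally show ?thesis by simp
  qed
  moreover have "(\<lambda>n. measure (\<nu> x) ?U - measure (\<nu> x) (A n)) \<longlonglongrightarrow> measure (\<nu> x) ?U - measure (\<nu> x) ?U"
    using A by (intro tendsto_intros finite_Lim_measure_incseq) (auto simp: sets_nu)
  ultimately have "(\<lambda>n. sqrt ((norm (E ?U x - E (A n) x))\<^sup>2)) \<longlonglongrightarrow> sqrt 0"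
    by (intro tendsto_real_sqrt) simp
  then have "(\<lambda>n. E ?U x - E (A n) x) \<longlonglongrightarrow> 0" by (simp add: tendsto_norm_zero_iff)
  from tendsto_diff[OF tendsto_const[of "E ?U x"] this] show ?thesis by simp
qed

end

locale spectral_resolution = pvm E for E :: "real set \<Rightarrow> 'a::complex_hilbert \<Rightarrow> 'a" +
  fixes T :: "'a oper"
  assumes integral: "is_spectral_integral E (\<lambda>t. t) T"
begin

lemma T_linear: "linear_op T" using integral by (simp add: is_spectral_integral_def)

lemma T_Domain: "x \<in> Domain T \<longleftrightarrow> integrable (\<nu> x) (\<lambda>t. t\<^sup>2)"
  using integral by (simp add: is_spectral_integral_def)

lemma T_form: "(x, y) \<in> T \<Longrightarrow> cinner x y = of_real (\<integral>t. t \<partial>\<nu> x)"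
  using integral by (auto simp: is_spectral_integral_def)

lemma integrable_id: "x \<in> Domain T \<Longrightarrow> integrable (\<nu> x) (\<lambda>t. t)"
proof -
  assume x: "x \<in> Domain T"
  interpret finite_measure "\<nu> x" by (rule finite_nu)
  have "\<bar>t\<bar> \<le> 1 + t\<^sup>2" for t :: real
    using zero_le_power2[of "\<bar>t\<bar> - 1"] by (simp add: power2_diff)
  then have "AE t in \<nu> x. norm t \<le> norm (1 + t\<^sup>2)" by simp
  moreover have "integrable (\<nu> x) (\<lambda>t. 1 + t\<^sup>2)" using x by (simp add: T_Domain)
  moreover have "(\<lambda>t. t) \<in> borel_measurable (\<nu> x)" by (rule borel_nu) simp
  ultimately show ?thesis by (rule Bochner_Integration.integrable_bound[rotated 2])
qed

lemma E_Domain: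
  assumes B [measurable]: "B \<in> sets borel" and x: "x \<in> Domain T"
  shows "E B x \<in> Domain T"
proof -
  have s: "B \<in> sets (\<nu> x)" by (simp add: sets_nu B)
  note [measurable] = borel_nu[of "\<lambda>t. t" x]
  have "integrable (\<nu> x) (\<lambda>t. t\<^sup>2 * indicator B t)"
    using x unfolding T_Domain by (rule integrable_real_mult_indicator[OF s])
  then show ?thesis
    unfolding T_Domain nu_E[OF B] using s by (subst integrable_density) (auto simp: mult.commute)
qed

lemma form_split:
  assumes B [measurable]: "B \<in> sets borel" and x: "x \<in> Domain T"
  shows "cinner x (op_val T x) = cinner (E B x) (op_val T (E B x)) + cinner (E (- B) x) (op_val T (E (- B) x))"
proof -
  have part: "(\<integral>t. t \<partial>\<nu> (E C x)) = (\<integral>t. t * indicator C t \<partial>\<nu> x)" "integrable (\<nu> x) (\<lambda>t. t * indicator C t)"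
    if C [measurable]: "C \<in> sets borel" for C
  proof -
    have s: "C \<in> sets (\<nu> x)" by (simp add: sets_nu C)
    show "(\<integral>t. t \<partial>\<nu> (E C x)) = (\<integral>t. t * indicator C t \<partial>\<nu> x)"
      unfolding nu_E[OF C] using s borel_nu[of "\<lambda>t. t" x] by (subst integral_density) (auto simp: mult.commute)
    show "integrable (\<nu> x) (\<lambda>t. t * indicator C t)"
      using integrable_id[OF x] s by (intro integrable_real_mult_indicator)
  qed
  have form: "cinner y (op_val T y) = of_real (\<integral>t. t \<partial>\<nu> y)" if "y \<in> Domain T" for y
    using that by (intro T_form op_val_mem T_linear)
  have "(\<integral>t. t \<partial>\<nu> x) = (\<integral>t. t * indicator B t + t * indicator (- B) t \<partial>\<nu> x)"
    by (intro Bochner_Integration.integral_cong) (auto simp: indicator_def)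
  also have "\<dots> = (\<integral>t. t \<partial>\<nu> (E B x)) + (\<integral>t. t \<partial>\<nu> (E (- B) x))"
    using part[of B] part[of "- B"] by (simp add: Bochner_Integration.integral_add)
  finally show ?thesis using x by (simp add: form E_Domain)
qed

text \<open>By \<open>form_split\<close> the quadratic form of \<open>T\<close> splits along \<open>E(B)\<close> and its complement. After polarization
  the cross terms vanish, which says that \<open>E(B)\<close> commutes with \<open>T\<close>.\<close>
lemma E_commutes:
  assumes B [measurable]: "B \<in> sets borel" and dense: "closure (Domain T) = UNIV" and xy: "(x, y) \<in> T"
  shows "(E B x, E B y) \<in> T"
proof -
  let ?P = "E B" and ?Q = "E (- B)" and ?t = "op_val T"
  define F where "F u v = cinner u (?t v) - cinner (?P u) (?t (?P v)) - cinner (?Q u) (?t (?Q v))" for u v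
  have dom: "?P u \<in> Domain T" "?Q u \<in> Domain T" if "u \<in> Domain T" for u
    using that by (auto intro: E_Domain)
  have zero: "F u v = 0" if "u \<in> Domain T" "v \<in> Domain T" for u v
  proof (rule sesquilinear_zero[OF csubspace_Domain[OF T_linear] _ _ _ _ _ that])
    show "F (x + y) z = F x z + F y z" if "x \<in> Domain T" "y \<in> Domain T" "z \<in> Domain T" for x y z
      by (simp add: F_def E_add cinner_add_left)
    show "F x (y + z) = F x y + F x z" if "x \<in> Domain T" "y \<in> Domain T" "z \<in> Domain T" for x y z
      using that by (simp add: F_def E_add cinner_add_right op_val_add T_linear dom)
    show "F (scaleC c x) y = cnj c * F x y" if "x \<in> Domain T" "y \<in> Domain T" for c x y
      by (simp add: F_def E_scaleC cinner_scaleC_left right_diff_distrib)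
    show "F x (scaleC c y) = c * F x y" if "x \<in> Domain T" "y \<in> Domain T" for c x y
      using that by (simp add: F_def E_scaleC cinner_scaleC_right op_val_scaleC T_linear dom right_diff_distrib)
    show "F x x = 0" if "x \<in> Domain T" for x
      using form_split[OF B that] by (simp add: F_def)
  qed
  have x: "x \<in> Domain T" using xy by blast
  have t0: "?t 0 = 0" by (intro op_val_eq T_linear linear_op_zero)
  have PQ: "?Q (?P u) = 0" "?P (?P u) = ?P u" for u by (auto intro: E_disjoint E_idem)
  have "cinner u (?t (?P x) - ?P (?t x)) = 0" if u: "u \<in> Domain T" for u
  proof -
    have "cinner u (?t (?P x)) = cinner (?P u) (?t (?P x))"
      using zero[OF u dom(1)[OF x]] by (simp add: F_def PQ t0)
    also have "\<dots> = cinner (?P u) (?t x)"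
      using zero[OF dom(1)[OF u] x] by (simp add: F_def PQ)
    finally show ?thesis by (simp add: cinner_diff_right E_sym)
  qed
  then have "?t (?P x) = ?P (?t x)" using orthogonal_dense_zero[OF dense, of "?t (?P x) - ?P (?t x)"] by simp
  then show ?thesis
    using op_val_mem[OF T_linear dom(1)[OF x]] op_val_eq[OF T_linear xy] by simp
qed

lemma bounded_support_Domain:
  assumes B [measurable]: "B \<in> sets borel" and "B \<subseteq> {-r..r}" and x: "E B x = x"
  shows "x \<in> Domain T"
proof -
  interpret finite_measure "\<nu> x" by (rule finite_nu)
  have "AE t in \<nu> x. norm (t\<^sup>2) \<le> r\<^sup>2"
    using nu_AE[OF B x]
  proof (rule eventually_mono)
    fix t assume "t \<in> B"
    then have "t \<in> {-r..r}" using assms(2) by blast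
    then have "\<bar>t\<bar> \<le> r" by auto
    then show "norm (t\<^sup>2) \<le> r\<^sup>2" using power_mono[of "\<bar>t\<bar>" r 2] by simp
  qed
  then show ?thesis
    unfolding T_Domain using borel_nu[of "\<lambda>t. t" x] by (intro integrable_const_bound) auto
qed

text \<open>The sign \<open>\<sigma>\<close> lets one lemma give both upper and lower bounds.\<close>
lemma form_bound:
  assumes B [measurable]: "B \<in> sets borel" and x: "E B x = x" "(x, y) \<in> T"
    and le: "\<And>t. t \<in> B \<Longrightarrow> \<sigma> * t \<le> a"
  shows "\<sigma> * Re (cinner x y) \<le> a * (norm x)\<^sup>2"
proof -
  interpret finite_measure "\<nu> x" by (rule finite_nu)
  have i: "integrable (\<nu> x) (\<lambda>t. t)" using x by (intro integrable_id) blast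
  have "\<sigma> * (\<integral>t. t \<partial>\<nu> x) = (\<integral>t. \<sigma> * t \<partial>\<nu> x)" by simp
  also have "\<dots> \<le> (\<integral>t. a \<partial>\<nu> x)"
    using nu_AE[OF B x(1)] le i by (intro integral_mono_AE) (auto elim!: eventually_mono)
  also have "\<dots> = a * (norm x)\<^sup>2" by (simp add: space_nu measure_nu E_UNIV)
  finally show ?thesis using T_form[OF x(2)] by simp
qed

end

section \<open>The spectral theorem for positive selfadjoint operators\<close>

context positive_selfadjoint
begin

text \<open>The projections \<open>1\<^bsub>B\<^esub>(T)\<close>, written as functions of the resolvent. They vanish off the Borel sets, as
  the uniqueness convention for resolutions of the identity demands.\<close>
definition spectral_family :: "real set \<Rightarrow> 'a \<Rightarrow> 'a" where
  "spectral_family B x = (if B \<in> sets borel then fcalc (indicator (unresolvent -` B)) x else 0)"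

lemma unresolvent_vimage [measurable]: "B \<in> sets borel \<Longrightarrow> unresolvent -` B \<in> sets borel"
  using measurable_sets[OF unresolvent_measurable, of B] by simp

lemma fdom_indicator: "B \<in> sets borel \<Longrightarrow> x \<in> fdom (indicator B)"
  by (auto intro!: fdom_bounded[where B = 1] simp: indicator_def)

lemma cinner_spectral_family:
  assumes "B \<in> sets borel"
  shows "cinner x (spectral_family B x) = of_real (measure (distr (\<mu> x) borel unresolvent) B)"
proof -
  have "cinner x (spectral_family B x) = of_real (\<integral>t. indicator (unresolvent -` B) t \<partial>\<mu> x)"
    using assms by (simp add: spectral_family_def cinner_fcalc fdom_indicator)
  also have "(\<integral>t. indicator (unresolvent -` B) t \<partial>\<mu> x) = measure (distr (\<mu> x) borel unresolvent) B"
    using assms borel_mu[OF unresolvent_measurable, of x] by (simp add: measure_distr space_mu)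
  finally show ?thesis .
qed

lemma pvm_spectral_family: "proj_valued_measure spectral_family"
  unfolding proj_valued_measure_def
proof (intro conjI ballI allI impI)
  fix B :: "real set" assume B: "B \<in> sets borel"
  have sf: "spectral_family B = fcalc (indicator (unresolvent -` B))" using B by (auto simp: spectral_family_def)
  note d = fdom_indicator[OF unresolvent_vimage[OF B]]
  show "orth_projection (spectral_family B)"
    unfolding orth_projection_def sf
  proof (intro conjI allI)
    fix x y c
    show "fcalc (indicator (unresolvent -` B)) (x + y) = fcalc (indicator (unresolvent -` B)) x + fcalc (indicator (unresolvent -` B)) y"
      using B d by (intro fcalc_add) auto
    show "fcalc (indicator (unresolvent -` B)) (scaleC c x) = scaleC c (fcalc (indicator (unresolvent -` B)) x)"
      using B d by (intro fcalc_scaleC) auto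
    have sq: "(\<lambda>t. indicator (unresolvent -` B) t * indicator (unresolvent -` B) t) = (indicator (unresolvent -` B) :: real \<Rightarrow> real)"
      by (auto simp: indicator_def)
    show "fcalc (indicator (unresolvent -` B)) (fcalc (indicator (unresolvent -` B)) x) = fcalc (indicator (unresolvent -` B)) x"
      using fcalc_fcalc(2)[of "indicator (unresolvent -` B)" "indicator (unresolvent -` B)" x] B d by (simp add: sq)
    show "cinner (fcalc (indicator (unresolvent -` B)) x) y = cinner x (fcalc (indicator (unresolvent -` B)) y)"
      using B d by (intro fcalc_sym) auto
  qed
next
  fix x show "spectral_family UNIV x = x"
    using fcalc_one(2)[of x] by (simp add: spectral_family_def indicator_def[abs_def])
next
  fix B :: "nat \<Rightarrow> real set" and x assume B: "range B \<subseteq> sets borel" and dis: "disjoint_family B"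
  have Bm [measurable]: "B k \<in> sets borel" for k using B by auto
  have part: "(\<Sum>k<n. fcalc (indicator (unresolvent -` B k)) x) = fcalc (indicator (\<Union>k<n. unresolvent -` B k)) x" for n
  proof (induction n)
    case (Suc n)
    have eq: "(\<lambda>t. indicator (\<Union>k<n. unresolvent -` B k) t + indicator (unresolvent -` B n) t) = (indicator (\<Union>k<Suc n. unresolvent -` B k) :: real \<Rightarrow> real)"
    proof
      fix t
      have "B k \<inter> B n = {}" if "k < n" for k
        using disjoint_family_onD[OF dis, of k n] that by simp
      then have "(\<Union>k<n. unresolvent -` B k) \<inter> unresolvent -` B n = {}" by blast
      then show "indicator (\<Union>k<n. unresolvent -` B k) t + indicator (unresolvent -` B n) t = (indicator (\<Union>k<Suc n. unresolvent -` B k) t :: real)"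
        by (simp add: lessThan_Suc Un_commute indicator_add)
    qed
    have "fcalc (\<lambda>t. indicator (\<Union>k<n. unresolvent -` B k) t + indicator (unresolvent -` B n) t) x =
        fcalc (indicator (\<Union>k<n. unresolvent -` B k)) x + fcalc (indicator (unresolvent -` B n)) x"
      by (intro fcalc_add_fun fdom_indicator) auto
    then show ?case using Suc by (simp add: eq)
  qed simp
  have "(\<lambda>n. fcalc (indicator (\<Union>k<n. unresolvent -` B k)) x) \<longlonglongrightarrow> fcalc (indicator (\<Union>k. unresolvent -` B k)) x"
  proof (rule fcalc_cutoff_limit)
    show "(\<lambda>n. indicator (\<Union>k<n. unresolvent -` B k) t :: real) \<longlonglongrightarrow> indicator (\<Union>k. unresolvent -` B k) t" for t
      by (rule LIMSEQ_indicator_UN)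
  qed auto
  moreover have "(\<Union>k. unresolvent -` B k) = unresolvent -` (\<Union>k. B k)" by auto
  ultimately show "(\<lambda>k. spectral_family (B k) x) sums spectral_family (\<Union>k. B k) x"
    unfolding sums_def by (simp add: spectral_family_def part)
next
  fix B :: "real set" and x assume "B \<notin> sets borel"
  then show "spectral_family B x = 0" by (simp add: spectral_family_def)
qed

sublocale F: pvm spectral_family by unfold_locales (rule pvm_spectral_family)

lemma scalar_measure_spectral_family: "scalar_measure spectral_family x = distr (\<mu> x) borel unresolvent"
proof (rule measure_eqI)
  interpret finite_measure "\<mu> x" by (rule finite_mu)
  interpret D: finite_measure "distr (\<mu> x) borel unresolvent"
    using borel_mu[OF unresolvent_measurable, of x] by (rule finite_measure_distr)
  fix B assume "B \<in> sets (scalar_measure spectral_family x)"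
  then have B: "B \<in> sets borel" by (simp add: F.sets_nu)
  have "(norm (spectral_family B x))\<^sup>2 = Re (cinner x (spectral_family B x))"
    using F.E_norm[OF B, of x] by (simp add: Re_cinner)
  then show "emeasure (scalar_measure spectral_family x) B = emeasure (distr (\<mu> x) borel unresolvent) B"
    using cinner_spectral_family[OF B, of x] by (simp add: F.emeasure_nu[OF B] D.emeasure_eq_measure)
qed (simp add: F.sets_nu)

lemma is_spectral_integral_fgraph:
  assumes f [measurable]: "f \<in> borel_measurable borel"
  shows "is_spectral_integral spectral_family f (fgraph (f \<circ> unresolvent))"
proof -
  have fh: "f \<circ> unresolvent \<in> borel_measurable borel" by measurable
  note [measurable] = borel_mu[OF unresolvent_measurable]
  show ?thesis
    unfolding is_spectral_integral_def scalar_measure_spectral_family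
  proof (intro conjI)
    show "linear_op (fgraph (f \<circ> unresolvent))" by (rule linear_op_fgraph[OF fh])
    show "Domain (fgraph (f \<circ> unresolvent)) = {x. integrable (distr (\<mu> x) borel unresolvent) (\<lambda>t. (f t)\<^sup>2)}"
      unfolding Domain_fgraph fdom_def by (auto simp: integrable_distr_eq)
    show "\<forall>(x, y)\<in>fgraph (f \<circ> unresolvent). cinner x y = complex_of_real (integral\<^sup>L (distr (\<mu> x) borel unresolvent) f)"
      using cinner_fcalc(2)[OF fh] by (auto simp: fgraph_def integral_distr)
  qed
qed

sublocale F: spectral_resolution spectral_family T
proof
  have "(\<lambda>t. t) \<circ> unresolvent = unresolvent" by auto
  then show "is_spectral_integral spectral_family (\<lambda>t. t) T"
    using is_spectral_integral_fgraph[of "\<lambda>t. t"] T_eq_fgraph by simp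
qed

lemma T_dense: "closure (Domain T) = UNIV"
  by (subst T_eq_fgraph) (simp add: Domain_fgraph fdom_dense)

text \<open>The family \<open>E\<close> commutes with \<open>T\<close>, hence with the resolvent and with every projection of the
  spectral family. A vector \<open>x\<close> in the ranges of \<open>E(B)\<close> and of the other projection over \<open>B'\<close>, where
  \<open>B \<subseteq> (-\<infinity>, a]\<close> and \<open>B' \<subseteq> [b, \<infinity>)\<close> with \<open>a < b\<close>, would satisfy
  \<open>b \<parallel>x\<parallel>\<^sup>2 \<le> \<langle>x, T x\<rangle> \<le> a \<parallel>x\<parallel>\<^sup>2\<close>. So both families agree on half-lines.\<close>
theorem resolution_unique:
  assumes E: "proj_valued_measure E" "is_spectral_integral E (\<lambda>t. t) T"
  shows "E = spectral_family"
proof -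
  interpret E: spectral_resolution E T by unfold_locales (rule E)+
  let ?F = spectral_family
  have commute: "E B (?F C x) = ?F C (E B x)" if B: "B \<in> sets borel" and C: "C \<in> sets borel" for B C x
  proof -
    have "E B (resolvent x) = resolvent (E B x)" for x
    proof -
      have "(E B (resolvent x), E B (x - resolvent x)) \<in> T" by (rule E.E_commutes[OF B T_dense resolvent_mem])
      from resolvent_eq[OF this] show ?thesis by (simp add: E.E_diff B)
    qed
    then interpret intertwining resolvent resolvent "E B"
      by (intro intertwining.intro intertwining_axioms.intro positive_contraction_axioms E.E_bounded_linear B)
    show ?thesis
      using S_fcalc[of "indicator (unresolvent -` C)" x] C by (simp add: spectral_family_def fdom_indicator)
  qed
  have separated: "x = 0"
    if B: "B \<in> sets borel" "B \<subseteq> {-r..r}" "\<And>t. t \<in> B \<Longrightarrow> \<sigma> * t \<le> a" "E B x = x"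
      and C: "C \<in> sets borel" "\<And>t. t \<in> C \<Longrightarrow> b \<le> \<sigma> * t" "?F C x = x" and ab: "a < b"
    for B C \<sigma> a b r x
  proof -
    have xy: "(x, op_val T x) \<in> T"
      by (intro op_val_mem linear E.bounded_support_Domain[OF B(1,2,4)])
    have "\<sigma> * Re (cinner x (op_val T x)) \<le> a * (norm x)\<^sup>2"
      by (rule E.form_bound[OF B(1,4) xy B(3)])
    moreover have "(-\<sigma>) * Re (cinner x (op_val T x)) \<le> (-b) * (norm x)\<^sup>2"
      using C(2) by (intro F.form_bound[OF C(1,3) xy]) simp
    ultimately have "b * (norm x)\<^sup>2 \<le> a * (norm x)\<^sup>2" by simp
    then show ?thesis using ab by (simp add: mult_le_cancel_right)
  qed
  \<comment> \<open>Exhaust the two half-lines by a bounded set and a set at positive distance from it. The bound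
    on the first set ensures that the vectors lie in the domain of \<open>T\<close>.\<close>
  have upper: "?F {a<..} (E {..a} x) = 0" for a x
  proof -
    define B where "B n = {- real n..a}" for n
    define C where "C m = {a + 1 / real (Suc m)..}" for m
    have m [measurable]: "B n \<in> sets borel" "C n \<in> sets borel" for n by (auto simp: B_def C_def)
    have Binc: "incseq B" by (auto simp: incseq_def B_def)
    have "C n \<subseteq> C k" if "n \<le> k" for n k
    proof -
      have "1 / real (Suc k) \<le> 1 / real (Suc n)" using that by (intro divide_left_mono) auto
      then show ?thesis by (auto simp: C_def)
    qed
    then have Cinc: "incseq C" by (auto simp: incseq_def)
    have BU: "(\<Union>n. B n) = {..a}"
    proof -
      have "\<exists>n. - real n \<le> t" for t using real_arch_simple[of "- t"] by (metis minus_le_iff)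
      then show ?thesis by (auto simp: B_def)
    qed
    have CU: "(\<Union>n. C n) = {a<..}"
    proof -
      have "\<exists>n. a + 1 / real (Suc n) \<le> t" if "a < t" for t
        using reals_Archimedean[of "t - a"] that by (auto simp: inverse_eq_divide intro: less_imp_le) (smt (verit))
      moreover have "a < t" if "a + 1 / real (Suc n) \<le> t" for n t
      proof -
        have "0 < 1 / real (Suc n)" by simp
        then show ?thesis using that by linarith
      qed
      ultimately show ?thesis unfolding C_def by (auto simp del: of_nat_Suc)
    qed
    have z: "?F (C m) (E (B n) x) = 0" for m n
    proof (rule separated[of "B n" "real n + \<bar>a\<bar>" 1 a _ "C m" "a + 1 / real (Suc m)"])
      show "E (B n) (?F (C m) (E (B n) x)) = ?F (C m) (E (B n) x)"
        by (simp add: commute E.E_idem)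
      show "?F (C m) (?F (C m) (E (B n) x)) = ?F (C m) (E (B n) x)" by (simp add: F.E_idem)
    qed (auto simp: B_def C_def)
    have "?F (C m) (E {..a} x) = 0" for m
    proof -
      have "(\<lambda>n. ?F (C m) (E (B n) x)) \<longlonglongrightarrow> ?F (C m) (E {..a} x)"
        unfolding BU[symmetric]
        by (intro bounded_linear.tendsto[OF F.E_bounded_linear] E.E_incseq m Binc)
      then show ?thesis by (simp add: z LIMSEQ_const_iff)
    qed
    then show ?thesis
      using F.E_incseq[of C "E {..a} x"] Cinc by (simp add: CU LIMSEQ_const_iff)
  qed
  \<comment> \<open>The same argument with the roles of the half-lines exchanged; one exhaustion provides both the
    bound and the distance.\<close>
  have lower: "?F {..a} (E {a<..} x) = 0" for a x
  proof -
    define B where "B n = {a + 1 / real (Suc n)..real n}" for n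
    have m [measurable]: "B n \<in> sets borel" for n by (auto simp: B_def)
    have "B n \<subseteq> B k" if "n \<le> k" for n k
    proof -
      have "1 / real (Suc k) \<le> 1 / real (Suc n)" using that by (intro divide_left_mono) auto
      then show ?thesis using that by (auto simp: B_def)
    qed
    then have Binc: "incseq B" by (auto simp: incseq_def)
    have BU: "(\<Union>n. B n) = {a<..}"
    proof -
      have "\<exists>n. a + 1 / real (Suc n) \<le> t \<and> t \<le> real n" if t: "a < t" for t
      proof -
        obtain n where n: "1 / real (Suc n) < t - a"
          using reals_Archimedean[of "t - a"] t by (auto simp: inverse_eq_divide)
        obtain k where k: "t \<le> real k" using real_arch_simple by blast
        have "1 / real (Suc (max n k)) \<le> 1 / real (Suc n)" by (intro divide_left_mono) auto
        then show ?thesis using n k by (intro exI[of _ "max n k"]) auto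
      qed
      moreover have "a < t" if "a + 1 / real (Suc n) \<le> t" for n t
      proof -
        have "0 < 1 / real (Suc n)" by simp
        then show ?thesis using that by linarith
      qed
      ultimately show ?thesis unfolding B_def by (auto simp del: of_nat_Suc)
    qed
    have z: "?F {..a} (E (B n) x) = 0" for n
    proof (rule separated[of "B n" "real n + \<bar>a\<bar>" "-1" "- (a + 1 / real (Suc n))" _ "{..a}" "- a"])
      show "B n \<subseteq> {- (real n + \<bar>a\<bar>)..real n + \<bar>a\<bar>}"
      proof
        fix t assume "t \<in> B n"
        then have "a + 1 / real (Suc n) \<le> t" "t \<le> real n" by (auto simp: B_def)
        moreover have "0 < 1 / real (Suc n)" by simp
        ultimately have "- (real n + \<bar>a\<bar>) \<le> t" "t \<le> real n + \<bar>a\<bar>" by linarith+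
        then show "t \<in> {- (real n + \<bar>a\<bar>)..real n + \<bar>a\<bar>}" by simp
      qed
      show "E (B n) (?F {..a} (E (B n) x)) = ?F {..a} (E (B n) x)"
        by (simp add: commute E.E_idem)
      show "?F {..a} (?F {..a} (E (B n) x)) = ?F {..a} (E (B n) x)" by (simp add: F.E_idem)
    qed (auto simp: B_def)
    have "(\<lambda>n. ?F {..a} (E (B n) x)) \<longlonglongrightarrow> ?F {..a} (E {a<..} x)"
      unfolding BU[symmetric]
      by (intro bounded_linear.tendsto[OF F.E_bounded_linear] E.E_incseq m Binc) simp
    then show ?thesis by (simp add: z LIMSEQ_const_iff)
  qed
  have half: "E {..a} x = ?F {..a} x" for a x
  proof -
    have c: "- {..a} = {a<..}" by auto
    have "?F {..a} x = ?F {..a} (E {..a} x) + ?F {..a} (E {a<..} x)"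
      using E.E_Compl[of "{..a}" x] by (simp add: c flip: F.E_add)
    also have "\<dots> = E {..a} x - ?F {a<..} (E {..a} x)"
      using F.E_Compl[of "{..a}" "E {..a} x"] by (simp add: lower c)
    finally show ?thesis by (simp add: upper)
  qed
  have borel: "E B x = ?F B x" if "B \<in> sets borel" for B x
  proof -
    have "Int_stable (range (atMost :: real \<Rightarrow> real set))"
      by (auto simp: Int_stable_def)
    moreover have "range (atMost :: real \<Rightarrow> real set) \<subseteq> Pow UNIV" by auto
    moreover have "B \<in> sigma_sets UNIV (range (atMost :: real \<Rightarrow> real set))"
      using that by (simp add: borel_eq_atMost)
    ultimately show ?thesis
    proof (induction rule: sigma_sets_induct_disjoint)
      case (basic A)
      then show ?case using half by auto
    next
      case empty
      show ?case by (simp add: E.E_empty F.E_empty)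
    next
      case (compl A)
      have "A \<in> sets borel" using compl by (simp add: borel_eq_atMost)
      then show ?case using compl.IH E.E_Compl[of A x] F.E_Compl[of A x] by (simp add: Compl_eq_Diff_UNIV)
    next
      case (union A)
      have "range A \<subseteq> sets borel" using union by (auto simp: borel_eq_atMost)
      then show ?case
        using E.E_sums[of A x] F.E_sums[of A x] union by (simp add: sums_unique2)
    qed
  qed
  have "E B x = ?F B x" for B x
    using borel E(1) by (cases "B \<in> sets borel") (auto simp: spectral_family_def proj_valued_measure_def)
  then show ?thesis by (intro ext)
qed

theorem resolution_of_identity_eq: "resolution_of_identity T = spectral_family"
  unfolding resolution_of_identity_def
  by (rule the_equality) (auto intro: pvm_spectral_family F.integral resolution_unique)

theorem borel_calculus_eq:
  assumes "f \<in> borel_measurable borel"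
  shows "borel_calculus f T = fgraph (f \<circ> unresolvent)"
  unfolding borel_calculus_def resolution_of_identity_eq
  using assms by (intro spectral_integral_eq is_spectral_integral_fgraph) (auto simp: Domain_fgraph intro!: fdom_dense)

end

section \<open>Square roots and commuting resolvents\<close>

context positive_selfadjoint
begin

text \<open>The range criterion for selfadjointness: if \<open>T\<^sup>* y = z\<close>, then \<open>u = (1 + T)\<^sup>-\<^sup>1 (y + z)\<close> differs from \<open>y\<close>
  by a vector orthogonal to the range of \<open>1 + T\<close>.\<close>
lemma adj_subset: "adj T \<subseteq> T"
proof
  fix p assume "p \<in> adj T"
  then obtain y z where p: "p = (y, z)" and yz: "\<And>x w. (x, w) \<in> T \<Longrightarrow> cinner y w = cinner z x"
    by (cases p) (auto simp: adj_def)
  define u where "u = resolvent (y + z)"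
  have uT: "(u, y + z - u) \<in> T" unfolding u_def by (rule resolvent_mem)
  have "cinner (y - u) v = 0" for v
  proof -
    have "cinner u (v - resolvent v) = cinner (y + z - u) (resolvent v)" by (rule symmetric[OF uT resolvent_mem])
    moreover have "cinner y (v - resolvent v) = cinner z (resolvent v)" by (rule yz[OF resolvent_mem])
    ultimately show ?thesis
      by (simp add: cinner_diff_left cinner_diff_right cinner_add_left diff_eq_eq add.commute)
  qed
  from this[of "y - u"] have "y = u" by (simp add: cinner_self)
  then show "p \<in> T" using uT by (simp add: p)
qed

lemma sqrt_measurable [measurable]: "sqrt \<circ> unresolvent \<in> borel_measurable borel"
  by measurable

text \<open>The preimage of \<open>z\<close> under \<open>1 + \<surd>T\<close> is \<open>g(T) z\<close> for the bounded function \<open>g(t) = 1 / (1 + \<surd>t)\<close>.\<close>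
lemma positive_selfadjoint_sqrt: "positive_selfadjoint (fgraph (sqrt \<circ> unresolvent))"
proof
  show "linear_op (fgraph (sqrt \<circ> unresolvent))" by (rule linear_op_fgraph) simp
  show "cinner x v = cinner y u" if "(x, y) \<in> fgraph (sqrt \<circ> unresolvent)" "(u, v) \<in> fgraph (sqrt \<circ> unresolvent)" for x y u v
    using that fcalc_sym[OF sqrt_measurable] by (auto simp: fgraph_def)
  show "0 \<le> inner x y" if "(x, y) \<in> fgraph (sqrt \<circ> unresolvent)" for x y
  proof -
    have "cinner x y = of_real (\<integral>t. (sqrt \<circ> unresolvent) t \<partial>\<mu> x)"
      using that cinner_fcalc(2)[OF sqrt_measurable, of x] by (auto simp: fgraph_def)
    then have "inner x y = (\<integral>t. (sqrt \<circ> unresolvent) t \<partial>\<mu> x)" by (simp flip: Re_cinner)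
    also have "\<dots> \<ge> 0" by (rule Bochner_Integration.integral_nonneg) (simp add: unresolvent_nonneg)
    finally show ?thesis .
  qed
  show "\<exists>x. (x, z - x) \<in> fgraph (sqrt \<circ> unresolvent)" for z
  proof
    define g where "g t = 1 / (1 + sqrt (unresolvent t))" for t
    have g [measurable]: "g \<in> borel_measurable borel" unfolding g_def by measurable
    have pos: "0 < 1 + sqrt (unresolvent t)" for t using unresolvent_nonneg[of t] by (simp add: add_pos_nonneg)
    have gd: "z \<in> fdom g"
      using pos unresolvent_nonneg by (intro fdom_bounded[where B = 1]) (auto simp: g_def)
    have prod: "(sqrt \<circ> unresolvent) t * g t = 1 - g t" for t
      using pos[of t] by (simp add: g_def field_simps)
    have d1: "z \<in> fdom (\<lambda>t. 1 - g t)" "fcalc (\<lambda>t. 1 - g t) z = z - fcalc g z"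
      using fcalc_diff_fun[OF _ fcalc_one(1) g gd] fcalc_one(2)[of z] by auto
    have d: "z \<in> fdom (\<lambda>t. (sqrt \<circ> unresolvent) t * g t)" unfolding prod by (rule d1)
    have "fcalc (sqrt \<circ> unresolvent) (fcalc g z) = z - fcalc g z"
      using fcalc_fcalc(2)[OF sqrt_measurable g gd d] d1(2) unfolding prod by (simp only:)
    moreover have "fcalc g z \<in> fdom (sqrt \<circ> unresolvent)" using fcalc_fcalc(1)[OF sqrt_measurable g gd] d by simp
    ultimately show "(fcalc g z, z - fcalc g z) \<in> fgraph (sqrt \<circ> unresolvent)" by (auto simp: fgraph_def)
  qed
qed

text \<open>The domains agree because square-integrability of \<open>t\<close> for a finite measure implies that of \<open>\<surd>t\<close>.\<close>
lemma fgraph_sqrt_square: "fgraph (sqrt \<circ> unresolvent) \<odot> fgraph (sqrt \<circ> unresolvent) = T"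
proof -
  have sq: "(\<lambda>t. (sqrt \<circ> unresolvent) t * (sqrt \<circ> unresolvent) t) = unresolvent" using unresolvent_nonneg by auto
  have sq2: "((sqrt \<circ> unresolvent) t)\<^sup>2 = unresolvent t" for t using unresolvent_nonneg by simp
  have sub: "x \<in> fdom (sqrt \<circ> unresolvent)" if "x \<in> fdom unresolvent" for x
    using cinner_fcalc(1)[OF unresolvent_measurable that] unfolding fdom_def sq2 by simp
  have iff: "x \<in> fdom (sqrt \<circ> unresolvent) \<Longrightarrow> fcalc (sqrt \<circ> unresolvent) x \<in> fdom (sqrt \<circ> unresolvent) \<longleftrightarrow> x \<in> fdom unresolvent"
     "x \<in> fdom (sqrt \<circ> unresolvent) \<Longrightarrow> x \<in> fdom unresolvent \<Longrightarrow> fcalc (sqrt \<circ> unresolvent) (fcalc (sqrt \<circ> unresolvent) x) = fcalc unresolvent x" for x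
    using fcalc_fcalc[OF sqrt_measurable sqrt_measurable, of x] unfolding sq by auto
  have "fgraph (sqrt \<circ> unresolvent) \<odot> fgraph (sqrt \<circ> unresolvent) = fgraph unresolvent"
    unfolding op_comp_def fgraph_def using iff sub by (auto simp: relcomp_unfold)
  then show ?thesis by (simp flip: T_eq_fgraph)
qed

end

lemma resolvents_commute_imp_spectral:
  assumes U: "positive_selfadjoint U" and V: "positive_selfadjoint V"
    and comm: "\<And>x. positive_selfadjoint.resolvent U (positive_selfadjoint.resolvent V x) = positive_selfadjoint.resolvent V (positive_selfadjoint.resolvent U x)"
  shows "spectral_projections_commute U V"
proof -
  interpret U: positive_selfadjoint U by (rule U)
  interpret V: positive_selfadjoint V by (rule V)
  have 1: "U.resolvent (V.spectral_family C x) = V.spectral_family C (U.resolvent x)" if C: "C \<in> sets borel" for C x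
  proof -
    interpret intertwining V.resolvent V.resolvent U.resolvent
      by (intro intertwining.intro intertwining_axioms.intro V.positive_contraction_axioms U.C_bounded_linear comm)
    show ?thesis using S_fcalc[of "indicator (unresolvent -` C)" x] C by (simp add: V.spectral_family_def V.fdom_indicator V.unresolvent_vimage)
  qed
  have 2: "V.spectral_family C (U.spectral_family B x) = U.spectral_family B (V.spectral_family C x)"
    if B: "B \<in> sets borel" and C: "C \<in> sets borel" for B C x
  proof -
    interpret intertwining U.resolvent U.resolvent "V.spectral_family C"
      by (intro intertwining.intro intertwining_axioms.intro U.positive_contraction_axioms V.F.E_bounded_linear C
          1[OF C, symmetric])
    show ?thesis using S_fcalc[of "indicator (unresolvent -` B)" x] B by (simp add: U.spectral_family_def U.fdom_indicator U.unresolvent_vimage)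
  qed
  show ?thesis
    unfolding spectral_projections_commute_def U.resolution_of_identity_eq V.resolution_of_identity_eq
    using 2 by (auto simp: fun_eq_iff)
qed

lemma (in positive_selfadjoint) commute_sqrt_resolvent:
  assumes P: "bounded_linear P" and comm: "\<And>x. P (resolvent x) = resolvent (P x)"
  shows "P (positive_selfadjoint.resolvent (fgraph (sqrt \<circ> unresolvent)) z) = positive_selfadjoint.resolvent (fgraph (sqrt \<circ> unresolvent)) (P z)"
proof -
  interpret Q: positive_selfadjoint "fgraph (sqrt \<circ> unresolvent)" by (rule positive_selfadjoint_sqrt)
  interpret intertwining resolvent resolvent P
    by (intro intertwining.intro intertwining_axioms.intro positive_contraction_axioms P comm)
  have "(Q.resolvent z, z - Q.resolvent z) \<in> fgraph (sqrt \<circ> unresolvent)" by (rule Q.resolvent_mem)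
  then have d: "Q.resolvent z \<in> fdom (sqrt \<circ> unresolvent)" and e: "z - Q.resolvent z = fcalc (sqrt \<circ> unresolvent) (Q.resolvent z)"
    by (auto simp: fgraph_def)
  have "P z - P (Q.resolvent z) = P (z - Q.resolvent z)" using P by (simp add: bounded_linear.linear linear_diff)
  also have "\<dots> = fcalc (sqrt \<circ> unresolvent) (P (Q.resolvent z))" unfolding e by (rule S_fcalc[OF sqrt_measurable d])
  finally have "(P (Q.resolvent z), P z - P (Q.resolvent z)) \<in> fgraph (sqrt \<circ> unresolvent)"
    using S_fdom[OF sqrt_measurable d] by (simp add: fgraph_def)
  then show ?thesis by (rule Q.resolvent_eq'[symmetric])
qed

section \<open>Adjoints, closures and products of unbounded operators\<close>

text \<open>A positive operator for which \<open>1 + T\<close> is onto has no proper positive extension, because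
  \<open>1 + T'\<close> is injective for any such extension \<open>T'\<close>. All equalities of unbounded operators, domains included, are
  obtained in this way.\<close>
lemma positive_maximal:
  assumes T: "linear_op T'" "\<And>x y. (x, y) \<in> T' \<Longrightarrow> 0 \<le> inner x y"
    and sub: "T \<subseteq> T'" and onto: "\<And>z. \<exists>x. (x, z - x) \<in> T"
  shows "T = T'"
proof (intro antisym sub subsetI)
  fix p assume p: "p \<in> T'"
  obtain x y where xy: "p = (x, y)" by (cases p)
  obtain u where u: "(u, x + y - u) \<in> T" using onto by blast
  have "x = u"
    by (rule positive_injective[OF T, of x y u "x + y - u"]) (use p u sub xy in auto)
  then show "p \<in> T" using u xy by simp
qed

lemma adjD: "(y, z) \<in> adj T \<Longrightarrow> (x, w) \<in> T \<Longrightarrow> cinner y w = cinner z x"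
  by (auto simp: adj_def)

lemma adjD': "(y, z) \<in> adj T \<Longrightarrow> (x, w) \<in> T \<Longrightarrow> cinner w y = cinner x z"
  using adjD[of y z T x w] cinner_commute[of w y] cinner_commute[of x z] by simp

lemma adjI: "(\<And>x w. (x, w) \<in> T \<Longrightarrow> cinner y w = cinner z x) \<Longrightarrow> (y, z) \<in> adj T"
  by (auto simp: adj_def)

lemma linear_op_adj:
  assumes "closure (Domain T) = UNIV"
  shows "linear_op (adj T)"
  unfolding linear_op_def
proof (intro conjI allI impI)
  show "single_valued (adj T)"
  proof (rule single_valuedI)
    fix y z z' assume yz: "(y, z) \<in> adj T" "(y, z') \<in> adj T"
    have "cinner x (z - z') = 0" if "x \<in> Domain T" for x
    proof -
      obtain w where "(x, w) \<in> T" using \<open>x \<in> Domain T\<close> by blast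
      then show ?thesis using adjD'[OF yz(1)] adjD'[OF yz(2)] by (simp add: cinner_diff_right)
    qed
    then show "z = z'" using orthogonal_dense_zero[OF assms, of "z - z'"] by simp
  qed
  show "(0, 0) \<in> adj T" by (rule adjI) simp
  show "(x + u, y + v) \<in> adj T" if "(x, y) \<in> adj T" "(u, v) \<in> adj T" for x y u v
    by (rule adjI) (simp add: cinner_add_left adjD[OF that(1)] adjD[OF that(2)])
  show "(scaleC c x, scaleC c y) \<in> adj T" if "(x, y) \<in> adj T" for c x y
    by (rule adjI) (simp add: cinner_scaleC_left adjD[OF that])
qed

lemma closed_pairI:
  fixes T :: "('a::metric_space \<times> 'a) set"
  assumes "\<And>x y a b. (\<And>n. (x n, y n) \<in> T) \<Longrightarrow> x \<longlonglongrightarrow> a \<Longrightarrow> y \<longlonglongrightarrow> b \<Longrightarrow> (a, b) \<in> T"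
  shows "closed T"
  unfolding closed_sequential_limits
proof (intro allI impI)
  fix s l assume s: "(\<forall>n. s n \<in> T) \<and> s \<longlonglongrightarrow> l"
  then have "(\<lambda>n. fst (s n)) \<longlonglongrightarrow> fst l" "(\<lambda>n. snd (s n)) \<longlonglongrightarrow> snd l"
    by (auto intro: tendsto_fst tendsto_snd)
  moreover have "(fst (s n), snd (s n)) \<in> T" for n using s by simp
  ultimately have "(fst l, snd l) \<in> T" by (rule assms[rotated])
  then show "l \<in> T" by simp
qed

lemma closed_pairD:
  fixes T :: "('a::metric_space \<times> 'a) set"
  assumes "closed T" "\<And>n. (x n, y n) \<in> T" "x \<longlonglongrightarrow> a" "y \<longlonglongrightarrow> b"
  shows "(a, b) \<in> T"
  using closed_sequentially[OF assms(1), of "\<lambda>n. (x n, y n)"] assms(2-4) by (auto intro: tendsto_Pair)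

lemma closure_pair:
  fixes T :: "('a::metric_space \<times> 'a) set"
  assumes "(a, b) \<in> closure T"
  shows "\<exists>x y. (\<forall>n. (x n, y n) \<in> T) \<and> x \<longlonglongrightarrow> a \<and> y \<longlonglongrightarrow> b"
proof -
  obtain s where s: "\<And>n. s n \<in> T" "s \<longlonglongrightarrow> (a, b)" using assms unfolding closure_sequential by blast
  show ?thesis
    by (intro exI[of _ "\<lambda>n. fst (s n)"] exI[of _ "\<lambda>n. snd (s n)"])
       (use s tendsto_fst[OF s(2)] tendsto_snd[OF s(2)] in auto)
qed

lemma closed_adj: "closed (adj T)"
proof (rule closed_pairI)
  fix y z a b assume yz: "\<And>n. (y n, z n) \<in> adj T" and lim: "y \<longlonglongrightarrow> a" "z \<longlonglongrightarrow> b"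
  show "(a, b) \<in> adj T"
  proof (rule adjI)
    fix x w assume xw: "(x, w) \<in> T"
    have "(\<lambda>n. cinner (y n) w) \<longlonglongrightarrow> cinner a w" "(\<lambda>n. cinner (z n) x) \<longlonglongrightarrow> cinner b x"
      by (intro tendsto_cinner lim tendsto_const)+
    then show "cinner a w = cinner b x"
      using adjD[OF yz xw] by (simp add: LIMSEQ_unique)
  qed
qed

lemma adj_closure: "adj T \<subseteq> adj (closure T)"
proof
  fix p assume p: "p \<in> adj T"
  obtain y z where yz: "p = (y, z)" by (cases p)
  have "(y, z) \<in> adj (closure T)"
  proof (rule adjI)
    fix a b assume "(a, b) \<in> closure T"
    then obtain x w where xw: "\<And>n. (x n, w n) \<in> T" and lim: "x \<longlonglongrightarrow> a" "w \<longlonglongrightarrow> b" using closure_pair by metis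
    have "(\<lambda>n. cinner y (w n)) \<longlonglongrightarrow> cinner y b" "(\<lambda>n. cinner z (x n)) \<longlonglongrightarrow> cinner z a"
      by (intro tendsto_cinner lim tendsto_const)+
    then show "cinner y b = cinner z a"
      using adjD[OF p[unfolded yz] xw] by (simp add: LIMSEQ_unique)
  qed
  then show "p \<in> adj (closure T)" by (simp add: yz)
qed

lemma linear_op_comp: "linear_op S \<Longrightarrow> linear_op T \<Longrightarrow> linear_op (S \<odot> T)"
  unfolding op_comp_def
  by (subst linear_op_def)
     (auto simp: relcomp_unfold single_valued_def intro: linear_op_zero linear_op_add linear_op_scale dest: linear_op_single)

text \<open>Ordinarily a product of closed operators need not be closed. For formally adjoint \<open>S\<close> and \<open>T\<close> the
  identity \<open>\<parallel>T x\<parallel>\<^sup>2 = \<langle>x, S T x\<rangle>\<close> forces the intermediate vectors to converge.\<close>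
lemma closed_comp:
  assumes lin: "linear_op S" "linear_op T" and cl: "closed S" "closed T"
    and formal: "\<And>x y u v. (x, y) \<in> T \<Longrightarrow> (u, v) \<in> S \<Longrightarrow> cinner y u = cinner x v"
  shows "closed (S \<odot> T)"
proof (rule closed_pairI)
  fix x z a b assume xz: "\<And>n. (x n, z n) \<in> S \<odot> T" and lim: "x \<longlonglongrightarrow> a" "z \<longlonglongrightarrow> b"
  obtain y where T: "\<And>n. (x n, y n) \<in> T" and S: "\<And>n. (y n, z n) \<in> S"
  proof -
    have "\<forall>n. \<exists>y. (x n, y) \<in> T \<and> (y, z n) \<in> S"
      using xz unfolding op_comp_def relcomp_unfold by auto
    then have "\<exists>y. \<forall>n. (x n, y n) \<in> T \<and> (y n, z n) \<in> S" by (rule choice)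
    then show ?thesis using that by blast
  qed
  have bound: "(norm (y m - y n))\<^sup>2 \<le> norm (x m - x n) * norm (z m - z n)" for m n
  proof -
    have "cinner (y m - y n) (y m - y n) = cinner (x m - x n) (z m - z n)"
      by (intro formal[of "x m - x n"] linear_op_diff lin T S)
    then have "(norm (y m - y n))\<^sup>2 = inner (x m - x n) (z m - z n)"
      by (simp add: power2_norm_eq_inner flip: Re_cinner)
    then show ?thesis using norm_cauchy_schwarz by metis
  qed
  have "Cauchy y"
  proof (rule CauchyI)
    fix e :: real assume e: "e > 0"
    have "Cauchy x" "Cauchy z" using lim by (auto intro: LIMSEQ_imp_Cauchy)
    then obtain M N where M: "\<And>m n. m \<ge> M \<Longrightarrow> n \<ge> M \<Longrightarrow> norm (x m - x n) < e"
      and N: "\<And>m n. m \<ge> N \<Longrightarrow> n \<ge> N \<Longrightarrow> norm (z m - z n) < e"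
      using e by (metis CauchyD)
    have "norm (y m - y n) < e" if "m \<ge> max M N" "n \<ge> max M N" for m n
    proof -
      have "(norm (y m - y n))\<^sup>2 \<le> norm (x m - x n) * norm (z m - z n)" by (rule bound)
      also have "\<dots> < e * e"
        using M[of m n] N[of m n] that by (intro mult_strict_mono') auto
      finally have "(norm (y m - y n))\<^sup>2 < e\<^sup>2" by (simp add: power2_eq_square)
      then show ?thesis using e by (intro power_less_imp_less_base[of _ 2 e]) auto
    qed
    then show "\<exists>M. \<forall>m\<ge>M. \<forall>n\<ge>M. norm (y m - y n) < e" by blast
  qed
  then obtain c where c: "y \<longlonglongrightarrow> c" using Cauchy_convergent convergent_def by blast
  have "(a, c) \<in> T" by (rule closed_pairD[OF cl(2) T lim(1) c])
  moreover have "(c, b) \<in> S" by (rule closed_pairD[OF cl(1) S c lim(2)])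
  ultimately show "(a, b) \<in> S \<odot> T" by (auto simp: op_comp_def)
qed

lemma linear_op_closure:
  assumes T: "linear_op T" and sub: "closure T \<subseteq> U" and U: "linear_op U"
  shows "linear_op (closure T)"
  unfolding linear_op_def
proof (intro conjI allI impI)
  show "single_valued (closure T)"
    using sub U by (auto simp: single_valued_def dest: linear_op_single)
  show "(0, 0) \<in> closure T" using linear_op_zero[OF T] closure_subset by blast
  fix x y assume "(x, y) \<in> closure T"
  then obtain a b where ab: "\<And>n. (a n, b n) \<in> T" "a \<longlonglongrightarrow> x" "b \<longlonglongrightarrow> y" using closure_pair by metis
  show "(scaleC c x, scaleC c y) \<in> closure T" for c
    unfolding closure_sequential
    by (intro exI[of _ "\<lambda>n. (scaleC c (a n), scaleC c (b n))"] conjI allI tendsto_Pair tendsto_scaleC linear_op_scale T ab)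
  fix u v assume "(u, v) \<in> closure T"
  then obtain a' b' where ab': "\<And>n. (a' n, b' n) \<in> T" "a' \<longlonglongrightarrow> u" "b' \<longlonglongrightarrow> v" using closure_pair by metis
  show "(x + u, y + v) \<in> closure T"
    unfolding closure_sequential
    by (intro exI[of _ "\<lambda>n. (a n + a' n, b n + b' n)"] conjI allI tendsto_Pair tendsto_add linear_op_add T ab ab')
qed

text \<open>The bound \<open>\<parallel>x\<parallel> \<le> \<parallel>x + T x\<parallel>\<close> makes the range of \<open>1 + T\<close> closed, so it is everything as soon as
  nothing is orthogonal to it.\<close>
lemma positive_onto:
  assumes T: "linear_op (T :: 'a::complex_hilbert oper)" "closed T" and pos: "\<And>x y. (x, y) \<in> T \<Longrightarrow> 0 \<le> inner x y"
    and orth: "\<And>y. (\<And>x w. (x, w) \<in> T \<Longrightarrow> cinner (x + w) y = 0) \<Longrightarrow> y = 0"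
  shows "\<exists>x. (x, z - x) \<in> (T :: 'a::complex_hilbert oper)"
proof -
  define M where "M = {x + w | x w. (x, w) \<in> T}"
  have sub: "csubspace M"
    unfolding csubspace_def
  proof (intro conjI ballI allI)
    have "0 = 0 + (0 :: 'a)" by simp
    then show "0 \<in> M" using linear_op_zero[OF T(1)] unfolding M_def by blast
  next
    fix a b assume "a \<in> M" "b \<in> M"
    then obtain x w u v where "(x, w) \<in> T" "(u, v) \<in> T" "a = x + w" "b = u + v" by (auto simp: M_def)
    then have "(x + u, w + v) \<in> T" "a + b = (x + u) + (w + v)"
      by (auto intro: linear_op_add[OF T(1)])
    then show "a + b \<in> M" unfolding M_def by blast
  next
    fix c a assume "a \<in> M"
    then obtain x w where "(x, w) \<in> T" "a = x + w" by (auto simp: M_def)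
    then have "(scaleC c x, scaleC c w) \<in> T" "scaleC c a = scaleC c x + scaleC c w"
      by (auto intro: linear_op_scale[OF T(1)] simp: scaleC_add_right)
    then show "scaleC c a \<in> M" unfolding M_def by blast
  qed
  have bound: "norm x \<le> norm (x + w)" if "(x, w) \<in> T" for x w
  proof -
    have "(norm x)\<^sup>2 \<le> inner x (x + w)" using pos[OF that] by (simp add: inner_add_right power2_norm_eq_inner)
    also have "\<dots> \<le> norm x * norm (x + w)" by (rule norm_cauchy_schwarz)
    finally show ?thesis by (cases "x = 0") (auto simp: power2_eq_square)
  qed
  have "closed M"
    unfolding closed_sequential_limits
  proof (intro allI impI)
    fix s l assume s: "(\<forall>n. s n \<in> M) \<and> s \<longlonglongrightarrow> l"
    have "\<exists>x. (x, s n - x) \<in> T" for n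
    proof -
      obtain x w where "s n = x + w" "(x, w) \<in> T" using s unfolding M_def by blast
      then show ?thesis by (intro exI[of _ x]) simp
    qed
    then obtain x where x: "\<And>n. (x n, s n - x n) \<in> T" by metis
    have "norm (x m - x n) \<le> norm (s m - s n)" for m n
      using bound[OF linear_op_diff[OF T(1) x x], of m n] by simp
    moreover have "Cauchy s" using s by (auto intro: LIMSEQ_imp_Cauchy)
    ultimately have "Cauchy x"
      unfolding Cauchy_iff by (meson le_less_trans)
    then obtain a where a: "x \<longlonglongrightarrow> a" using Cauchy_convergent convergent_def by blast
    have "(a, l - a) \<in> T"
      using s by (intro closed_pairD[OF T(2) x a] tendsto_diff a) auto
    moreover have "l = a + (l - a)" by simp
    ultimately show "l \<in> M" unfolding M_def by blast
  qed
  moreover have "closure M = UNIV"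
    by (rule dense_if_no_orthogonal[OF sub]) (auto simp: M_def intro!: orth)
  ultimately have "z \<in> M" by (simp add: closure_closed)
  then obtain x w where "z = x + w" "(x, w) \<in> T" unfolding M_def by blast
  then show ?thesis by (intro exI[of _ x]) simp
qed

lemma linear_op_restrict:
  assumes T: "linear_op T" and K: "csubspace K"
  shows "linear_op (op_restrict T K)"
  unfolding linear_op_def
proof (intro conjI allI impI)
  show "single_valued (op_restrict T K)"
    by (auto simp: op_restrict_def single_valued_def intro: linear_op_single[OF T])
  show "(0, 0) \<in> op_restrict T K"
    using linear_op_zero[OF T] K by (simp add: op_restrict_def csubspace_def)
  show "(x + u, y + v) \<in> op_restrict T K" if "(x, y) \<in> op_restrict T K" "(u, v) \<in> op_restrict T K" for x y u v
    using that linear_op_add[OF T] K by (simp add: op_restrict_def csubspace_def)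
  show "(scaleC c x, scaleC c y) \<in> op_restrict T K" if "(x, y) \<in> op_restrict T K" for c x y
    using that linear_op_scale[OF T] K by (simp add: op_restrict_def csubspace_def)
qed

lemma Id_plus_mem: "(x, w) \<in> Id \<oplus> complex_of_real q \<cdot> T \<longleftrightarrow> (\<exists>z. (x, z) \<in> T \<and> w = x + q *\<^sub>R z)"
  by (auto simp: op_add_def op_scale_def scaleC_of_real)

section \<open>The relations as identities of selfadjoint operators\<close>

text \<open>The data of a well-behaved representation with its invariant domain \<open>K\<close> fixed. In the comments,
  \<open>N\<^sub>i\<close> stands for \<open>A\<^sub>i A\<^sub>i\<^sup>*\<close> and \<open>\<Delta>\<close> for the sum of the \<open>A\<^sub>i\<^sup>* A\<^sub>i\<close>.\<close>
locale operator_family =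
  fixes q :: real and n :: nat and A :: "nat \<Rightarrow> 'a::complex_hilbert oper" and K :: "'a set"
  assumes q_pos: "0 < q"
    and lin: "i \<in> {1..n} \<Longrightarrow> linear_op (A i)"
    and cl: "i \<in> {1..n} \<Longrightarrow> closed (A i)"
    and K_subspace: "csubspace K" and K_dense: "closure K = UNIV"
    and K_inv: "i \<in> {1..n} \<Longrightarrow> invariant_under K (A i)"
    and K_inv_adj: "i \<in> {1..n} \<Longrightarrow> invariant_under K (adj (A i))"
    and rel: "i \<in> {1..n} \<Longrightarrow> op_restrict (adj (A i) \<odot> A i) K =
           op_restrict (Id \<oplus> complex_of_real q \<cdot> (A i \<odot> adj (A i))) K"
    and rel_off: "i \<in> {1..n} \<Longrightarrow> j \<in> {1..n} \<Longrightarrow> i \<noteq> j \<Longrightarrow>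
           op_restrict (adj (A i) \<odot> A j) K = op_restrict (0 \<cdot> Id) K"
    and esa: "ess_selfadjoint_on (op_sum (\<lambda>i. adj (A i) \<odot> A i) {1..n}) K"
begin

lemma dense_Domain: "i \<in> {1..n} \<Longrightarrow> closure (Domain (A i)) = UNIV"
  using K_inv[of i] K_dense closure_mono[of K "Domain (A i)"] by (auto simp: invariant_under_def)

lemma lin_adj: "i \<in> {1..n} \<Longrightarrow> linear_op (adj (A i))"
  by (intro linear_op_adj dense_Domain)

lemma adj_A_A: "i \<in> {1..n} \<Longrightarrow> linear_op (adj (A i) \<odot> A i)" "i \<in> {1..n} \<Longrightarrow> closed (adj (A i) \<odot> A i)"
proof -
  assume i: "i \<in> {1..n}"
  show "linear_op (adj (A i) \<odot> A i)" by (intro linear_op_comp lin lin_adj i)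
  show "closed (adj (A i) \<odot> A i)"
    by (intro closed_comp lin lin_adj cl closed_adj i) (rule adjD')
qed

lemma A_adj_A: "i \<in> {1..n} \<Longrightarrow> linear_op (A i \<odot> adj (A i))" "i \<in> {1..n} \<Longrightarrow> closed (A i \<odot> adj (A i))"
proof -
  assume i: "i \<in> {1..n}"
  show "linear_op (A i \<odot> adj (A i))" by (intro linear_op_comp lin lin_adj i)
  show "closed (A i \<odot> adj (A i))"
    by (intro closed_comp lin lin_adj cl closed_adj i) (rule adjD[symmetric])
qed

lemma adj_A_A_form:
  assumes "(x, w) \<in> adj (A i) \<odot> A i"
  shows "0 \<le> inner x w"
proof -
  obtain y where "(x, y) \<in> A i" "(y, w) \<in> adj (A i)" using assms by (auto simp: op_comp_def)
  then have "cinner x w = cinner y y" using adjD' by metis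
  then have "inner x w = (norm y)\<^sup>2" by (simp add: power2_norm_eq_inner flip: Re_cinner)
  then show ?thesis by simp
qed

lemma A_adj_A_form:
  assumes "(x, w) \<in> A i \<odot> adj (A i)"
  shows "\<exists>y. (x, y) \<in> adj (A i) \<and> inner x w = (norm y)\<^sup>2"
proof -
  obtain y where y: "(x, y) \<in> adj (A i)" "(y, w) \<in> A i" using assms by (auto simp: op_comp_def)
  then have "cinner x w = cinner y y" using adjD by metis
  then show ?thesis using y by (intro exI[of _ y]) (simp add: power2_norm_eq_inner flip: Re_cinner)
qed

definition act where "act i x = op_val (A i) x"
definition act_adj where "act_adj i x = op_val (adj (A i)) x"

lemma act_K: "i \<in> {1..n} \<Longrightarrow> x \<in> K \<Longrightarrow> (x, act i x) \<in> A i" "i \<in> {1..n} \<Longrightarrow> x \<in> K \<Longrightarrow> act i x \<in> K"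
proof -
  assume i: "i \<in> {1..n}" and x: "x \<in> K"
  show "(x, act i x) \<in> A i"
    unfolding act_def using K_inv[OF i] x by (intro op_val_mem lin i) (auto simp: invariant_under_def)
  then show "act i x \<in> K" using K_inv[OF i] x by (auto simp: invariant_under_def)
qed

lemma act_adj_K: "i \<in> {1..n} \<Longrightarrow> x \<in> K \<Longrightarrow> (x, act_adj i x) \<in> adj (A i)" "i \<in> {1..n} \<Longrightarrow> x \<in> K \<Longrightarrow> act_adj i x \<in> K"
proof -
  assume i: "i \<in> {1..n}" and x: "x \<in> K"
  show "(x, act_adj i x) \<in> adj (A i)"
    unfolding act_adj_def using K_inv_adj[OF i] x by (intro op_val_mem lin_adj i) (auto simp: invariant_under_def)
  then show "act_adj i x \<in> K" using K_inv_adj[OF i] x by (auto simp: invariant_under_def)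
qed

lemma act_adj_act:
  assumes i: "i \<in> {1..n}" and x: "x \<in> K"
  shows "act_adj i (act i x) = x + q *\<^sub>R act i (act_adj i x)"
proof -
  have "(x, act_adj i (act i x)) \<in> op_restrict (adj (A i) \<odot> A i) K"
    using act_K[OF i x] act_adj_K(1)[OF i act_K(2)[OF i x]] x by (auto simp: op_restrict_def op_comp_def)
  then have "(x, act_adj i (act i x)) \<in> Id \<oplus> complex_of_real q \<cdot> (A i \<odot> adj (A i))"
    unfolding rel[OF i] by (simp add: op_restrict_def)
  then obtain z where z: "(x, z) \<in> A i \<odot> adj (A i)" "act_adj i (act i x) = x + q *\<^sub>R z"
    unfolding Id_plus_mem by blast
  have "(x, act i (act_adj i x)) \<in> A i \<odot> adj (A i)"
    using act_adj_K[OF i x] act_K(1)[OF i act_adj_K(2)[OF i x]] by (auto simp: op_comp_def)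
  then show ?thesis using linear_op_single[OF A_adj_A(1)[OF i] z(1)] z(2) by simp
qed

lemma act_adj_act_off:
  assumes i: "i \<in> {1..n}" and j: "j \<in> {1..n}" and ij: "i \<noteq> j" and x: "x \<in> K"
  shows "(act j x, 0) \<in> adj (A i)" "act_adj i (act j x) = 0"
proof -
  have m: "(act j x, act_adj i (act j x)) \<in> adj (A i)" by (intro act_adj_K(1) i act_K(2) j x)
  then have "(x, act_adj i (act j x)) \<in> op_restrict (adj (A i) \<odot> A j) K"
    using act_K[OF j x] x by (auto simp: op_restrict_def op_comp_def)
  then show "act_adj i (act j x) = 0"
    unfolding rel_off[OF i j ij] by (auto simp: op_restrict_def op_scale_def)
  then show "(act j x, 0) \<in> adj (A i)" using m by simp
qed

definition core_product where "core_product i = op_restrict (adj (A i) \<odot> A i) K"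

lemma core_product_mem: "i \<in> {1..n} \<Longrightarrow> (x, w) \<in> core_product i \<longleftrightarrow> x \<in> K \<and> w = act_adj i (act i x)"
proof -
  assume i: "i \<in> {1..n}"
  have m: "(x, act_adj i (act i x)) \<in> adj (A i) \<odot> A i" if "x \<in> K"
    using act_K[OF i that] act_adj_K(1)[OF i act_K(2)[OF i that]] by (auto simp: op_comp_def)
  show ?thesis
    unfolding core_product_def op_restrict_def using m linear_op_single[OF adj_A_A(1)[OF i], of x] by auto
qed

lemma closure_core_product_subset: "i \<in> {1..n} \<Longrightarrow> closure (core_product i) \<subseteq> adj (A i) \<odot> A i"
  by (rule closure_minimal[OF _ adj_A_A(2)]) (auto simp: core_product_def op_restrict_def)

lemma core_product_ge:
  assumes i: "i \<in> {1..n}" and x: "x \<in> K"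
  shows "(norm x)\<^sup>2 \<le> inner x (act_adj i (act i x))"
proof -
  have "(x, act i (act_adj i x)) \<in> A i \<odot> adj (A i)"
    using act_adj_K[OF i x] act_K(1)[OF i act_adj_K(2)[OF i x]] by (auto simp: op_comp_def)
  then have "0 \<le> inner x (act i (act_adj i x))" using A_adj_A_form by fastforce
  then show ?thesis using q_pos unfolding act_adj_act[OF i x] by (simp add: inner_add_right power2_norm_eq_inner)
qed

text \<open>The decisive step, in which essential selfadjointness of the sum \<open>\<Delta>\<close> controls each single
  summand. Orthogonality of \<open>y\<close> reads \<open>q \<langle>N\<^sub>i x, y\<rangle> = - 2 \<langle>x, y\<rangle>\<close>; for \<open>N\<^sub>j x\<close> in place of \<open>x\<close> the
  left-hand side vanishes, whence \<open>\<langle>N\<^sub>j x, y\<rangle> = 0\<close> and \<open>\<langle>\<Delta> x, y\<rangle> = (n - 2) \<langle>x, y\<rangle>\<close>.\<close>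
lemma no_defect:
  assumes i: "i \<in> {1..n}" and y: "\<And>x. x \<in> K \<Longrightarrow> cinner (x + act_adj i (act i x)) y = 0"
  shows "y = 0"
proof -
  let ?Delta = "op_restrict (op_sum (\<lambda>i. adj (A i) \<odot> A i) {1..n}) K"
  have Ni: "q * cinner (act i (act_adj i x)) y = - 2 * cinner x y" if x: "x \<in> K" for x
    using y[OF x] unfolding act_adj_act[OF i x]
    by (simp add: cinner_add_left cinner_scaleR_left algebra_simps add_eq_0_iff2 mult_2)
  have Nj: "cinner (act j (act_adj j x)) y = 0" if j: "j \<in> {1..n}" "j \<noteq> i" and x: "x \<in> K" for j x
  proof -
    let ?z = "act j (act_adj j x)"
    have z: "?z \<in> K" by (intro act_K(2) act_adj_K(2) j x)
    have "act_adj i ?z = 0" by (rule act_adj_act_off(2)[OF i j(1) j(2)[symmetric] act_adj_K(2)[OF j(1) x]])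
    moreover have "(0, act i 0) \<in> A i" using act_K(1)[OF i] K_subspace by (simp add: csubspace_def)
    then have "act i 0 = 0" using linear_op_single[OF lin[OF i] linear_op_zero[OF lin[OF i]]] by simp
    ultimately show ?thesis using Ni[OF z] by simp
  qed
  have Delta: "(x, w) \<in> ?Delta \<longleftrightarrow> x \<in> K \<and> w = (\<Sum>j\<in>{1..n}. act_adj j (act j x))" for x w
  proof -
    have m: "(x, act_adj j (act j x)) \<in> adj (A j) \<odot> A j" if "x \<in> K" "j \<in> {1..n}" for j
      using that core_product_mem[of j x "act_adj j (act j x)"] by (simp add: core_product_def op_restrict_def)
    have "w = (\<Sum>j\<in>{1..n}. act_adj j (act j x))"
      if x: "x \<in> K" and "w = (\<Sum>j\<in>{1..n}. z j)" "\<forall>j\<in>{1..n}. (x, z j) \<in> adj (A j) \<odot> A j" for z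
      unfolding that(2) using that(3) m[OF x] linear_op_single[OF adj_A_A(1)]
      by (intro sum.cong refl) blast
    moreover have "(x, \<Sum>j\<in>{1..n}. act_adj j (act j x)) \<in> op_sum (\<lambda>i. adj (A i) \<odot> A i) {1..n}" if "x \<in> K"
      unfolding op_sum_def using m[OF that] by (intro CollectI exI[of _ x] exI[of _ "\<lambda>j. act_adj j (act j x)"]) simp
    ultimately show ?thesis unfolding op_restrict_def by (auto simp: op_sum_def)
  qed
  have val: "cinner (\<Sum>j\<in>{1..n}. act_adj j (act j x)) y = (of_nat n - 2) * cinner x y" if x: "x \<in> K" for x
  proof -
    have "cinner (\<Sum>j\<in>{1..n}. act_adj j (act j x)) y = (\<Sum>j\<in>{1..n}. cinner (act_adj j (act j x)) y)"
      by (rule bounded_bilinear.sum_left[OF bounded_bilinear_cinner])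
    also have "\<dots> = (\<Sum>j\<in>{1..n}. cinner x y + (if j = i then - 2 * cinner x y else 0))"
      using Ni[OF x] Nj x by (intro sum.cong refl) (auto simp: act_adj_act[OF _ x] cinner_add_left cinner_scaleR_left)
    also have "\<dots> = of_nat n * cinner x y - 2 * cinner x y"
      using i by (simp add: sum.distrib sum.delta)
    finally show ?thesis by (simp add: algebra_simps)
  qed
  have "(y, (real n - 2) *\<^sub>R y) \<in> adj ?Delta"
  proof (rule adjI)
    fix x w assume "(x, w) \<in> ?Delta"
    then have x: "x \<in> K" and w: "w = (\<Sum>j\<in>{1..n}. act_adj j (act j x))" unfolding Delta by auto
    have "cinner y w = cnj (cinner w y)" by (rule cinner_commute)
    also have "\<dots> = (of_nat n - 2) * cnj (cinner x y)" unfolding w val[OF x] by simp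
    also have "\<dots> = cinner ((real n - 2) *\<^sub>R y) x"
      using cinner_commute[of y x] by (simp add: cinner_scaleR_left)
    finally show "cinner y w = cinner ((real n - 2) *\<^sub>R y) x" .
  qed
  \<comment> \<open>Essential selfadjointness turns this weak eigenvector into a limit of vectors of \<open>K\<close>, where
    the form of \<open>\<Delta>\<close> is at least \<open>n\<close>.\<close>
  then have "(y, (real n - 2) *\<^sub>R y) \<in> adj (closure ?Delta)" using adj_closure by blast
  then have "(y, (real n - 2) *\<^sub>R y) \<in> closure ?Delta"
    using esa by (simp add: ess_selfadjoint_on_def selfadjoint_def)
  from closure_pair[OF this] obtain x w
    where xw: "\<forall>k. (x k, w k) \<in> ?Delta" and lim: "x \<longlonglongrightarrow> y" "w \<longlonglongrightarrow> (real n - 2) *\<^sub>R y"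
    by blast
  have "real n * (norm (x k))\<^sup>2 \<le> inner (x k) (w k)" for k
  proof -
    have xk: "x k \<in> K" and wk: "w k = (\<Sum>j\<in>{1..n}. act_adj j (act j (x k)))" using spec[OF xw, of k] unfolding Delta by auto
    have "(\<Sum>j\<in>{1..n}. (norm (x k))\<^sup>2) \<le> (\<Sum>j\<in>{1..n}. inner (x k) (act_adj j (act j (x k))))"
      by (intro sum_mono core_product_ge xk)
    then show ?thesis by (simp add: wk inner_sum_right)
  qed
  moreover have "(\<lambda>k. real n * (norm (x k))\<^sup>2) \<longlonglongrightarrow> real n * (norm y)\<^sup>2"
    by (intro tendsto_intros lim)
  moreover have "(\<lambda>k. inner (x k) (w k)) \<longlonglongrightarrow> inner y ((real n - 2) *\<^sub>R y)"
    by (intro tendsto_intros lim)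
  ultimately have "real n * (norm y)\<^sup>2 \<le> inner y ((real n - 2) *\<^sub>R y)"
    by (intro LIMSEQ_le) auto
  then have "2 * (norm y)\<^sup>2 \<le> 0" by (simp add: power2_norm_eq_inner[symmetric] algebra_simps)
  then show ?thesis by simp
qed

lemma closure_core_product_onto:
  assumes i: "i \<in> {1..n}"
  shows "\<exists>x. (x, z - x) \<in> closure (core_product i)"
proof (rule positive_onto)
  show "linear_op (closure (core_product i))"
    using closure_core_product_subset[OF i] adj_A_A(1)[OF i] unfolding core_product_def
    by (intro linear_op_closure[OF linear_op_restrict] K_subspace) auto
  show "0 \<le> inner x y" if "(x, y) \<in> closure (core_product i)" for x y
    using adj_A_A_form closure_core_product_subset[OF i] that by blast
  show "y = 0" if "\<And>x w. (x, w) \<in> closure (core_product i) \<Longrightarrow> cinner (x + w) y = 0" for y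
  proof (rule no_defect[OF i])
    fix x assume "x \<in> K"
    then have "(x, act_adj i (act i x)) \<in> closure (core_product i)" using core_product_mem[OF i] closure_subset by blast
    then show "cinner (x + act_adj i (act i x)) y = 0" by (rule that)
  qed
qed simp

text \<open>So \<open>K\<close> is a core for \<open>A\<^sub>i\<^sup>* A\<^sub>i\<close>.\<close>
lemma closure_core_product: "i \<in> {1..n} \<Longrightarrow> closure (core_product i) = adj (A i) \<odot> A i"
  by (rule positive_maximal[OF adj_A_A(1) adj_A_A_form closure_core_product_subset closure_core_product_onto])

lemma product_positive_selfadjoint:
  assumes i: "i \<in> {1..n}"
  shows "positive_selfadjoint (adj (A i) \<odot> A i)"
proof
  show "cinner x v = cinner y u" if "(x, y) \<in> adj (A i) \<odot> A i" "(u, v) \<in> adj (A i) \<odot> A i" for x y u v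
  proof -
    obtain s t where "(x, s) \<in> A i" "(s, y) \<in> adj (A i)" "(u, t) \<in> A i" "(t, v) \<in> adj (A i)"
      using \<open>(x, y) \<in> _\<close> \<open>(u, v) \<in> _\<close> by (auto simp: op_comp_def)
    then show ?thesis using adjD adjD' by metis
  qed
  show "\<exists>x. (x, z - x) \<in> adj (A i) \<odot> A i" for z
    using closure_core_product_onto[OF i] by (simp add: closure_core_product[OF i])
qed (use adj_A_A(1)[OF i] adj_A_A_form in auto)

text \<open>The right-hand side is closed and positive and extends \<open>A\<^sub>i\<^sup>* A\<^sub>i\<close> from the core \<open>K\<close>, hence
  everywhere; maximality gives equality.\<close>
lemma commutation_relation:
  assumes i: "i \<in> {1..n}"
  shows "adj (A i) \<odot> A i = Id \<oplus> complex_of_real q \<cdot> (A i \<odot> adj (A i))"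
proof (rule positive_maximal)
  let ?R = "Id \<oplus> complex_of_real q \<cdot> (A i \<odot> adj (A i))"
  note N = A_adj_A(1)[OF i]
  show "linear_op ?R"
    unfolding linear_op_def
  proof (intro conjI allI impI)
    show "single_valued ?R"
      by (rule single_valuedI) (auto simp: Id_plus_mem dest: linear_op_single[OF N])
    show "(0, 0) \<in> ?R" unfolding Id_plus_mem using linear_op_zero[OF N] by force
    show "(x + u, y + v) \<in> ?R" if xy: "(x, y) \<in> ?R" and uv: "(u, v) \<in> ?R" for x y u v
    proof -
      obtain z z' where "(x, z) \<in> A i \<odot> adj (A i)" "y = x + q *\<^sub>R z" "(u, z') \<in> A i \<odot> adj (A i)" "v = u + q *\<^sub>R z'"
        using xy uv unfolding Id_plus_mem by blast
      then show ?thesis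
        unfolding Id_plus_mem using linear_op_add[OF N, of x z u z']
        by (intro exI[of _ "z + z'"]) (simp add: algebra_simps)
    qed
    show "(scaleC c x, scaleC c y) \<in> ?R" if xy: "(x, y) \<in> ?R" for c x y
    proof -
      obtain z where "(x, z) \<in> A i \<odot> adj (A i)" "y = x + q *\<^sub>R z" using xy unfolding Id_plus_mem by blast
      then show ?thesis
        unfolding Id_plus_mem using linear_op_scale[OF N, of x z c]
        by (intro exI[of _ "scaleC c z"]) (simp add: scaleC_add_right scaleC_scaleR)
    qed
  qed
  show "0 \<le> inner x y" if xy: "(x, y) \<in> ?R" for x y
  proof -
    obtain z where z: "(x, z) \<in> A i \<odot> adj (A i)" "y = x + q *\<^sub>R z" using xy unfolding Id_plus_mem by blast
    then have "0 \<le> inner x z" using A_adj_A_form by fastforce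
    then show ?thesis using q_pos by (simp add: z(2) inner_add_right)
  qed
  have "closed ?R"
  proof (rule closed_pairI)
    fix x y u v assume xy: "\<And>k. (x k, y k) \<in> ?R" and lim: "x \<longlonglongrightarrow> u" "y \<longlonglongrightarrow> v"
    have "(x k, (1 / q) *\<^sub>R (y k - x k)) \<in> A i \<odot> adj (A i)" for k
    proof -
      obtain z where "(x k, z) \<in> A i \<odot> adj (A i)" "y k = x k + q *\<^sub>R z" using xy[of k] unfolding Id_plus_mem by blast
      then show ?thesis using q_pos by simp
    qed
    then have "(u, (1 / q) *\<^sub>R (v - u)) \<in> A i \<odot> adj (A i)"
      by (rule closed_pairD[OF A_adj_A(2)[OF i] _ lim(1)]) (intro tendsto_intros lim)
    then show "(u, v) \<in> ?R"
      unfolding Id_plus_mem using q_pos by (intro exI[of _ "(1 / q) *\<^sub>R (v - u)"]) simp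
  qed
  moreover have "core_product i \<subseteq> ?R" unfolding core_product_def rel[OF i] by (auto simp: op_restrict_def)
  ultimately have "closure (core_product i) \<subseteq> ?R" by (intro closure_minimal)
  then show "adj (A i) \<odot> A i \<subseteq> ?R" by (simp add: closure_core_product[OF i])
  show "\<exists>x. (x, z - x) \<in> adj (A i) \<odot> A i" for z
    using closure_core_product_onto[OF i] by (simp add: closure_core_product[OF i])
qed

text \<open>A vector \<open>y\<close> in the range of \<open>A\<^sub>i\<close> is orthogonal to \<open>N\<^sub>j K\<close>, so \<open>A\<^sub>j\<^sup>* A\<^sub>j y = y\<close> by selfadjointness
  with core \<open>K\<close>. Then \<open>N\<^sub>j y = 0\<close>, hence \<open>A\<^sub>j\<^sup>* y = 0\<close>.\<close>
lemma range_orthogonal: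
  assumes i: "i \<in> {1..n}" and j: "j \<in> {1..n}" and ij: "i \<noteq> j" and xy: "(x, y) \<in> A i" and uv: "(u, v) \<in> A j"
  shows "cinner y v = 0"
proof -
  interpret J: positive_selfadjoint "adj (A j) \<odot> A j" by (rule product_positive_selfadjoint[OF j])
  have "(y, y) \<in> adj (core_product j)"
  proof (rule adjI)
    fix z w assume "(z, w) \<in> core_product j"
    then have z: "z \<in> K" and w: "w = act_adj j (act j z)" using core_product_mem[OF j] by auto
    have "(act j (act_adj j z), 0) \<in> adj (A i)" by (rule act_adj_act_off(1)[OF i j ij act_adj_K(2)[OF j z]])
    from adjD'[OF this xy] show "cinner y w = cinner y z"
      by (simp add: w act_adj_act[OF j z] cinner_add_right cinner_scaleR_right)
  qed
  then have "(y, y) \<in> adj (A j) \<odot> A j"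
    using adj_closure[of "core_product j"] J.adj_subset unfolding closure_core_product[OF j] by blast
  then obtain z where z: "(y, z) \<in> A j \<odot> adj (A j)" "y = y + q *\<^sub>R z"
    unfolding commutation_relation[OF j] Id_plus_mem by blast
  then have "z = 0" using q_pos by simp
  then obtain s where s: "(y, s) \<in> adj (A j)" "inner y z = (norm s)\<^sup>2" using A_adj_A_form[OF z(1)] by blast
  then have "s = 0" using \<open>z = 0\<close> by simp
  then show ?thesis using adjD[OF s(1) uv] by simp
qed

text \<open>If \<open>z = v + A\<^sub>i\<^sup>* A\<^sub>i v = 2 v + q N\<^sub>i v\<close>, then \<open>v - z/2\<close> is in the range of \<open>A\<^sub>i\<close>. So the
  symmetric operators \<open>(1 + A\<^sub>i\<^sup>* A\<^sub>i)\<^sup>-\<^sup>1 - 1/2\<close> have orthogonal ranges, hence product zero.\<close>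
lemma resolvents_commute:
  assumes i: "i \<in> {1..n}" and j: "j \<in> {1..n}"
  shows "positive_selfadjoint.resolvent (adj (A i) \<odot> A i) (positive_selfadjoint.resolvent (adj (A j) \<odot> A j) x) =
    positive_selfadjoint.resolvent (adj (A j) \<odot> A j) (positive_selfadjoint.resolvent (adj (A i) \<odot> A i) x)"
proof (cases "i = j")
  case False
  interpret I: positive_selfadjoint "adj (A i) \<odot> A i" by (rule product_positive_selfadjoint[OF i])
  interpret J: positive_selfadjoint "adj (A j) \<odot> A j" by (rule product_positive_selfadjoint[OF j])
  define P where "P z = I.resolvent z - (1/2) *\<^sub>R z" for z
  define Q where "Q z = J.resolvent z - (1/2) *\<^sub>R z" for z
  have ran: "\<exists>v w. (v, w) \<in> A k \<and> positive_selfadjoint.resolvent (adj (A k) \<odot> A k) z - (1/2) *\<^sub>R z = (- (q/2)) *\<^sub>R w"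
    if k: "k \<in> {1..n}" for k z
  proof -
    interpret T: positive_selfadjoint "adj (A k) \<odot> A k" by (rule product_positive_selfadjoint[OF k])
    have "(T.resolvent z, z - T.resolvent z) \<in> adj (A k) \<odot> A k" by (rule T.resolvent_mem)
    then obtain w where w: "(T.resolvent z, w) \<in> A k \<odot> adj (A k)" "z - T.resolvent z = T.resolvent z + q *\<^sub>R w"
      unfolding commutation_relation[OF k] Id_plus_mem by blast
    then have "z = 2 *\<^sub>R T.resolvent z + q *\<^sub>R w" by (simp add: scaleR_2 algebra_simps)
    then have "(1/2) *\<^sub>R z = (1/2) *\<^sub>R (2 *\<^sub>R T.resolvent z + q *\<^sub>R w)" by simp
    then have "T.resolvent z - (1/2) *\<^sub>R z = (- (q/2)) *\<^sub>R w" by (simp add: scaleR_add_right)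
    then show ?thesis using w(1) by (auto simp: op_comp_def)
  qed
  have orth: "cinner (P y) (Q z) = 0" for y z
    using ran[OF i, of y] ran[OF j, of z] range_orthogonal[OF i j False]
    by (auto simp: P_def Q_def cinner_scaleR_left cinner_scaleR_right cinner_minus_left cinner_minus_right)
  have symP: "cinner (P y) z = cinner y (P z)" and symQ: "cinner (Q y) z = cinner y (Q z)" for y z
    by (simp_all add: P_def Q_def cinner_diff_left cinner_diff_right cinner_scaleR_left cinner_scaleR_right I.C_sym J.C_sym)
  have "cinner (P (Q x)) (P (Q x)) = 0" using orth[of "P (Q x)" x] symP[of "P (Q x)" "Q x"]
    by (metis symP)
  then have PQ: "P (Q x) = 0" by (simp add: cinner_self)
  have "cinner (Q (P x)) (Q (P x)) = 0" using orth[of x "Q (P x)"] symQ[of "P x" "Q (P x)"] by simp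
  then have QP: "Q (P x) = 0" by (simp add: cinner_self)
  have 1: "I.resolvent (J.resolvent x) = (1/2) *\<^sub>R I.resolvent x + (1/2) *\<^sub>R J.resolvent x - (1/4) *\<^sub>R x"
  proof -
    have "I.resolvent (Q x) = (1/2) *\<^sub>R Q x" using PQ by (simp add: P_def)
    moreover have "J.resolvent x = (1/2) *\<^sub>R x + Q x" by (simp add: Q_def)
    ultimately have "I.resolvent (J.resolvent x) = (1/2) *\<^sub>R I.resolvent x + (1/2) *\<^sub>R Q x" by (simp add: I.C_add I.C_scaleR)
    then show ?thesis by (simp add: Q_def scaleR_diff_right)
  qed
  have 2: "J.resolvent (I.resolvent x) = (1/2) *\<^sub>R I.resolvent x + (1/2) *\<^sub>R J.resolvent x - (1/4) *\<^sub>R x"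
  proof -
    have "J.resolvent (P x) = (1/2) *\<^sub>R P x" using QP by (simp add: Q_def)
    moreover have "I.resolvent x = (1/2) *\<^sub>R x + P x" by (simp add: P_def)
    ultimately have "J.resolvent (I.resolvent x) = (1/2) *\<^sub>R J.resolvent x + (1/2) *\<^sub>R P x" by (simp add: J.C_add J.C_scaleR)
    then show ?thesis by (simp add: P_def scaleR_diff_right)
  qed
  show ?thesis using 1 2 by simp
qed simp

lemma op_abs_eq:
  assumes i: "i \<in> {1..n}"
  shows "op_abs (A i) = positive_contraction.fgraph (positive_selfadjoint.resolvent (adj (A i) \<odot> A i)) (sqrt \<circ> unresolvent)"
  unfolding op_abs_def by (rule positive_selfadjoint.borel_calculus_eq[OF product_positive_selfadjoint[OF i]]) simp

lemma abs_positive_selfadjoint: "i \<in> {1..n} \<Longrightarrow> positive_selfadjoint (op_abs (A i))"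
  unfolding op_abs_eq by (rule positive_selfadjoint.positive_selfadjoint_sqrt[OF product_positive_selfadjoint])

lemma abs_square: "i \<in> {1..n} \<Longrightarrow> op_abs (A i) \<odot> op_abs (A i) = adj (A i) \<odot> A i"
  unfolding op_abs_eq by (rule positive_selfadjoint.fgraph_sqrt_square[OF product_positive_selfadjoint])

text \<open>Commutation of the resolvents of \<open>A\<^sub>i\<^sup>* A\<^sub>i\<close> and \<open>A\<^sub>j\<^sup>* A\<^sub>j\<close> passes to their square roots one index at a
  time.\<close>
theorem abs_commute:
  assumes i: "i \<in> {1..n}" and j: "j \<in> {1..n}"
  shows "spectral_projections_commute (op_abs (A i)) (op_abs (A j))"
proof (rule resolvents_commute_imp_spectral[OF abs_positive_selfadjoint[OF i] abs_positive_selfadjoint[OF j]])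
  interpret I: positive_selfadjoint "adj (A i) \<odot> A i" by (rule product_positive_selfadjoint[OF i])
  interpret J: positive_selfadjoint "adj (A j) \<odot> A j" by (rule product_positive_selfadjoint[OF j])
  interpret I': positive_selfadjoint "op_abs (A i)" by (rule abs_positive_selfadjoint[OF i])
  fix x
  have 1: "J.resolvent (I'.resolvent z) = I'.resolvent (J.resolvent z)" for z
    unfolding op_abs_eq[OF i]
    by (rule I.commute_sqrt_resolvent[OF J.C_bounded_linear resolvents_commute[OF j i]])
  show "I'.resolvent (positive_selfadjoint.resolvent (op_abs (A j)) x) = positive_selfadjoint.resolvent (op_abs (A j)) (I'.resolvent x)"
    unfolding op_abs_eq[OF j]
    by (rule J.commute_sqrt_resolvent[OF I'.C_bounded_linear 1[symmetric]])
qed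

end

section \<open>The polar decomposition\<close>

locale polar_family = operator_family +
  fixes S :: "nat \<Rightarrow> 'a oper"
  assumes polar: "i \<in> {1..n} \<Longrightarrow> polar_decomposition (A i) (S i)"
begin

lemma S_linear: "i \<in> {1..n} \<Longrightarrow> linear_op (S i)"
  using polar by (simp add: polar_decomposition_def partial_isometry_def bounded_op_def)

lemma S_total: "i \<in> {1..n} \<Longrightarrow> Domain (S i) = UNIV"
  using polar by (simp add: polar_decomposition_def partial_isometry_def bounded_op_def)

lemma A_eq: "i \<in> {1..n} \<Longrightarrow> A i = S i \<odot> op_abs (A i)"
  using polar by (simp add: polar_decomposition_def)

text \<open>Because \<open>|A\<^sub>i|\<^sup>2 = 1 + q A\<^sub>i A\<^sub>i\<^sup>* \<ge> 1\<close>.\<close>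
lemma kernel_abs:
  assumes i: "i \<in> {1..n}" and u: "(u, 0) \<in> op_abs (A i)"
  shows "u = 0"
proof -
  have "(0, 0) \<in> op_abs (A i)" using abs_positive_selfadjoint[OF i] by (intro linear_op_zero positive_selfadjoint.linear)
  then have "(u, 0) \<in> Id \<oplus> complex_of_real q \<cdot> (A i \<odot> adj (A i))"
    using u commutation_relation[OF i] abs_square[OF i] by (auto simp: op_comp_def)
  then obtain z where z: "(u, z) \<in> A i \<odot> adj (A i)" "0 = u + q *\<^sub>R z" unfolding Id_plus_mem by blast
  have "0 \<le> inner u z" using A_adj_A_form[OF z(1)] by auto
  moreover have "inner u (u + q *\<^sub>R z) = 0" by (simp flip: z(2))
  ultimately have "inner u u \<le> 0" using q_pos by (simp add: inner_add_right) (smt (verit) mult_nonneg_nonneg)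
  then show ?thesis using inner_ge_zero[of u] by (metis antisym inner_eq_zero_iff)
qed

definition isom where "isom i x = op_val (S i) x"

lemma S_mem: "i \<in> {1..n} \<Longrightarrow> (x, y) \<in> S i \<longleftrightarrow> y = isom i x"
  unfolding isom_def using op_val_mem[OF S_linear, of i x] op_val_eq[OF S_linear, of i x y] S_total[of i] by auto

lemma isom_linear:
  assumes "i \<in> {1..n}"
  shows "isom i (x + y) = isom i x + isom i y" "isom i (scaleC c x) = scaleC c (isom i x)"
  unfolding isom_def using assms by (auto intro!: op_val_add op_val_scaleC S_linear simp: S_total)

text \<open>The initial space of \<open>S\<^sub>i\<close> is the whole space, because \<open>|A\<^sub>i|\<close> has no kernel.\<close>
lemma isom_norm:
  assumes i: "i \<in> {1..n}"
  shows "norm (isom i x) = norm x"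
proof -
  have "op_kernel (S i) \<subseteq> {0}"
    using polar[OF i] kernel_abs[OF i] by (auto simp: polar_decomposition_def op_kernel_def)
  then have "\<forall>u\<in>op_kernel (S i). cinner u x = 0" by auto
  moreover have "(x, isom i x) \<in> S i" by (simp add: S_mem[OF i])
  ultimately show ?thesis
    using polar[OF i] unfolding polar_decomposition_def partial_isometry_def by fastforce
qed

lemma isom_bounded_linear:
  assumes i: "i \<in> {1..n}"
  shows "bounded_linear (isom i)"
proof (rule bounded_linear_intro[of _ 1])
  show "isom i (r *\<^sub>R x) = r *\<^sub>R isom i x" for r x
    using isom_linear(2)[OF i, of "of_real r"] by (simp add: scaleC_of_real)
qed (simp_all add: isom_linear[OF i] isom_norm[OF i])

lemma isom_cinner:
  assumes i: "i \<in> {1..n}"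
  shows "cinner (isom i x) (isom i y) = cinner x y"
proof -
  have "cinner (isom i x) (isom i y) - cinner x y = 0"
    by (rule sesquilinear_zero[where V = UNIV and B = "\<lambda>x y. cinner (isom i x) (isom i y) - cinner x y"])
       (simp_all add: csubspace_def isom_linear[OF i] cinner_add_left cinner_add_right cinner_scaleC_left
         cinner_scaleC_right cinner_self isom_norm[OF i] right_diff_distrib)
  then show ?thesis by simp
qed

lemma adj_S: "i \<in> {1..n} \<Longrightarrow> (x, y) \<in> adj (S i) \<longleftrightarrow> (\<forall>u. cinner x (isom i u) = cinner y u)"
  by (auto simp: adj_def S_mem)

lemma range_abs_dense:
  assumes i: "i \<in> {1..n}"
  shows "closure (Range (op_abs (A i))) = UNIV"
proof -
  interpret B: positive_selfadjoint "op_abs (A i)" by (rule abs_positive_selfadjoint[OF i])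
  show ?thesis
  proof (rule dense_if_no_orthogonal)
    show "csubspace (Range (op_abs (A i)))"
      unfolding csubspace_def
      by (auto intro: linear_op_zero[OF B.linear] linear_op_add[OF B.linear] linear_op_scale[OF B.linear])
    fix y assume y: "\<forall>u\<in>Range (op_abs (A i)). cinner u y = 0"
    have "(y, 0) \<in> adj (op_abs (A i))"
    proof (rule adjI)
      fix x w assume "(x, w) \<in> op_abs (A i)"
      then have "cinner w y = 0" using y by blast
      then show "cinner y w = cinner 0 x" using cinner_commute[of y w] by simp
    qed
    then show "y = 0" using B.adj_subset kernel_abs[OF i] by blast
  qed
qed

theorem isometry_relations:
  assumes i: "i \<in> {1..n}" and j: "j \<in> {1..n}"
  shows "adj (S i) \<odot> S j = (if i = j then 1 else 0) \<cdot> Id"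
proof -
  have orth: "cinner (isom j x) (isom i u) = (if i = j then cinner x u else 0)" for x u
  proof (cases "i = j")
    case True
    then show ?thesis by (simp add: isom_cinner[OF j])
  next
    case False
    have "x \<in> closure (Range (op_abs (A j)))" "u \<in> closure (Range (op_abs (A i)))"
      using range_abs_dense i j by auto
    then obtain y v where y: "\<And>k. y k \<in> Range (op_abs (A j))" "y \<longlonglongrightarrow> x"
      and v: "\<And>k. v k \<in> Range (op_abs (A i))" "v \<longlonglongrightarrow> u"
      unfolding closure_sequential by metis
    have "isom k w \<in> Range (A k)" if "k \<in> {1..n}" "w \<in> Range (op_abs (A k))" for k w
    proof -
      obtain z where "(z, w) \<in> op_abs (A k)" using \<open>w \<in> _\<close> by blast
      moreover have "(w, isom k w) \<in> S k" using that by (simp add: S_mem)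
      ultimately have "(z, isom k w) \<in> S k \<odot> op_abs (A k)" by (auto simp: op_comp_def)
      then show ?thesis using A_eq[OF that(1)] by auto
    qed
    then have "isom j (y k) \<in> Range (A j)" "isom i (v k) \<in> Range (A i)" for k using y v i j by auto
    then have "cinner (isom j (y k)) (isom i (v k)) = 0" for k
      using range_orthogonal[OF j i False[symmetric]] by blast
    moreover have "(\<lambda>k. cinner (isom j (y k)) (isom i (v k))) \<longlonglongrightarrow> cinner (isom j x) (isom i u)"
      by (intro tendsto_cinner bounded_linear.tendsto[OF isom_bounded_linear] i j y v)
    ultimately show ?thesis using False by (simp add: LIMSEQ_const_iff)
  qed
  have "(x, y) \<in> adj (S i) \<odot> S j \<longleftrightarrow> y = (if i = j then x else 0)" for x y
  proof -
    have "(x, y) \<in> adj (S i) \<odot> S j \<longleftrightarrow> (\<forall>u. cinner (isom j x) (isom i u) = cinner y u)"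
      unfolding op_comp_def relcomp_unfold by (simp add: S_mem[OF j] adj_S[OF i])
    also have "\<dots> \<longleftrightarrow> (\<forall>u. cinner ((if i = j then x else 0) - y) u = 0)"
      unfolding orth by (auto simp: cinner_diff_left)
    also have "\<dots> \<longleftrightarrow> (if i = j then x else 0) - y = 0"
      by (metis cinner_self cinner_zero_left of_real_eq_0_iff norm_eq_zero power_eq_0_iff)
    finally show ?thesis by auto
  qed
  then show ?thesis by (auto simp: op_scale_def)
qed

text \<open>The square of \<open>D\<^sub>i = S\<^sub>i |A\<^sub>i| S\<^sub>i\<^sup>*\<close> (see \<open>D_square\<close>).\<close>
definition conj_product where "conj_product i = S i \<odot> (adj (A i) \<odot> A i) \<odot> adj (S i)"

lemma conj_product_mem: "i \<in> {1..n} \<Longrightarrow> (x, y) \<in> conj_product i \<longleftrightarrow> (\<exists>u v. (x, u) \<in> adj (S i) \<and> (u, v) \<in> adj (A i) \<odot> A i \<and> y = isom i v)"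
  unfolding conj_product_def op_comp_def[of "S i"] op_comp_def[of "adj (A i) \<odot> A i" "adj (S i)"]
  by (auto simp: relcomp_unfold S_mem)

text \<open>To solve \<open>x + S T S\<^sup>* x = z\<close>, decompose \<open>z = S u + w\<close> with \<open>w\<close> orthogonal to the range of the
  isometry \<open>S\<close> and take \<open>x = S (1 + T)\<^sup>-\<^sup>1 u + w\<close>.\<close>
lemma conj_product_positive_selfadjoint:
  assumes i: "i \<in> {1..n}"
  shows "positive_selfadjoint (conj_product i)"
proof
  interpret T: positive_selfadjoint "adj (A i) \<odot> A i" by (rule product_positive_selfadjoint[OF i])
  note m = conj_product_mem[OF i] and adjs = adj_S[OF i]
  have "linear_op (adj (S i))" using S_total[OF i] by (intro linear_op_adj) simp
  then show "linear_op (conj_product i)" unfolding conj_product_def by (intro linear_op_comp S_linear T.linear i)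
  show "cinner x v = cinner y u" if xy: "(x, y) \<in> conj_product i" and uv: "(u, v) \<in> conj_product i" for x y u v
  proof -
    obtain p r where p: "(x, p) \<in> adj (S i)" "(p, r) \<in> adj (A i) \<odot> A i" "y = isom i r" using xy m by blast
    obtain p' r' where p': "(u, p') \<in> adj (S i)" "(p', r') \<in> adj (A i) \<odot> A i" "v = isom i r'" using uv m by blast
    have "cinner x v = cinner p r'" using p p' adjs by simp
    also have "\<dots> = cinner r p'" by (rule T.symmetric[OF p(2) p'(2)])
    also have "\<dots> = cinner y u"
      using p'(1) p(3) adjs cinner_commute[of r p'] cinner_commute[of y u] by simp
    finally show ?thesis .
  qed
  show "0 \<le> inner x y" if xy: "(x, y) \<in> conj_product i" for x y
  proof -
    obtain p r where p: "(x, p) \<in> adj (S i)" "(p, r) \<in> adj (A i) \<odot> A i" "y = isom i r" using xy m by blast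
    have "inner x y = inner p r" using p adjs by (simp flip: Re_cinner)
    then show ?thesis using T.positive[OF p(2)] by simp
  qed
  show "\<exists>x. (x, z - x) \<in> conj_product i" for z
  proof -
    have sub: "csubspace (range (isom i))"
      unfolding csubspace_def
    proof (intro conjI ballI allI)
      show "0 \<in> range (isom i)" using isom_linear(2)[OF i, of 0 0] by (intro range_eqI[of _ _ 0]) simp
    next
      fix x y assume "x \<in> range (isom i)" "y \<in> range (isom i)"
      then show "x + y \<in> range (isom i)" by (auto simp flip: isom_linear(1)[OF i])
    next
      fix c x assume "x \<in> range (isom i)"
      then show "scaleC c x \<in> range (isom i)" by (auto simp flip: isom_linear(2)[OF i])
    qed
    have clo: "closed (range (isom i))"
      unfolding closed_sequential_limits
    proof (intro allI impI)
      fix y l assume y: "(\<forall>k. y k \<in> range (isom i)) \<and> y \<longlonglongrightarrow> l"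
      then have "\<forall>k. \<exists>x. y k = isom i x" by blast
      from choice[OF this] obtain x where x: "\<And>k. y k = isom i (x k)" by blast
      have "norm (x k - x m) = norm (y k - y m)" for k m
        using isom_norm[OF i, of "x k - x m"] bounded_linear.linear[OF isom_bounded_linear[OF i]]
        by (simp add: x linear_diff)
      moreover have "Cauchy y" using y by (auto intro: LIMSEQ_imp_Cauchy)
      ultimately have "Cauchy x" by (simp add: Cauchy_iff)
      then obtain c where c: "x \<longlonglongrightarrow> c" using Cauchy_convergent convergent_def by blast
      have "y \<longlonglongrightarrow> isom i c" unfolding x by (intro bounded_linear.tendsto[OF isom_bounded_linear[OF i]] c)
      then show "l \<in> range (isom i)" using y LIMSEQ_unique by blast
    qed
    obtain u where u: "\<forall>r. cinner (isom i r) (z - isom i u) = 0"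
      using orthogonal_decomposition[OF sub clo, of z] by auto
    define w where "w = z - isom i u"
    have w: "cinner w (isom i r) = 0" for r using u cinner_commute[of w "isom i r"] by (simp add: w_def)
    have "(isom i (T.resolvent u) + w, T.resolvent u) \<in> adj (S i)"
      by (simp add: adjs cinner_add_left w isom_cinner[OF i])
    then have "(isom i (T.resolvent u) + w, isom i (u - T.resolvent u)) \<in> conj_product i" using T.resolvent_mem[of u] m by blast
    moreover have "isom i (u - T.resolvent u) = z - (isom i (T.resolvent u) + w)"
      using bounded_linear.linear[OF isom_bounded_linear[OF i]] by (simp add: w_def linear_diff)
    ultimately show ?thesis by metis
  qed
qed

lemma abs_formal:
  assumes i: "i \<in> {1..n}" and xu: "(x, u) \<in> adj (S i)" and ub: "(u, v) \<in> op_abs (A i)"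
  shows "(x, v) \<in> adj (A i)"
proof (rule adjI)
  interpret B: positive_selfadjoint "op_abs (A i)" by (rule abs_positive_selfadjoint[OF i])
  fix p r assume "(p, r) \<in> A i"
  then have "(p, r) \<in> S i \<odot> op_abs (A i)" using A_eq[OF i] by simp
  then obtain t where t: "(p, t) \<in> op_abs (A i)" "r = isom i t"
    by (auto simp: op_comp_def S_mem[OF i])
  have "cinner x r = cinner u t" using xu by (simp add: t(2) adj_S[OF i])
  also have "\<dots> = cinner v p" by (rule B.symmetric[OF ub t(1)])
  finally show "cinner x r = cinner v p" .
qed

lemma conj_product_eq:
  assumes i: "i \<in> {1..n}"
  shows "conj_product i = A i \<odot> adj (A i)"
proof (rule positive_maximal[OF A_adj_A(1)[OF i]])
  show "0 \<le> inner x y" if "(x, y) \<in> A i \<odot> adj (A i)" for x y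
    using A_adj_A_form[OF that] by auto
  show "conj_product i \<subseteq> A i \<odot> adj (A i)"
  proof
    fix p assume "p \<in> conj_product i"
    then obtain x u v where p: "p = (x, isom i v)" "(x, u) \<in> adj (S i)" "(u, v) \<in> adj (A i) \<odot> A i"
      using conj_product_mem[OF i] by (cases p) auto
    then obtain t where t: "(u, t) \<in> op_abs (A i)" "(t, v) \<in> op_abs (A i)"
    proof -
      have "(u, v) \<in> op_abs (A i) \<odot> op_abs (A i)" using p(3) unfolding abs_square[OF i] .
      then show ?thesis using that by (auto simp: op_comp_def)
    qed
    have "(x, t) \<in> adj (A i)" by (rule abs_formal[OF i p(2) t(1)])
    moreover have "(v, isom i v) \<in> S i" by (simp add: S_mem[OF i])
    with t(2) have "(t, isom i v) \<in> S i \<odot> op_abs (A i)" by (auto simp: op_comp_def)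
    then have "(t, isom i v) \<in> A i" using A_eq[OF i] by simp
    ultimately show "p \<in> A i \<odot> adj (A i)" by (auto simp: op_comp_def p(1))
  qed
  show "\<exists>x. (x, z - x) \<in> conj_product i" for z by (rule positive_selfadjoint.onto[OF conj_product_positive_selfadjoint[OF i]])
qed

lemma D_square:
  assumes i: "i \<in> {1..n}" and D: "D = S i \<odot> op_abs (A i) \<odot> adj (S i)"
  shows "D \<odot> D = conj_product i"
proof -
  have id: "S i O adj (S i) = Id"
    using isometry_relations[OF i i] by (auto simp: op_comp_def op_scale_def)
  have sq: "op_abs (A i) O op_abs (A i) = A i O adj (A i)"
    using abs_square[OF i] by (simp add: op_comp_def)
  have "D \<odot> D = adj (S i) O op_abs (A i) O (S i O adj (S i)) O op_abs (A i) O S i"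
    unfolding D op_comp_def by (simp only: O_assoc)
  also have "\<dots> = adj (S i) O (op_abs (A i) O op_abs (A i)) O S i"
    unfolding id by (simp only: O_assoc Id_O_R)
  also have "\<dots> = conj_product i"
    unfolding sq conj_product_def op_comp_def by (simp only: O_assoc)
  finally show ?thesis .
qed

text \<open>The isometry \<open>S\<^sub>i\<close> intertwines the resolvents of \<open>A\<^sub>i\<^sup>* A\<^sub>i = 1 + q D\<^sup>2\<close> and of \<open>D\<^sup>2\<close>. For bounded
  \<open>f\<close> both sides are everywhere defined, so the resulting inclusion is an equality.\<close>
theorem calculus_intertwines:
  assumes i: "i \<in> {1..n}" and D: "D = S i \<odot> op_abs (A i) \<odot> adj (S i)"
    and f [measurable]: "f \<in> borel_measurable borel" and bd: "bounded (range f)"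
  shows "borel_calculus f (D \<odot> D) \<odot> S i = S i \<odot> borel_calculus f (Id \<oplus> complex_of_real q \<cdot> (D \<odot> D))"
proof -
  interpret T: positive_selfadjoint "adj (A i) \<odot> A i" by (rule product_positive_selfadjoint[OF i])
  interpret G: positive_selfadjoint "conj_product i" by (rule conj_product_positive_selfadjoint[OF i])
  have "isom i (T.resolvent z) = G.resolvent (isom i z)" for z
  proof -
    have "(isom i (T.resolvent z), T.resolvent z) \<in> adj (S i)" by (simp add: adj_S[OF i] isom_cinner[OF i])
    then have "(isom i (T.resolvent z), isom i (z - T.resolvent z)) \<in> conj_product i" using T.resolvent_mem[of z] conj_product_mem[OF i] by blast
    from G.resolvent_eq[OF this] show ?thesis
      using isom_linear(1)[OF i, of "T.resolvent z" "z - T.resolvent z"] by simp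
  qed
  then interpret intertwining T.resolvent G.resolvent "isom i"
    by (intro intertwining.intro intertwining_axioms.intro T.positive_contraction_axioms
        G.positive_contraction_axioms isom_bounded_linear i)
  obtain B where B: "\<And>t. \<bar>f t\<bar> \<le> B" using bd by (auto simp: bounded_iff)
  have fh: "f \<circ> unresolvent \<in> borel_measurable borel" by measurable
  have dT: "x \<in> T.fdom (f \<circ> unresolvent)" and dG: "x \<in> G.fdom (f \<circ> unresolvent)" for x
    using B by (auto intro!: T.fdom_bounded[OF fh, of B] G.fdom_bounded[OF fh, of B])
  have "D \<odot> D = conj_product i" by (rule D_square[OF i D])
  moreover have "Id \<oplus> complex_of_real q \<cdot> conj_product i = adj (A i) \<odot> A i"
    unfolding conj_product_eq[OF i] by (rule commutation_relation[OF i, symmetric])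
  moreover have "G.fgraph (f \<circ> unresolvent) \<odot> S i = S i \<odot> T.fgraph (f \<circ> unresolvent)"
  proof -
    have "(x, y) \<in> G.fgraph (f \<circ> unresolvent) \<longleftrightarrow> y = G.fcalc (f \<circ> unresolvent) x" "(x, y) \<in> T.fgraph (f \<circ> unresolvent) \<longleftrightarrow> y = T.fcalc (f \<circ> unresolvent) x" for x y
      using dG dT by (auto simp: G.fgraph_def T.fgraph_def)
    then show ?thesis
      using S_fcalc[OF fh dT] unfolding op_comp_def[of "G.fgraph (f \<circ> unresolvent)"] op_comp_def[of "S i"]
      by (auto simp: S_mem[OF i] relcomp_unfold)
  qed
  ultimately show ?thesis by (simp add: G.borel_calculus_eq[OF f] T.borel_calculus_eq[OF f])
qed

end

theorem theorem3:
  fixes q :: real and n :: nat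
    and A S D :: "nat \<Rightarrow> 'a::complex_hilbert oper"
  assumes q: "0 < q" "q < 1"
    and n: "n \<ge> 1"
    and rep: "well_behaved_rep q n A"
    and polar: "\<And>i. i \<in> {1..n} \<Longrightarrow> polar_decomposition (A i) (S i)"
    and D: "\<And>i. i \<in> {1..n} \<Longrightarrow> D i = S i \<odot> op_abs (A i) \<odot> adj (S i)"
  shows "(\<forall>i\<in>{1..n}. \<forall>f :: real \<Rightarrow> real. f \<in> borel_measurable borel \<longrightarrow> bounded (range f) \<longrightarrow>
            borel_calculus f (D i \<odot> D i) \<odot> S i =
            S i \<odot> borel_calculus f (Id \<oplus> complex_of_real q \<cdot> (D i \<odot> D i)))
       \<and> (\<forall>i\<in>{1..n}. \<forall>j\<in>{1..n}. spectral_projections_commute (op_abs (A i)) (op_abs (A j)))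
       \<and> (\<forall>i\<in>{1..n}. \<forall>j\<in>{1..n}. adj (S i) \<odot> S j = (if i = j then 1 else 0) \<cdot> Id)"
proof -
  obtain K where K: "csubspace K" "closure K = UNIV"
      "\<forall>i\<in>{1..n}. invariant_under K (A i) \<and> invariant_under K (adj (A i))"
      "\<forall>i\<in>{1..n}. op_restrict (adj (A i) \<odot> A i) K =
           op_restrict (Id \<oplus> complex_of_real q \<cdot> (A i \<odot> adj (A i))) K"
      "\<forall>i\<in>{1..n}. \<forall>j\<in>{1..n}. i \<noteq> j \<longrightarrow> op_restrict (adj (A i) \<odot> A j) K = op_restrict (0 \<cdot> Id) K"
      "ess_selfadjoint_on (op_sum (\<lambda>i. adj (A i) \<odot> A i) {1..n}) K"
    using rep unfolding well_behaved_rep_def by (elim conjE exE)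
  interpret polar_family q n A K S
  proof
    show "linear_op (A i)" "closed (A i)" if "i \<in> {1..n}" for i
      using rep that unfolding well_behaved_rep_def by auto
  qed (use q K polar in auto)
  have "borel_calculus f (D i \<odot> D i) \<odot> S i = S i \<odot> borel_calculus f (Id \<oplus> complex_of_real q \<cdot> (D i \<odot> D i))"
    if "i \<in> {1..n}" "f \<in> borel_measurable borel" "bounded (range f)" for i f
    by (rule calculus_intertwines[OF that(1) D[OF that(1)] that(2,3)])
  then show ?thesis using abs_commute isometry_relations by simp
qed

end
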